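(* Let $G$ be a group. Whenever $\mathcal{E}(G)$ is finitely presented, $\delta_{\mathcal{E}(G)}(n)\preceq\max\{n^4,\ \delta_G(n)^2\}$.
   Context: For a group $G$, let $\overline{G}$ be a second copy of $G$ with a fixed isomorphism $g\mapsto\overline{g}$. In the free product $G\ast\overline{G}$ let $\mathcal{D}=[G,\overline{G}]$ and $\mathcal{L}=\langle\{g^{-1}\overline{g}\mid g\in G\}\rangle$. Define $\mathcal{E}(G)=\langle G,\overline{G}\mid[\mathcal{D},\mathcal{L}]=1\rangle$, i.e. the quotient of $G\ast\overline{G}$ by the normal closure of all commutators $[x,y]$ with $x\in\mathcal{D}$, $y\in\mathcal{L}$. It is known that $\mathcal{E}(G)$ is finitely presented if and only if $G$ is finitely presented and $G/[G,G]$ is finite. Dehn functions: for a finite presentation $\langle X\mid R\rangle$ of a group $\Gamma$ and a word $w$ in the free group $F(X)$ with $w=1$ in $\Gamma$, ${\rm Area}(w)$ is the least $M$ such that $w=\prod_{i=1}^M\theta_i^{-1}r_i\theta_i$ in $F(X)$ with $r_i\in R\cup R^{-1}$, $\theta_i\in F(X)$; the Dehn function is $\delta_\Gamma(n)=\max\{{\rm Area}(w)\mid w=_\Gamma 1,\ |w|\le n\}$. For $f,g:\mathbb{N}\to\mathbb{N}$, $f\preceq g$ means there is a positive integer $C$ with $f(n)\le C g(Cn+C)+Cn+C$ for all $n$; $f\simeq g$ means $f\preceq g$ and $g\preceq f$. The Dehn function is independent of the finite presentation up to $\simeq$. *)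

theory Defs
  imports "HOL-Algebra.Generated_Groups"
begin

section \<open>Free groups\<close>

text \<open>A letter is a generator together with a sign: \<open>(x, True)\<close> stands for \<open>x\<close> and
  \<open>(x, False)\<close> for the formal inverse of \<open>x\<close>.\<close>

type_synonym 'x word = "('x \<times> bool) list"

definition inv_letter :: "'x \<times> bool \<Rightarrow> 'x \<times> bool" where
  "inv_letter a = (fst a, \<not> snd a)"

definition reduced :: "'x word \<Rightarrow> bool" where
  "reduced = successively (\<lambda>a b. b \<noteq> inv_letter a)"

fun cancel_cons :: "'x \<times> bool \<Rightarrow> 'x word \<Rightarrow> 'x word" where
  "cancel_cons a [] = [a]"
| "cancel_cons a (b # w) = (if b = inv_letter a then w else a # b # w)"

definition reduce :: "'x word \<Rightarrow> 'x word" where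
  "reduce w = foldr cancel_cons w []"

text \<open>The free group is modelled on reduced words, so the word length of an element is the
  length of the list.\<close>

definition free_group :: "'x set \<Rightarrow> 'x word monoid" where
  "free_group X = \<lparr>carrier = {w. fst ` set w \<subseteq> X \<and> reduced w},
                   mult = (\<lambda>u v. reduce (u @ v)), one = []\<rparr>"


section \<open>Commutators, normal closures and presentations\<close>

definition commutator :: "('a, 'b) monoid_scheme \<Rightarrow> 'a \<Rightarrow> 'a \<Rightarrow> 'a" where
  "commutator G x y = inv\<^bsub>G\<^esub> x \<otimes>\<^bsub>G\<^esub> inv\<^bsub>G\<^esub> y \<otimes>\<^bsub>G\<^esub> x \<otimes>\<^bsub>G\<^esub> y"

definition commutator_subgroup :: "('a, 'b) monoid_scheme \<Rightarrow> 'a set \<Rightarrow> 'a set \<Rightarrow> 'a set" where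
  "commutator_subgroup G A B = generate G {commutator G x y | x y. x \<in> A \<and> y \<in> B}"

definition normal_closure :: "('a, 'b) monoid_scheme \<Rightarrow> 'a set \<Rightarrow> 'a set" where
  "normal_closure G S =
     generate G {inv\<^bsub>G\<^esub> t \<otimes>\<^bsub>G\<^esub> s \<otimes>\<^bsub>G\<^esub> t | s t. s \<in> S \<and> t \<in> carrier G}"

definition presented_group :: "'x set \<Rightarrow> 'x word set \<Rightarrow> 'x word set monoid" where
  "presented_group X R = free_group X Mod normal_closure (free_group X) R"

definition finite_presentation ::
    "'x set \<Rightarrow> 'x word set \<Rightarrow> ('a, 'b) monoid_scheme \<Rightarrow> bool" where
  "finite_presentation X R G \<longleftrightarrow>
     finite X \<and> finite R \<and> R \<subseteq> carrier (free_group X) \<and> presented_group X R \<cong> G"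

text \<open>The type of generators is irrelevant for existence, because the generating set is finite.\<close>

definition finitely_presented :: "('a, 'b) monoid_scheme \<Rightarrow> bool" where
  "finitely_presented G \<longleftrightarrow> (\<exists>(X :: nat set) R. finite_presentation X R G)"


section \<open>Free products and the group \<open>\<E>(G)\<close>\<close>

text \<open>The free product of \<open>G\<close> and \<open>H\<close> is presented by the disjoint union of the two carriers,
  subject to the multiplication tables of \<open>G\<close> and \<open>H\<close>.  The relators
  \<open>x y (x y)\<^sup>-\<^sup>1\<close> have to be reduced, since for instance \<open>x\<close> may be the neutral element.\<close>

definition table_relators ::
    "('a, 'b) monoid_scheme \<Rightarrow> ('c, 'd) monoid_scheme \<Rightarrow> ('a + 'c) word set" where
  "table_relators G H =
     {reduce [(Inl x, True), (Inl y, True), (Inl (x \<otimes>\<^bsub>G\<^esub> y), False)] | x y.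
        x \<in> carrier G \<and> y \<in> carrier G} \<union>
     {reduce [(Inr x, True), (Inr y, True), (Inr (x \<otimes>\<^bsub>H\<^esub> y), False)] | x y.
        x \<in> carrier H \<and> y \<in> carrier H}"

definition free_product ::
    "('a, 'b) monoid_scheme \<Rightarrow> ('c, 'd) monoid_scheme \<Rightarrow> ('a + 'c) word set monoid" where
  "free_product G H = presented_group (carrier G <+> carrier H) (table_relators G H)"

definition free_product_gen ::
    "('a, 'b) monoid_scheme \<Rightarrow> ('c, 'd) monoid_scheme \<Rightarrow> 'a + 'c \<Rightarrow> ('a + 'c) word set" where
  "free_product_gen G H z =
     (let F = free_group (carrier G <+> carrier H)
      in normal_closure F (table_relators G H) #>\<^bsub>F\<^esub> [(z, True)])"

text \<open>In the free product of \<open>G\<close> with itself, the left factor is \<open>G\<close> and the right factor is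
  the second copy of \<open>G\<close>.\<close>

abbreviation copy1 :: "('a, 'b) monoid_scheme \<Rightarrow> 'a \<Rightarrow> ('a + 'a) word set" where
  "copy1 G g \<equiv> free_product_gen G G (Inl g)"

abbreviation copy2 :: "('a, 'b) monoid_scheme \<Rightarrow> 'a \<Rightarrow> ('a + 'a) word set" where
  "copy2 G g \<equiv> free_product_gen G G (Inr g)"

definition D_subgroup :: "('a, 'b) monoid_scheme \<Rightarrow> ('a + 'a) word set set" where
  "D_subgroup G =
     commutator_subgroup (free_product G G) (copy1 G ` carrier G) (copy2 G ` carrier G)"

definition L_subgroup :: "('a, 'b) monoid_scheme \<Rightarrow> ('a + 'a) word set set" where
  "L_subgroup G = generate (free_product G G)
     {inv\<^bsub>free_product G G\<^esub> (copy1 G g) \<otimes>\<^bsub>free_product G G\<^esub> copy2 G g | g. g \<in> carrier G}"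

definition E_group :: "('a, 'b) monoid_scheme \<Rightarrow> ('a + 'a) word set set monoid" where
  "E_group G = free_product G G Mod
     normal_closure (free_product G G)
       {commutator (free_product G G) x y | x y. x \<in> D_subgroup G \<and> y \<in> L_subgroup G}"


section \<open>Dehn functions\<close>

definition conj_product :: "'x set \<Rightarrow> ('x word \<times> 'x word) list \<Rightarrow> 'x word" where
  "conj_product X ps =
     foldr (\<lambda>(r, t) u. (inv\<^bsub>free_group X\<^esub> t \<otimes>\<^bsub>free_group X\<^esub> r \<otimes>\<^bsub>free_group X\<^esub> t) \<otimes>\<^bsub>free_group X\<^esub> u)
       ps \<one>\<^bsub>free_group X\<^esub>"

definition area :: "'x set \<Rightarrow> 'x word set \<Rightarrow> 'x word \<Rightarrow> nat" where
  "area X R w = (LEAST M. \<exists>ps. length ps = M \<and>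
     (\<forall>(r, t) \<in> set ps. r \<in> R \<union> (\<lambda>s. inv\<^bsub>free_group X\<^esub> s) ` R \<and> t \<in> carrier (free_group X)) \<and>
     w = conj_product X ps)"

text \<open>The coset of \<open>w\<close> is the image of \<open>w\<close> in the presented group.  For finite \<open>X\<close> the maximum
  is over a finite set, which contains the area of the empty word.\<close>

definition dehn :: "'x set \<Rightarrow> 'x word set \<Rightarrow> nat \<Rightarrow> nat" where
  "dehn X R n = Max {area X R w | w. w \<in> carrier (free_group X) \<and>
     normal_closure (free_group X) R #>\<^bsub>free_group X\<^esub> w = \<one>\<^bsub>presented_group X R\<^esub> \<and>
     length w \<le> n}"

definition dehn_le :: "(nat \<Rightarrow> nat) \<Rightarrow> (nat \<Rightarrow> nat) \<Rightarrow> bool"  (infix \<open>\<preceq>\<close> 50) where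
  "f \<preceq> g \<longleftrightarrow> (\<exists>C > 0. \<forall>n. f n \<le> C * g (C * n + C) + C * n + C)"

end

theory Submission
  imports Defs
begin

text \<open>Let \<open>Z\<close> be the kernel of the map \<open>\<E>(G) \<rightarrow> G\<^sup>3\<close> whose coordinates kill the second copy of
  \<open>G\<close>, kill the first copy, and identify the two copies.  An element of \<open>Z\<close> lies in the images of
  both \<open>\<D>\<close> and \<open>\<L>\<close>, so \<open>Z\<close> is abelian and is centralized by the preimage of \<open>[G, G]\<^sup>3\<close>.
  If \<open>G/[G, G]\<close> were infinite, a family of permutation representations in which any given finite
  set of the relations \<open>[d, l] = 1\<close> almost always holds would show that \<open>\<E>(G)\<close> is not finitely
  presented; so \<open>[G, G]\<^sup>3\<close> has finite index.  A word of length \<open>n\<close> that is trivial in \<open>\<E>(G)\<close> has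
  area \<open>O(n\<^sup>2 + \<delta>\<^sub>G(n))\<close> over the image in \<open>G\<^sup>3\<close>.  Each relator used there is, in \<open>\<E>(G)\<close>, one of
  finitely many elements of \<open>Z\<close>, and moving it to the end of the word costs at most the length of
  the word.  What remains is a trivial word of length \<open>O(n\<^sup>2 + \<delta>\<^sub>G(n))\<close> in a finitely generated
  abelian group, which has quadratic area.\<close>

section \<open>Words\<close>

text \<open>That the kernel is centralized by the preimage of \<open>[G, G]^3\<close> rests on the
  identity \<open>[g, h] = (lgen h)^g * dcom g h * (lgen h)^-1\<close> in the first copy of G: its
  factors lie in \<open>LL\<close> or \<open>DD\<close>, and an element of the kernel commutes with
  both. Hence a conjugate of a kernel element depends only on a coset of \<open>[G, G]^3\<close>,
  and finitely many words, the tokens, name all conjugates that occur. The obstacle is length.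
  Moving a token costs the length of the word that it crosses, and a derivation with few relators
  may pass through very long words, because insertions of cancelling pairs are free. Fillings are
  therefore brought into a form in which a word grows only by inserted relators
  (\<open>fill\<close>), and this form must be shown to be insensitive to free reduction
  (\<open>fill_reduce\<close>). Moreover the image in the cube of G need not be everything, so the
  letters of a filling need not come from E(G); they are rewritten along cosets. The term n^2 pays
  for sorting letters by coordinate; squaring comes from moving k relators through words whose
  length is linear in n + k.\<close>

definition winv :: "'x word \<Rightarrow> 'x word" where
  "winv w = rev (map inv_letter w)"

definition signed :: "('x \<Rightarrow> 'y word) \<Rightarrow> 'x \<times> bool \<Rightarrow> 'y word" where
  "signed f a = (if snd a then f (fst a) else winv (f (fst a)))"

definition subst :: "('x \<Rightarrow> 'y word) \<Rightarrow> 'x word \<Rightarrow> 'y word" where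
  "subst f w = concat (map (signed f) w)"

definition words :: "'x set \<Rightarrow> 'x word set" where
  "words X = {w. fst ` set w \<subseteq> X}"

lemma inv_letter_inv_letter [simp]: "inv_letter (inv_letter a) = a"
  by (simp add: inv_letter_def)

lemma inv_letter_eq_iff: "inv_letter a = b \<longleftrightarrow> a = inv_letter b"
  by auto

lemma fst_inv_letter [simp]: "fst (inv_letter a) = fst a"
  by (simp add: inv_letter_def)

lemma snd_inv_letter [simp]: "snd (inv_letter a) = (\<not> snd a)"
  by (simp add: inv_letter_def)

lemma winv_Nil [simp]: "winv [] = []"
  by (simp add: winv_def)

lemma winv_Cons [simp]: "winv (a # w) = winv w @ [inv_letter a]"
  by (simp add: winv_def)

lemma winv_append [simp]: "winv (u @ v) = winv v @ winv u"
  by (simp add: winv_def)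

lemma winv_winv [simp]: "winv (winv w) = w"
  by (induction w) auto

lemma length_winv [simp]: "length (winv w) = length w"
  by (simp add: winv_def)

lemma winv_in_words [simp]: "winv w \<in> words X \<longleftrightarrow> w \<in> words X"
  by (auto simp: words_def winv_def image_image)

lemma words_Nil [simp]: "[] \<in> words X"
  by (simp add: words_def)

lemma words_Cons [simp]: "a # w \<in> words X \<longleftrightarrow> fst a \<in> X \<and> w \<in> words X"
  by (simp add: words_def)

lemma words_append [simp]: "u @ v \<in> words X \<longleftrightarrow> u \<in> words X \<and> v \<in> words X"
  by (auto simp: words_def)

lemma signed_inv_letter [simp]: "signed f (inv_letter a) = winv (signed f a)"
  by (simp add: signed_def)

lemma subst_Nil [simp]: "subst f [] = []"
  by (simp add: subst_def)

lemma subst_Cons [simp]: "subst f (a # w) = signed f a @ subst f w"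
  by (simp add: subst_def)

lemma subst_append [simp]: "subst f (u @ v) = subst f u @ subst f v"
  by (simp add: subst_def)

lemma subst_winv [simp]: "subst f (winv w) = winv (subst f w)"
  by (induction w) auto

lemma subst_in_words: "w \<in> words X \<Longrightarrow> (\<And>x. x \<in> X \<Longrightarrow> f x \<in> words Y) \<Longrightarrow> subst f w \<in> words Y"
  by (induction w) (auto simp: signed_def)

lemma length_subst_le:
  "w \<in> words X \<Longrightarrow> (\<And>x. x \<in> X \<Longrightarrow> length (f x) \<le> c) \<Longrightarrow> length (subst f w) \<le> c * length w"
proof (induction w)
  case (Cons a w)
  then have "length (signed f a) \<le> c" "length (subst f w) \<le> c * length w"
    by (auto simp: signed_def)
  then show ?case by simp
qed simp

lemma finite_words_le: "finite X \<Longrightarrow> finite {w \<in> words X. length w \<le> n}"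
proof -
  assume "finite X"
  then have "finite {w. set w \<subseteq> X \<times> (UNIV :: bool set) \<and> length w \<le> n}"
    by (intro finite_lists_length_le) auto
  moreover have "{w \<in> words X. length w \<le> n} \<subseteq> {w. set w \<subseteq> X \<times> (UNIV :: bool set) \<and> length w \<le> n}"
    by (auto simp: words_def)
  ultimately show ?thesis by (rule finite_subset[rotated])
qed


section \<open>Counting the relators used in a derivation\<close>

text \<open>\<open>k\<close> bounds the number of conjugates of relators and of their inverses by
  which \<open>u\<close> and \<open>v\<close> differ; the inverses come from \<open>eqv_sym\<close>.
  Words are not kept reduced, so that substitutions act on derivations letter by letter.\<close>

inductive eqv :: "'x word set \<Rightarrow> nat \<Rightarrow> 'x word \<Rightarrow> 'x word \<Rightarrow> bool" for P where
  eqv_refl: "eqv P 0 u u"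
| eqv_cancel: "eqv P 0 (u @ a # inv_letter a # v) (u @ v)"
| eqv_relator: "r \<in> P \<Longrightarrow> eqv P 1 (u @ r @ v) (u @ v)"
| eqv_sym: "eqv P k u v \<Longrightarrow> eqv P k v u"
| eqv_trans: "eqv P k u v \<Longrightarrow> eqv P l v w \<Longrightarrow> eqv P (k + l) u w"
| eqv_weaken: "eqv P k u v \<Longrightarrow> k \<le> l \<Longrightarrow> eqv P l u v"

lemma eqv_trans': "eqv P k u v \<Longrightarrow> eqv P l v w \<Longrightarrow> k + l \<le> m \<Longrightarrow> eqv P m u w"
  using eqv_trans eqv_weaken by blast

lemma eqv_reflI [simp]: "eqv P k u u"
  using eqv_refl eqv_weaken by blast

lemma eqv_context: "eqv P k u v \<Longrightarrow> eqv P k (x @ u @ y) (x @ v @ y)"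
proof (induction rule: eqv.induct)
  case (eqv_cancel u a v)
  show ?case using eqv.eqv_cancel[of P "x @ u" a "v @ y"] by simp
next
  case (eqv_relator r u v)
  then show ?case using eqv.eqv_relator[of r P "x @ u" "v @ y"] by simp
qed (auto intro: eqv.intros)

lemma eqv_append: "eqv P k u v \<Longrightarrow> eqv P l u' v' \<Longrightarrow> eqv P (k + l) (u @ u') (v @ v')"
  using eqv_trans[OF eqv_context[of P k u v "[]" u', simplified] eqv_context[of P l u' v' v "[]", simplified]] by simp

lemma eqv_append_left: "eqv P k u v \<Longrightarrow> eqv P k (x @ u) (x @ v)"
  using eqv_context[of P k u v x "[]"] by simp

lemma eqv_append_right: "eqv P k u v \<Longrightarrow> eqv P k (u @ x) (v @ x)"
  using eqv_context[of P k u v "[]" x] by simp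

lemma eqv_winv_left_cancel: "eqv P 0 (u @ winv x @ x @ v) (u @ v)"
proof (induction x arbitrary: u v)
  case (Cons a x)
  have "eqv P 0 (u @ winv x @ [inv_letter a, inv_letter (inv_letter a)] @ x @ v) (u @ winv x @ x @ v)"
    using eqv_cancel[of P "u @ winv x" "inv_letter a" "x @ v"] by simp
  then show ?case using eqv_trans[OF _ Cons[of u v]] by simp
qed simp

lemma eqv_winv_right_cancel: "eqv P 0 (u @ x @ winv x @ v) (u @ v)"
  using eqv_winv_left_cancel[of P u "winv x" v] by simp

lemma eqv_move_winv: "eqv P k (winv x @ u) v \<longleftrightarrow> eqv P k u (x @ v)"
proof
  assume "eqv P k (winv x @ u) v"
  then have "eqv P k (x @ winv x @ u) (x @ v)" by (rule eqv_append_left)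
  with eqv_winv_right_cancel[of P "[]" x u] show "eqv P k u (x @ v)"
    using eqv_trans'[OF eqv_sym[OF eqv_winv_right_cancel[of P "[]" x u]]] by simp
next
  assume "eqv P k u (x @ v)"
  then have "eqv P k (winv x @ u) (winv x @ x @ v)" by (rule eqv_append_left)
  then show "eqv P k (winv x @ u) v"
    using eqv_trans'[OF _ eqv_winv_left_cancel[of P "[]" x v]] by simp
qed

lemma eqv_cancel_left: "eqv P k (q @ u) (q @ v) \<Longrightarrow> eqv P k u v"
proof -
  assume "eqv P k (q @ u) (q @ v)"
  then have "eqv P k (winv q @ q @ u) v" by (simp only: eqv_move_winv)
  with eqv_sym[OF eqv_winv_left_cancel[of P "[]" q u]] show "eqv P k u v"
    using eqv_trans by fastforce
qed

lemma eqv_winv: "eqv P k u v \<Longrightarrow> eqv P k (winv u) (winv v)"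
proof -
  assume "eqv P k u v"
  then have "eqv P k (winv u @ u @ winv v) (winv u @ v @ winv v)" by (intro eqv_context)
  then have "eqv P k (winv v) (winv u @ v @ winv v)"
    using eqv_trans'[OF eqv_sym[OF eqv_winv_left_cancel[of P "[]" u "winv v"]]] by simp
  then have "eqv P k (winv v) (winv u)"
    using eqv_trans'[OF _ eqv_winv_right_cancel[of P "winv u" v "[]"]] by simp
  then show ?thesis by (rule eqv_sym)
qed

text \<open>A substitution turns a cancelling pair into a word followed by its inverse, which is
  free; only the relator steps are charged.\<close>

lemma eqv_subst:
  assumes "\<And>r. r \<in> P \<Longrightarrow> eqv Q c (subst f r) []"
  shows "eqv P k u v \<Longrightarrow> eqv Q (c * k) (subst f u) (subst f v)"
proof (induction rule: eqv.induct)
  case (eqv_cancel u a v)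
  show ?case using eqv_winv_right_cancel[of Q "subst f u" "signed f a" "subst f v"] by simp
next
  case (eqv_relator r u v)
  show ?case
    using eqv_context[OF assms[OF eqv_relator], of "subst f u" "subst f v"] by simp
next
  case (eqv_weaken k u v l)
  then show ?case by (meson eqv.eqv_weaken mult_le_mono2)
qed (auto intro: eqv_sym eqv_trans' simp: algebra_simps)

lemma eqv_reduce: "eqv P 0 w (reduce w)"
proof (induction w)
  case (Cons a w)
  have "eqv P 0 (a # v) (cancel_cons a v)" for v
    using eqv_cancel[of P "[]" a] by (cases v) auto
  moreover have "eqv P 0 (a # w) (a # reduce w)"
    using eqv_append_left[OF Cons, of "[a]"] by simp
  ultimately show ?case using eqv_trans' by (fastforce simp: reduce_def)
qed (simp add: reduce_def)


section \<open>Filling words by inserting relators\<close>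

text \<open>In contrast to \<^const>\<open>eqv\<close>, cancelling pairs are removed but never inserted, so a word that is
  being filled with \<open>k\<close> relators grows by at most their total length.\<close>

inductive fill :: "'x word set \<Rightarrow> nat \<Rightarrow> 'x word \<Rightarrow> bool" for R where
  fill_Nil: "fill R k []"
| fill_cancel: "fill R k (u @ v) \<Longrightarrow> fill R k (u @ a # inv_letter a # v)"
| fill_insert: "fill R k (u @ r @ v) \<Longrightarrow> r \<in> R \<Longrightarrow> fill R (Suc k) (u @ v)"

text \<open>The same moves in the opposite direction: \<open>fill\<close> leads from its word to the
  empty word, \<open>grow\<close> from the empty word to its word.\<close>

inductive grow :: "'x word set \<Rightarrow> nat \<Rightarrow> 'x word \<Rightarrow> bool" for R where
  grow_Nil: "grow R 0 []"
| grow_cancel: "grow R k (u @ a # inv_letter a # v) \<Longrightarrow> grow R k (u @ v)"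
| grow_insert: "grow R k (u @ v) \<Longrightarrow> r \<in> R \<Longrightarrow> grow R (Suc k) (u @ r @ v)"

definition cyclic_closed :: "'x word set \<Rightarrow> bool" where
  "cyclic_closed R \<longleftrightarrow> (\<forall>p q. p @ q \<in> R \<longrightarrow> q @ p \<in> R)"

lemma fill_mono: "fill R k w \<Longrightarrow> k \<le> l \<Longrightarrow> fill R l w"
proof (induction arbitrary: l rule: fill.induct)
  case (fill_insert k u r v)
  then obtain m where "l = Suc m" "k \<le> m" by (cases l) auto
  with fill_insert show ?case by (auto intro: fill.intros)
qed (auto intro: fill.intros)

lemma fill_context: "fill R k w \<Longrightarrow> fill R l (u @ v) \<Longrightarrow> fill R (k + l) (u @ w @ v)"
proof (induction rule: fill.induct)
  case (fill_Nil k)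
  then show ?case by (auto intro: fill_mono)
next
  case (fill_cancel k p q a)
  then show ?case using fill.fill_cancel[of R "k + l" "u @ p" "q @ v" a] by simp
next
  case (fill_insert k p r q)
  then show ?case using fill.fill_insert[of R "k + l" "u @ p" r "q @ v"] by simp
qed

lemma fill_append: "fill R k u \<Longrightarrow> fill R l v \<Longrightarrow> fill R (k + l) (u @ v)"
  using fill_context[of R k u l "[]" v] by simp

lemma fill_grow: "grow R j x \<Longrightarrow> fill R k (u @ x @ v) \<Longrightarrow> fill R (k + j) (u @ v)"
proof (induction arbitrary: k rule: grow.induct)
  case (grow_cancel j p a q)
  then show ?case using fill.fill_cancel[of R k "u @ p" "q @ v" a] by simp
next
  case (grow_insert j p q r)
  then show ?case using fill.fill_insert[of R k "u @ p" r "q @ v"] by fastforce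
qed simp

lemma grow_context: "grow R i z \<Longrightarrow> grow R j (u @ v) \<Longrightarrow> grow R (i + j) (u @ z @ v)"
proof (induction rule: grow.induct)
  case (grow_cancel k p a q)
  then show ?case using grow.grow_cancel[of R "k + j" "u @ p" a "q @ v"] by simp
next
  case (grow_insert k p q r)
  then show ?case using grow.grow_insert[of R "k + j" "u @ p" "q @ v" r] by simp
qed simp

text \<open>Allows a word that has grown in one gap to be cut open and regrown in another gap. The
  history of \<open>x\<close> is replayed on the rotated word; only a cut through a relator needs
  the closure of \<open>R\<close>.\<close>

lemma grow_cyclic:
  assumes R: "cyclic_closed R"
  shows "grow R j x \<Longrightarrow> x = p @ q \<Longrightarrow> grow R j (q @ p)"
proof (induction arbitrary: p q rule: grow.induct)
  case grow_Nil
  then show ?case by (auto intro: grow.intros)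
next
  case (grow_cancel k u a v)
  consider t where "p = u @ t" "v = t @ q" | t where "u = p @ t" "q = t @ v"
    using grow_cancel.prems by (auto simp: append_eq_append_conv2)
  then show ?case
  proof cases
    case 1
    then have "grow R k (q @ u @ a # inv_letter a # t)"
      using grow_cancel.IH[of "u @ a # inv_letter a # t" q] by simp
    then show ?thesis using grow.grow_cancel[of R k "q @ u" a t] 1 by simp
  next
    case 2
    then have "grow R k ((t @ a # inv_letter a # v) @ p)"
      using grow_cancel.IH[of p "t @ a # inv_letter a # v"] by simp
    then show ?thesis using grow.grow_cancel[of R k t a "v @ p"] 2 by simp
  qed
next
  case (grow_insert k u v r)
  consider t where "p = u @ r @ t" "v = t @ q"
    | s t where "p = u @ s" "r = s @ t" "q = t @ v"
    | t where "u = p @ t" "q = t @ r @ v"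
    using grow_insert.prems by (auto simp: append_eq_append_conv2)
  then show ?case
  proof cases
    case 1
    then show ?thesis
      using grow_insert.IH[of "u @ t" q] grow_insert.hyps
        grow.grow_insert[of R k "q @ u" t r] by simp
  next
    case 2
    \<comment> \<open>The cut falls inside the relator \<open>r = s @ t\<close>. The rotated history
      starts with the relator \<open>t @ s\<close>, and \<open>v @ u\<close> grows between its two
      halves.\<close>
    then have "t @ s \<in> R" using R grow_insert.hyps by (auto simp: cyclic_closed_def)
    then have "grow R 1 (t @ s)" using grow.grow_insert[of R 0 "[]" "[]" "t @ s"] grow_Nil[of R] by simp
    then have "grow R (k + 1) (t @ (v @ u) @ s)"
      using grow_context[of R k "v @ u" 1 t s] grow_insert.IH[of u v] by simp
    then show ?thesis using 2 by simp
  next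
    case 3
    then show ?thesis
      using grow_insert.IH[of p "t @ v"] grow_insert.hyps grow.grow_insert[of R k t "v @ p" r] by simp
  qed
qed

lemma pair_eq_append:
  "p @ c # d # q = l @ r \<Longrightarrow> (\<exists>t. l = p @ c # d # t \<and> q = t @ r) \<or>
     (l = p @ [c] \<and> r = d # q) \<or> (\<exists>t. p = l @ t \<and> r = t @ c # d # q)"
proof (induction l arbitrary: p)
  case (Cons x l)
  show ?case
  proof (cases p)
    case Nil
    then show ?thesis using Cons.prems by (cases l) auto
  next
    case (Cons y p')
    then show ?thesis using Cons.IH[of p'] Cons.prems by simp
  qed
qed simp

lemma append_eq_middle:
  "p @ q = u @ a # v \<Longrightarrow> (\<exists>t. u = p @ t \<and> q = t @ a # v) \<or> (\<exists>s. p = u @ a # s \<and> v = s @ q)"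
proof (induction u arbitrary: p)
  case Nil
  then show ?case by (cases p) auto
next
  case (Cons x u)
  show ?case
  proof (cases p)
    case (Cons y p')
    then show ?thesis using Cons.IH[of p'] Cons.prems by simp
  qed (use Cons in auto)
qed

text \<open>To delete the pair \<open>a\<close>, \<open>a\<^sup>-\<^sup>1\<close> one keeps aside the word \<open>x\<close> that has grown between its
  letters.  It is inserted only when a letter of the pair is cancelled by a letter outside; if \<open>x\<close>
  shrinks to the empty word, its relators are saved.\<close>

lemma fill_uncancel_grow:
  assumes R: "cyclic_closed R"
  shows "fill R k w \<Longrightarrow> w = u @ a # x @ inv_letter a # v \<Longrightarrow> grow R j x \<Longrightarrow> fill R (k + j) (u @ v)"
proof (induction arbitrary: u x v j rule: fill.induct)
  case fill_Nil
  then show ?case by simp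
next
  case (fill_insert k p r q)
  consider t where "u = p @ t" "q = t @ a # x @ inv_letter a # v"
    | s t where "p = u @ a # s" "x = s @ t" "q = t @ inv_letter a # v"
    | t where "p = u @ a # x @ inv_letter a # t" "v = t @ q"
  proof -
    from append_eq_middle[OF fill_insert.prems(1)] show ?thesis
    proof (elim disjE exE conjE)
      fix t assume "u = p @ t" "q = t @ a # x @ inv_letter a # v"
      then show ?thesis by (rule that(1))
    next
      fix s assume s: "p = u @ a # s" "x @ inv_letter a # v = s @ q"
      from append_eq_middle[OF s(2)[symmetric]] show ?thesis
      proof (elim disjE exE conjE)
        fix t assume "x = s @ t" "q = t @ inv_letter a # v"
        with s show ?thesis by (intro that(2))
      next
        fix t assume "s = x @ inv_letter a # t" "v = t @ q"
        with s show ?thesis by (intro that(3)) simp_all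
      qed
    qed
  qed
  then show ?case
  proof cases
    case 1
    then have "fill R (k + j) ((p @ r @ t) @ v)"
      using fill_insert.IH[of "p @ r @ t" x v j] fill_insert.prems(2) by simp
    then show ?thesis using fill.fill_insert[of R "k + j" p r "t @ v"] fill_insert.hyps 1 by simp
  next
    case 2
    then have "grow R (Suc j) (s @ r @ t)"
      using fill_insert.prems(2) fill_insert.hyps(2) grow.grow_insert by blast
    then have "fill R (k + Suc j) (u @ v)"
      using fill_insert.IH[of u "s @ r @ t" v "Suc j"] 2 by simp
    then show ?thesis by simp
  next
    case 3
    then have "fill R (k + j) (u @ (t @ r @ q))"
      using fill_insert.IH[of u x "t @ r @ q" j] fill_insert.prems(2) by simp
    then show ?thesis using fill.fill_insert[of R "k + j" "u @ t" r q] fill_insert.hyps 3 by simp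
  qed
next
  case (fill_cancel k p q b)
  have x: "grow R j x" by fact
  consider t where "u = p @ b # inv_letter b # t" "q = t @ a # x @ inv_letter a # v"
    | "u = p @ [b]" "a = inv_letter b" "q = x @ b # v"
    | y where "b = a" "p = u" "x = inv_letter a # y" "q = y @ inv_letter a # v"
    | "p = u" "b = a" "x = []" "q = v"
    | s t where "p = u @ a # s" "x = s @ b # inv_letter b # t" "q = t @ inv_letter a # v"
    | y where "x = y @ [a]" "b = a" "p = u @ a # y" "q = v"
    | "p = u @ a # x" "b = inv_letter a" "v = a # q"
    | t where "p = u @ a # x @ inv_letter a # t" "v = t @ b # inv_letter b # q"
  proof -
    from pair_eq_append[OF fill_cancel.prems(1)] show ?thesis
    proof (elim disjE exE conjE)
      fix t assume t: "p = u @ t" "a # x @ inv_letter a # v = t @ b # inv_letter b # q"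
      show ?thesis
      proof (cases t)
        case Nil
        then have "p = u" "b = a" "x @ inv_letter a # v = inv_letter b # q" using t by auto
        then show ?thesis
          using that(3)[of "tl x"] that(4) by (cases x) auto
      next
        case (Cons c s)
        then have "s @ b # inv_letter b # q = x @ inv_letter a # v" "c = a" using t(2) by auto
        from pair_eq_append[OF this(1)] this(2) Cons t(1) show ?thesis
        proof (elim disjE exE conjE)
          fix r assume "x = s @ b # inv_letter b # r" "q = r @ inv_letter a # v"
          then show ?thesis using that(5)[of s r] t(1) Cons \<open>c = a\<close> by simp
        next
          assume "x = s @ [b]" "inv_letter a # v = inv_letter b # q"
          then have "x = s @ [a]" "b = a" "q = v" using inv_letter_eq_iff[of a "inv_letter b"] by auto
          then show ?thesis using that(6)[of s] t(1) Cons \<open>c = a\<close> by simp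
        next
          fix r assume r: "s = x @ r" "inv_letter a # v = r @ b # inv_letter b # q"
          show ?thesis
          proof (cases r)
            case Nil
            then have "b = inv_letter a" "v = a # q" using r by auto
            then show ?thesis using that(7) r(1) t(1) Cons Nil \<open>c = a\<close> by simp
          next
            case (Cons d r')
            then have "d = inv_letter a" "v = r' @ b # inv_letter b # q" using r by auto
            then show ?thesis using that(8)[of r'] r(1) t(1) Cons \<open>t = c # s\<close> \<open>c = a\<close> by simp
          qed
        qed
      qed
    next
      assume "u = p @ [b]" "a # x @ inv_letter a # v = inv_letter b # q"
      then have "u = p @ [b]" "a = inv_letter b" "q = x @ b # v" by auto
      then show ?thesis by (rule that(2))
    next
      fix t assume "u = p @ b # inv_letter b # t" "q = t @ a # x @ inv_letter a # v"
      then show ?thesis by (rule that(1))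
    qed
  qed
  then show ?case
  proof cases
    case 1
    then have "fill R (k + j) ((p @ t) @ v)"
      using fill_cancel.IH[of "p @ t" x v j] x by simp
    then show ?thesis using fill.fill_cancel[of R "k + j" p "t @ v" b] 1 by simp
  next
    case 2
    then show ?thesis using fill_grow[OF x, of k p "b # v"] fill_cancel.hyps by simp
  next
    case 3
    \<comment> \<open>Cancelling \<open>a\<close> against the head of \<open>x\<close> has left
      \<open>u @ y @ inv_letter a # v\<close>. Growing the rotation of \<open>x\<close> between
      \<open>u\<close> and \<open>v\<close> yields exactly this word.\<close>
    then have "grow R j (y @ [inv_letter a])" using grow_cyclic[OF R x, of "[inv_letter a]" y] by simp
    then show ?thesis using fill_grow[of R j "y @ [inv_letter a]" k u v] fill_cancel.hyps 3 by simp
  next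
    case 4
    then show ?thesis using fill_mono[OF fill_cancel.hyps, of "k + j"] by simp
  next
    case 5
    then have "grow R j (s @ t)" using x grow.grow_cancel by blast
    then show ?thesis using fill_cancel.IH[of u "s @ t" v j] 5 by simp
  next
    case 6
    then have "grow R j (a # y)" using grow_cyclic[OF R x, of y "[a]"] by simp
    then show ?thesis using fill_grow[of R j "a # y" k u v] fill_cancel.hyps 6 by simp
  next
    case 7
    then show ?thesis using fill_grow[OF x, of k "u @ [a]" q] fill_cancel.hyps by simp
  next
    case 8
    then have "fill R (k + j) (u @ (t @ q))"
      using fill_cancel.IH[of u x "t @ q" j] x by simp
    then show ?thesis using fill.fill_cancel[of R "k + j" "u @ t" q b] 8 by simp
  qed
qed

lemma fill_uncancel:
  "cyclic_closed R \<Longrightarrow> fill R k (u @ a # inv_letter a # v) \<Longrightarrow> fill R k (u @ v)"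
  using fill_uncancel_grow[of R k _ u a "[]" v 0] grow_Nil by fastforce

text \<open>Area is measured on reduced words, while translated words are not reduced. By
  \<open>fill_uncancel\<close> neither direction changes the number of relators.\<close>

lemma fill_reduce: "cyclic_closed R \<Longrightarrow> fill R k (reduce w) \<longleftrightarrow> fill R k w"
proof -
  assume R: "cyclic_closed R"
  have step: "fill R k (u @ cancel_cons a v) \<longleftrightarrow> fill R k (u @ a # v)" for u a v
    by (cases v) (auto intro: fill_uncancel[OF R] fill_cancel)
  have "fill R k (u @ reduce w) \<longleftrightarrow> fill R k (u @ w)" for u
  proof (induction w arbitrary: u)
    case (Cons a w)
    have "fill R k (u @ reduce (a # w)) \<longleftrightarrow> fill R k (u @ a # reduce w)"
      using step by (simp add: reduce_def)
    then show ?case using Cons[of "u @ [a]"] by simp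
  qed (simp add: reduce_def)
  from this[of "[]"] show ?thesis by simp
qed

lemma fill_cancel_word: "fill R k (u @ v) \<Longrightarrow> fill R k (u @ x @ winv x @ v)"
proof (induction x arbitrary: u v)
  case (Cons a x)
  have "fill R k (u @ a # inv_letter a # v)" using Cons.prems by (rule fill_cancel)
  then show ?case using Cons.IH[of "u @ [a]" "inv_letter a # v"] by simp
qed simp

text \<open>Used to copy fillings over the generators of \<open>G\<close> into each coordinate of
  the cube of \<open>G\<close>.\<close>

lemma fill_subst:
  assumes "\<And>r. r \<in> R \<Longrightarrow> subst f r \<in> Q"
  shows "fill R k w \<Longrightarrow> fill Q k (subst f w)"
proof (induction rule: fill.induct)
  case (fill_cancel k u v a)
  then show ?case using fill_cancel_word[of Q k "subst f u" "subst f v" "signed f a"] by simp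
next
  case (fill_insert k u r v)
  then show ?case using fill.fill_insert[of Q k "subst f u" "subst f r" "subst f v"] assms by simp
qed (auto intro: fill.intros)


section \<open>Evaluating words in groups\<close>

definition ev_letter :: "('a, 'b) monoid_scheme \<Rightarrow> ('x \<Rightarrow> 'a) \<Rightarrow> 'x \<times> bool \<Rightarrow> 'a" where
  "ev_letter G f a = (if snd a then f (fst a) else inv\<^bsub>G\<^esub> f (fst a))"

primrec ev :: "('a, 'b) monoid_scheme \<Rightarrow> ('x \<Rightarrow> 'a) \<Rightarrow> 'x word \<Rightarrow> 'a" where
  "ev G f [] = \<one>\<^bsub>G\<^esub>"
| "ev G f (a # w) = ev_letter G f a \<otimes>\<^bsub>G\<^esub> ev G f w"

lemma ev_cong: "w \<in> words X \<Longrightarrow> (\<And>x. x \<in> X \<Longrightarrow> f x = g x) \<Longrightarrow> ev G f w = ev G g w"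
  by (induction w) (auto simp: ev_letter_def)

context group
begin

lemma ev_letter_closed [simp]: "f \<in> X \<rightarrow> carrier G \<Longrightarrow> fst a \<in> X \<Longrightarrow> ev_letter G f a \<in> carrier G"
  by (auto simp: ev_letter_def)

lemma ev_closed [simp]: "f \<in> X \<rightarrow> carrier G \<Longrightarrow> w \<in> words X \<Longrightarrow> ev G f w \<in> carrier G"
  by (induction w) auto

lemma ev_letter_inv: "f \<in> X \<rightarrow> carrier G \<Longrightarrow> fst a \<in> X \<Longrightarrow> ev_letter G f (inv_letter a) = inv (ev_letter G f a)"
  by (auto simp: ev_letter_def Pi_iff)

lemma ev_append: "f \<in> X \<rightarrow> carrier G \<Longrightarrow> u \<in> words X \<Longrightarrow> v \<in> words X \<Longrightarrow>
    ev G f (u @ v) = ev G f u \<otimes> ev G f v"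
  by (induction u) (auto simp: m_assoc)

lemma ev_winv: "f \<in> X \<rightarrow> carrier G \<Longrightarrow> w \<in> words X \<Longrightarrow> ev G f (winv w) = inv (ev G f w)"
  by (induction w) (auto simp: ev_append ev_letter_inv inv_mult_group)

lemma ev_signed:
  "f \<in> X \<rightarrow> carrier G \<Longrightarrow> g (fst a) \<in> words X \<Longrightarrow> ev G f (signed g a) = ev_letter G (\<lambda>x. ev G f (g x)) a"
  by (auto simp: signed_def ev_letter_def ev_winv)

lemma ev_subst:
  assumes f: "f \<in> X \<rightarrow> carrier G" and g: "\<And>y. y \<in> Y \<Longrightarrow> g y \<in> words X"
  shows "w \<in> words Y \<Longrightarrow> ev G f (subst g w) = ev G (\<lambda>y. ev G f (g y)) w"
proof (induction w)
  case (Cons a w)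
  have "signed g a \<in> words X" using g Cons.prems by (auto simp: signed_def)
  moreover have "subst g w \<in> words X" using subst_in_words[of w Y g X] g Cons.prems by auto
  ultimately show ?case using f g Cons by (simp add: ev_append ev_signed)
qed simp

lemma ev_hom:
  assumes "group H" and h: "h \<in> hom G H" and f: "f \<in> X \<rightarrow> carrier G"
  shows "w \<in> words X \<Longrightarrow> h (ev G f w) = ev H (\<lambda>x. h (f x)) w"
proof -
  interpret group_hom G H h using assms by (simp add: group_hom_def group_hom_axioms_def group_axioms)
  show "w \<in> words X \<Longrightarrow> h (ev G f w) = ev H (\<lambda>x. h (f x)) w"
  proof (induction w)
    case (Cons a w)
    then have "h (ev_letter G f a) = ev_letter H (\<lambda>x. h (f x)) a"
      using f by (auto simp: ev_letter_def Pi_iff)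
    with Cons f show ?case by simp
  qed simp
qed

lemma ev_cancel:
  assumes f: "f \<in> X \<rightarrow> carrier G" and "fst a \<in> X" "w \<in> words X"
  shows "ev_letter G f a \<otimes> (ev_letter G f (inv_letter a) \<otimes> ev G f w) = ev G f w"
proof -
  have "ev_letter G f a \<in> carrier G" "ev G f w \<in> carrier G" using assms by auto
  then show ?thesis using assms by (simp add: ev_letter_inv m_assoc[symmetric])
qed

lemma ev_reduce: "f \<in> X \<rightarrow> carrier G \<Longrightarrow> w \<in> words X \<Longrightarrow> reduce w \<in> words X \<and> ev G f (reduce w) = ev G f w"
proof (induction w)
  case (Cons a w)
  have "cancel_cons a v \<in> words X \<and> ev G f (cancel_cons a v) = ev_letter G f a \<otimes> ev G f v"
    if "v \<in> words X" for v
    using that Cons.prems ev_cancel[of f X a] by (cases v) auto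
  then show ?case using Cons by (simp add: reduce_def)
qed (simp add: reduce_def)

lemma ev_eqv:
  assumes f: "f \<in> UNIV \<rightarrow> carrier G" and P: "\<And>r. r \<in> P \<Longrightarrow> ev G f r = \<one>"
  shows "eqv P k u v \<Longrightarrow> ev G f u = ev G f v"
proof -
  have U: "w \<in> words UNIV" for w :: "'x word" by (simp add: words_def)
  have f': "f x \<in> carrier G" for x using f by auto
  show "eqv P k u v \<Longrightarrow> ev G f u = ev G f v"
  proof (induction rule: eqv.induct)
    case (eqv_cancel u a v)
    then show ?case using ev_cancel[OF f _ U] by (simp add: ev_append[OF f U U])
  next
    case (eqv_relator r u v)
    then show ?case using P by (simp add: ev_append[OF f U U] ev_closed[OF f U])
  qed auto
qed

end


section \<open>The free group\<close>

lemma reduced_cancel_cons: "reduced w \<Longrightarrow> reduced (cancel_cons a w)"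
  by (cases w) (auto simp: reduced_def successively_Cons)

lemma reduced_reduce [simp]: "reduced (reduce w)"
  by (induction w) (auto simp: reduce_def reduced_cancel_cons, simp add: reduced_def)

lemma reduced_ConsD: "reduced (a # w) \<Longrightarrow> reduced w"
  by (cases w) (auto simp: reduced_def successively_Cons)

lemma cancel_cons_reduced: "reduced (a # w) \<Longrightarrow> cancel_cons a w = a # w"
  by (cases w) (auto simp: reduced_def)

lemma reduce_reduced: "reduced w \<Longrightarrow> reduce w = w"
proof (induction w)
  case (Cons a w)
  then show ?case using cancel_cons_reduced[of a w] reduced_ConsD[of a w] by (simp add: reduce_def)
qed (simp add: reduce_def)

text \<open>Letters act on reduced words by mutually inverse permutations. This is van der Waerden's
  argument: words multiply by composing actions, and associativity follows without a confluence
  proof for free reduction.\<close>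

lemma cancel_cons_inverse: "reduced w \<Longrightarrow> cancel_cons a (cancel_cons (inv_letter a) w) = w"
proof (cases w)
  case (Cons b v)
  moreover assume "reduced w"
  ultimately show ?thesis using cancel_cons_reduced[of b v] by auto
qed simp

lemma reduce_append: "reduce (u @ v) = foldr cancel_cons u (reduce v)"
  by (simp add: reduce_def)

lemma foldr_cancel_cons_reduced: "reduced v \<Longrightarrow> reduced (foldr cancel_cons u v)"
  by (induction u) (auto simp: reduced_cancel_cons)

lemma foldr_cancel_cons_reduce:
  assumes "reduced v"
  shows "foldr cancel_cons (reduce u) v = foldr cancel_cons u v"
proof (induction u)
  case (Cons a u)
  have "foldr cancel_cons (cancel_cons a w) v = cancel_cons a (foldr cancel_cons w v)" for w
    using cancel_cons_inverse[of "foldr cancel_cons _ v" a] foldr_cancel_cons_reduced[OF assms]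
    by (cases w) auto
  then show ?case using Cons by (simp add: reduce_def)
qed (simp add: reduce_def)

lemma reduce_append_left: "reduce (reduce u @ v) = reduce (u @ v)"
  by (simp add: reduce_append foldr_cancel_cons_reduce)

lemma reduce_append_right: "reduce (u @ reduce v) = reduce (u @ v)"
  by (simp add: reduce_append reduce_reduced)

lemma reduce_in_words: "w \<in> words X \<Longrightarrow> reduce w \<in> words X"
proof (induction w)
  case (Cons a w)
  then show ?case by (cases "reduce w") (auto simp: reduce_def)
qed (simp add: reduce_def)

lemma length_reduce_le: "length (reduce w) \<le> length w"
proof (induction w)
  case (Cons a w)
  then show ?case by (cases "reduce w") (auto simp: reduce_def)
qed (simp add: reduce_def)

lemma reduce_winv_append: "reduce (winv u @ u @ v) = reduce v"
proof (induction u arbitrary: v)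
  case (Cons a u)
  have "reduce (winv u @ [inv_letter a, a] @ (u @ v)) = reduce (winv u @ (u @ v))"
    using cancel_cons_inverse[of "reduce (u @ v)" "inv_letter a"]
    by (simp add: foldr_cancel_cons_reduced reduce_append reduce_append[of u] reduce_def[of "_ # _"] flip: reduce_def)
  then show ?case using Cons by simp
qed simp

lemma carrier_free_group: "carrier (free_group X) = {w \<in> words X. reduced w}"
  by (auto simp: free_group_def words_def)

lemma mult_free_group: "u \<otimes>\<^bsub>free_group X\<^esub> v = reduce (u @ v)"
  by (simp add: free_group_def)

lemma one_free_group: "\<one>\<^bsub>free_group X\<^esub> = []"
  by (simp add: free_group_def)

lemma reduce_in_carrier: "w \<in> words X \<Longrightarrow> reduce w \<in> carrier (free_group X)"
  by (simp add: carrier_free_group reduce_in_words)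

lemma group_free_group: "group (free_group X)"
proof (rule groupI)
  fix u v w assume "u \<in> carrier (free_group X)" "v \<in> carrier (free_group X)" "w \<in> carrier (free_group X)"
  then show "u \<otimes>\<^bsub>free_group X\<^esub> v \<otimes>\<^bsub>free_group X\<^esub> w = u \<otimes>\<^bsub>free_group X\<^esub> (v \<otimes>\<^bsub>free_group X\<^esub> w)"
    by (simp add: mult_free_group reduce_append_left reduce_append_right)
next
  fix u assume u: "u \<in> carrier (free_group X)"
  have "reduce (winv u) \<otimes>\<^bsub>free_group X\<^esub> u = \<one>\<^bsub>free_group X\<^esub>"
    using reduce_winv_append[of u "[]"]
    by (simp add: mult_free_group one_free_group reduce_append_left reduce_def[of "[]"])
  moreover have "reduce (winv u) \<in> carrier (free_group X)"
    using u reduce_in_carrier[of "winv u" X] by (simp add: carrier_free_group)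
  ultimately show "\<exists>v\<in>carrier (free_group X). v \<otimes>\<^bsub>free_group X\<^esub> u = \<one>\<^bsub>free_group X\<^esub>" by blast
next
  fix u assume u: "u \<in> carrier (free_group X)"
  then show "\<one>\<^bsub>free_group X\<^esub> \<otimes>\<^bsub>free_group X\<^esub> u = u"
    by (simp add: mult_free_group one_free_group carrier_free_group reduce_reduced)
qed (auto simp: mult_free_group one_free_group carrier_free_group reduce_in_words, simp add: reduced_def)

lemma inv_free_group:
  assumes "u \<in> carrier (free_group X)"
  shows "inv\<^bsub>free_group X\<^esub> u = reduce (winv u)"
proof -
  interpret group "free_group X" by (rule group_free_group)
  have "reduce (winv u) \<otimes>\<^bsub>free_group X\<^esub> u = \<one>\<^bsub>free_group X\<^esub>"
    using reduce_winv_append[of u "[]"]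
    by (simp add: mult_free_group one_free_group reduce_append_left reduce_def[of "[]"])
  moreover have "reduce (winv u) \<in> carrier (free_group X)"
    using assms reduce_in_carrier[of "winv u" X] by (simp add: carrier_free_group)
  ultimately show ?thesis using assms by (metis inv_equality)
qed

lemma reduce_hom: "u \<in> words X \<Longrightarrow> v \<in> words X \<Longrightarrow>
    reduce (u @ v) = reduce u \<otimes>\<^bsub>free_group X\<^esub> reduce v"
  by (simp add: mult_free_group reduce_append_left reduce_append_right)

lemma ev_free_group_hom:
  assumes "group G" "f \<in> X \<rightarrow> carrier G"
  shows "ev G f \<in> hom (free_group X) G"
proof -
  interpret group G by fact
  show ?thesis
    using assms ev_reduce[OF assms(2)]
    by (auto simp: hom_def carrier_free_group mult_free_group ev_append)
qed

lemma hom_free_group_eq_ev: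
  assumes "group G" and h: "h \<in> hom (free_group X) G" and w: "w \<in> words X"
  shows "h (reduce w) = ev G (\<lambda>x. h [(x, True)]) w"
  using w
proof (induction w)
  case Nil
  interpret group_hom "free_group X" G h
    using assms group_free_group by (simp add: group_hom_def group_hom_axioms_def)
  show ?case using hom_one by (simp add: reduce_def one_free_group)
next
  case (Cons a w)
  interpret group_hom "free_group X" G h
    using assms group_free_group by (simp add: group_hom_def group_hom_axioms_def)
  obtain x s where a: "a = (x, s)" by (cases a)
  have x: "[(x, True)] \<in> carrier (free_group X)" "[(x, False)] \<in> carrier (free_group X)"
    using Cons.prems a by (auto simp: carrier_free_group reduced_def)
  have "inv\<^bsub>free_group X\<^esub> [(x, True)] = [(x, False)]"
    using x by (simp add: inv_free_group reduce_def inv_letter_def)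
  then have "h [(x, False)] = inv\<^bsub>G\<^esub> h [(x, True)]" using hom_inv[OF x(1)] by simp
  then have "h [a] = ev_letter G (\<lambda>x. h [(x, True)]) a" using a by (auto simp: ev_letter_def)
  moreover have "h (reduce (a # w)) = h [a] \<otimes>\<^bsub>G\<^esub> h (reduce w)"
  proof -
    have "reduce (a # w) = [a] \<otimes>\<^bsub>free_group X\<^esub> reduce w"
      using reduce_append_right[of "[a]" w] by (simp add: mult_free_group)
    moreover have "[a] \<in> carrier (free_group X)" using x a by (cases s) auto
    ultimately show ?thesis using reduce_in_carrier[of w X] Cons.prems by simp
  qed
  ultimately show ?case using Cons by simp
qed


section \<open>Presentations and area\<close>

context group
begin

lemma normal_closure_gens_closed:
  assumes "S \<subseteq> carrier G"
  shows "{inv t \<otimes> s \<otimes> t | s t. s \<in> S \<and> t \<in> carrier G} \<subseteq> carrier G"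
  using assms by auto

lemma normal_closure_normal:
  assumes "S \<subseteq> carrier G"
  shows "normal_closure G S \<lhd> G"
  unfolding normal_closure_def
proof (rule normal_generateI[OF normal_closure_gens_closed[OF assms]])
  fix h g assume "h \<in> {inv t \<otimes> s \<otimes> t | s t. s \<in> S \<and> t \<in> carrier G}" and g: "g \<in> carrier G"
  then obtain s t where st: "s \<in> S" "t \<in> carrier G" "h = inv t \<otimes> s \<otimes> t" by blast
  then have "g \<otimes> h \<otimes> inv g = inv (t \<otimes> inv g) \<otimes> s \<otimes> (t \<otimes> inv g)"
    using g assms by (auto simp: inv_mult_group m_assoc subset_iff)
  then show "g \<otimes> h \<otimes> inv g \<in> {inv t \<otimes> s \<otimes> t | s t. s \<in> S \<and> t \<in> carrier G}"
    using st g by blast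
qed

lemma normal_closure_incl:
  assumes "S \<subseteq> carrier G" "s \<in> S"
  shows "s \<in> normal_closure G S"
proof -
  have "s = inv \<one> \<otimes> s \<otimes> \<one>" using assms by auto
  then have "s \<in> {inv t \<otimes> s \<otimes> t | s t. s \<in> S \<and> t \<in> carrier G}" using assms by blast
  then show ?thesis by (simp add: normal_closure_def generate.incl)
qed

lemma normal_closure_hom:
  assumes "group H" "h \<in> hom G H" "S \<subseteq> carrier G" "\<And>s. s \<in> S \<Longrightarrow> h s = \<one>\<^bsub>H\<^esub>"
    and "x \<in> normal_closure G S"
  shows "h x = \<one>\<^bsub>H\<^esub>"
proof -
  note gens_carrier = generate_in_carrier[OF normal_closure_gens_closed[OF assms(3)]]
  interpret group_hom G H h using assms by (simp add: group_hom_def group_hom_axioms_def group_axioms)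
  show ?thesis using assms(5) unfolding normal_closure_def
  proof (induction rule: generate.induct)
    case (incl x)
    then show ?case using assms(3,4) by (auto simp: subset_iff)
  next
    case (inv x)
    then show ?case using assms(3,4) by (auto simp: subset_iff)
  next
    case (eng x y)
    then have "x \<in> carrier G" "y \<in> carrier G"
      using gens_carrier by auto
    with eng show ?case by simp
  qed simp
qed

lemma coset_eq_one_iff:
  assumes "N \<lhd> G" "x \<in> carrier G"
  shows "N #> x = N \<longleftrightarrow> x \<in> N"
  using assms coset_join1 coset_join2 normal_imp_subgroup[OF assms(1)] subgroup.subset by metis

lemma hom_from_factor:
  assumes "N \<lhd> G" "group H" "h \<in> hom G H" "\<And>x. x \<in> N \<Longrightarrow> h x = \<one>\<^bsub>H\<^esub>"
  obtains g where "g \<in> hom (G Mod N) H" "\<And>x. x \<in> carrier G \<Longrightarrow> g (N #> x) = h x"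
proof -
  note self = rcos_self[OF _ normal_imp_subgroup[OF assms(1)]]
  interpret group_hom G H h using assms by (simp add: group_hom_def group_hom_axioms_def group_axioms)
  have "h x = h y" if xy: "x \<in> carrier G" "y \<in> carrier G" "N #> x = N #> y" for x y
  proof -
    have "x \<in> N #> y" using xy self[OF xy(1)] by simp
    then obtain n where "n \<in> N" "x = n \<otimes> y" by (auto simp: r_coset_def)
    moreover have "n \<in> carrier G" using \<open>n \<in> N\<close> normal_imp_subgroup[OF assms(1)] subgroup.subset by blast
    ultimately show ?thesis using assms(4) xy by simp
  qed
  from FactGroup_universal[OF assms(3,1) this] that show thesis by blast
qed

end

lemma group_presented_group: "R \<subseteq> carrier (free_group X) \<Longrightarrow> group (presented_group X R)"
  unfolding presented_group_def
  by (intro normal.factorgroup_is_group group.normal_closure_normal group_free_group)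

text \<open>Replaces the isomorphism by an evaluation of words, so that later arguments do not have
  to deal with cosets of the free group.\<close>

lemma finite_presentationE:
  assumes "group G" "finite_presentation X R G"
  obtains f where "f \<in> UNIV \<rightarrow> carrier G"
    and "\<And>g. g \<in> carrier G \<Longrightarrow> \<exists>w \<in> words X. ev G f w = g"
    and "\<And>w. w \<in> words X \<Longrightarrow> ev G f w = \<one>\<^bsub>G\<^esub> \<longleftrightarrow> reduce w \<in> normal_closure (free_group X) R"
proof -
  interpret G: group G by fact
  let ?F = "free_group X" and ?N = "normal_closure (free_group X) R"
  interpret F: group ?F by (rule group_free_group)
  have R: "R \<subseteq> carrier ?F" and iso: "presented_group X R \<cong> G"
    using assms(2) by (auto simp: finite_presentation_def)
  interpret N: normal ?N ?F by (rule F.normal_closure_normal[OF R])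
  interpret P: group "presented_group X R" by (rule group_presented_group[OF R])
  from iso obtain \<phi> where \<phi>: "\<phi> \<in> iso (presented_group X R) G" unfolding is_iso_def by blast
  interpret group_hom "presented_group X R" G \<phi>
    using \<phi> by (simp add: group_hom_def group_hom_axioms_def iso_def P.is_group G.is_group)
  define h where "h = (\<lambda>w. \<phi> (?N #>\<^bsub>?F\<^esub> w))"
  have h: "h \<in> hom ?F G"
    using hom_compose[OF N.r_coset_hom_Mod, of \<phi> G] homh
    by (simp add: h_def presented_group_def comp_def)
  \<comment> \<open>The default value outside \<open>X\<close> makes \<open>f\<close> a map from all
    letters into the group, so that \<open>ev\<close> is closed on arbitrary words.\<close>
  define f where "f = (\<lambda>x. if x \<in> X then h [(x, True)] else \<one>\<^bsub>G\<^esub>)"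
  have ev: "ev G f w = h (reduce w)" if "w \<in> words X" for w
    using hom_free_group_eq_ev[OF assms(1) h that] ev_cong[OF that, of f "\<lambda>x. h [(x, True)]" G]
    by (simp add: f_def)
  have "[(x, True)] \<in> carrier ?F" if "x \<in> X" for x
    using that by (auto simp: carrier_free_group reduced_def)
  then have f: "f \<in> UNIV \<rightarrow> carrier G"
    using hom_in_carrier[OF h] by (auto simp: f_def)
  show thesis
  proof
    show "f \<in> UNIV \<rightarrow> carrier G" by (rule f)
  next
    fix g assume "g \<in> carrier G"
    moreover have "\<phi> ` carrier (presented_group X R) = carrier G"
      using \<phi> by (simp add: iso_def bij_betw_def)
    ultimately have "g \<in> \<phi> ` carrier (presented_group X R)" by simp
    then obtain c where "g = \<phi> c" "c \<in> carrier (presented_group X R)" by (rule imageE)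
    then obtain w where "w \<in> carrier ?F" "h w = g"
      by (auto simp: presented_group_def h_def carrier_FactGroup)
    then show "\<exists>w \<in> words X. ev G f w = g"
      using ev[of w] by (auto simp: carrier_free_group reduce_reduced)
  next
    fix w assume w: "w \<in> words X"
    then have rw: "reduce w \<in> carrier ?F" by (rule reduce_in_carrier)
    have c: "?N #>\<^bsub>?F\<^esub> reduce w \<in> carrier (presented_group X R)"
      using rw by (auto simp: presented_group_def carrier_FactGroup)
    have "ev G f w = \<one>\<^bsub>G\<^esub> \<longleftrightarrow> ?N #>\<^bsub>?F\<^esub> reduce w = \<one>\<^bsub>presented_group X R\<^esub>"
      unfolding ev[OF w] h_def using iso_iff \<phi> c hom_one by auto
    also have "\<dots> \<longleftrightarrow> reduce w \<in> ?N"
      using F.coset_eq_one_iff[OF N.normal_axioms rw] by (simp add: presented_group_def)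
    finally show "ev G f w = \<one>\<^bsub>G\<^esub> \<longleftrightarrow> reduce w \<in> ?N" .
  qed
qed

definition conj_pairs :: "'x set \<Rightarrow> 'x word set \<Rightarrow> ('x word \<times> 'x word) list \<Rightarrow> bool" where
  "conj_pairs X R ps \<longleftrightarrow> (\<forall>(r, t) \<in> set ps.
     r \<in> R \<union> (\<lambda>s. inv\<^bsub>free_group X\<^esub> s) ` R \<and> t \<in> carrier (free_group X))"

lemma area_alt: "area X R w = (LEAST M. \<exists>ps. length ps = M \<and> conj_pairs X R ps \<and> w = conj_product X ps)"
  by (simp add: area_def conj_pairs_def)

lemma conj_pairs_append [simp]: "conj_pairs X R (ps @ qs) \<longleftrightarrow> conj_pairs X R ps \<and> conj_pairs X R qs"
  by (auto simp: conj_pairs_def)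

lemma conj_pairs_Nil [simp]: "conj_pairs X R []"
  by (auto simp: conj_pairs_def)

lemma conj_product_Nil [simp]: "conj_product X [] = \<one>\<^bsub>free_group X\<^esub>"
  by (simp add: conj_product_def)

lemma conj_product_Cons:
  "conj_product X ((r, t) # ps) = (inv\<^bsub>free_group X\<^esub> t \<otimes>\<^bsub>free_group X\<^esub> r \<otimes>\<^bsub>free_group X\<^esub> t) \<otimes>\<^bsub>free_group X\<^esub> conj_product X ps"
  by (simp add: conj_product_def)

section \<open>Products of conjugates, area and Dehn function of a fixed presentation\<close>

locale relators =
  fixes X :: "'x set" and R :: "'x word set"
  assumes relators: "R \<subseteq> carrier (free_group X)"
begin

abbreviation F where "F \<equiv> free_group X"

sublocale F: group F
  by (rule group_free_group)

lemma conj_pairs_Cons: "conj_pairs X R ((r, t) # ps) \<longleftrightarrow>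
    r \<in> R \<union> (\<lambda>s. inv\<^bsub>F\<^esub> s) ` R \<and> t \<in> carrier F \<and> conj_pairs X R ps"
  by (auto simp: conj_pairs_def)

lemma sym_relators: "r \<in> R \<union> (\<lambda>s. inv\<^bsub>F\<^esub> s) ` R \<Longrightarrow> r \<in> carrier F"
  using relators by auto

lemma conj_product_closed: "conj_pairs X R ps \<Longrightarrow> conj_product X ps \<in> carrier F"
proof (induction ps)
  case (Cons p ps)
  then show ?case
    using sym_relators by (cases p) (simp add: conj_product_Cons conj_pairs_Cons)
qed simp

lemma conj_product_append:
  "conj_pairs X R ps \<Longrightarrow> conj_pairs X R qs \<Longrightarrow>
     conj_product X (ps @ qs) = conj_product X ps \<otimes>\<^bsub>F\<^esub> conj_product X qs"
proof (induction ps)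
  case (Cons p ps)
  then show ?case
    using sym_relators conj_product_closed
    by (cases p) (simp add: conj_product_Cons conj_pairs_Cons F.m_assoc)
qed (simp add: conj_product_closed)

definition prods :: "nat \<Rightarrow> 'x word set" where
  "prods k = {conj_product X ps | ps. conj_pairs X R ps \<and> length ps \<le> k}"

lemma prodsE:
  assumes "a \<in> prods k"
  obtains ps where "conj_pairs X R ps" "length ps \<le> k" "a = conj_product X ps"
  using assms unfolding prods_def by blast

lemma prods_one: "\<one>\<^bsub>F\<^esub> \<in> prods k"
  unfolding prods_def by (force intro: exI[of _ "[]"])

lemma prods_mono: "a \<in> prods k \<Longrightarrow> k \<le> l \<Longrightarrow> a \<in> prods l"
  by (force simp: prods_def)

lemma prods_mult:
  assumes "a \<in> prods k" "b \<in> prods l"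
  shows "a \<otimes>\<^bsub>F\<^esub> b \<in> prods (k + l)"
proof -
  obtain ps qs where "conj_pairs X R ps" "length ps \<le> k" "a = conj_product X ps"
    "conj_pairs X R qs" "length qs \<le> l" "b = conj_product X qs"
    using assms by (auto simp: prods_def)
  then show ?thesis unfolding prods_def
    by (intro CollectI exI[of _ "ps @ qs"]) (simp add: conj_product_append)
qed

lemma prods_single:
  assumes "r \<in> R \<union> (\<lambda>s. inv\<^bsub>F\<^esub> s) ` R" "t \<in> carrier F"
  shows "inv\<^bsub>F\<^esub> t \<otimes>\<^bsub>F\<^esub> r \<otimes>\<^bsub>F\<^esub> t \<in> prods 1"
  unfolding prods_def
  using assms sym_relators[OF assms(1)]
  by (intro CollectI exI[of _ "[(r, t)]"]) (simp add: conj_product_Cons conj_pairs_Cons del: inv_free_group)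

lemma prods_inv: "a \<in> prods k \<Longrightarrow> inv\<^bsub>F\<^esub> a \<in> prods k"
proof -
  have "inv\<^bsub>F\<^esub> conj_product X ps \<in> prods (length ps)" if "conj_pairs X R ps" for ps
    using that
  proof (induction ps)
    case (Cons p ps)
    obtain r t where p: "p = (r, t)" by (cases p)
    with Cons have r: "r \<in> R \<union> (\<lambda>s. inv\<^bsub>F\<^esub> s) ` R" and t: "t \<in> carrier F" and ps: "conj_pairs X R ps"
      by (auto simp: conj_pairs_Cons)
    have r': "r \<in> carrier F" by (rule sym_relators[OF r])
    have "inv\<^bsub>F\<^esub> r \<in> R \<union> (\<lambda>s. inv\<^bsub>F\<^esub> s) ` R" using r relators by (auto simp: subset_iff)
    from prods_single[OF this t] Cons.IH[OF ps]
    have "inv\<^bsub>F\<^esub> conj_product X ps \<otimes>\<^bsub>F\<^esub> (inv\<^bsub>F\<^esub> t \<otimes>\<^bsub>F\<^esub> inv\<^bsub>F\<^esub> r \<otimes>\<^bsub>F\<^esub> t) \<in> prods (length ps + 1)"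
      by (intro prods_mult)
    then show ?case
      using r' t conj_product_closed[OF ps] by (simp add: p conj_product_Cons F.inv_mult_group F.m_assoc)
  qed (simp add: prods_one)
  then show "a \<in> prods k \<Longrightarrow> inv\<^bsub>F\<^esub> a \<in> prods k"
    using prods_mono[of _ _ k] prodsE by metis
qed

lemma normal_closure_prods:
  assumes "w \<in> normal_closure F R"
  shows "\<exists>k. w \<in> prods k"
  using assms unfolding normal_closure_def
proof (induction rule: generate.induct)
  case one
  then show ?case using prods_one by blast
next
  case (incl h)
  then show ?case using prods_single by blast
next
  case (inv h)
  then show ?case using prods_single prods_inv by blast
next
  case (eng g h)
  then show ?case using prods_mult by blast
qed

lemma area_le_iff_prods:
  assumes "w \<in> normal_closure F R"
  shows "area X R w \<le> k \<longleftrightarrow> w \<in> prods k"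
proof
  let ?P = "\<lambda>M. \<exists>ps. length ps = M \<and> conj_pairs X R ps \<and> w = conj_product X ps"
  have "\<exists>M. ?P M" using normal_closure_prods[OF assms] by (auto simp: prods_def)
  then have "?P (LEAST M. ?P M)" by (rule LeastI_ex)
  then show "w \<in> prods k" if "area X R w \<le> k"
    using that unfolding area_alt prods_def by auto
next
  assume "w \<in> prods k"
  then obtain ps where "conj_pairs X R ps" "length ps \<le> k" "w = conj_product X ps"
    by (auto simp: prods_def)
  then show "area X R w \<le> k"
    unfolding area_alt using Least_le[of _ "length ps"] le_trans by (smt (verit, best))
qed

text \<open>Letters outside \<open>X\<close> may occur in the middle of a derivation, so they are deleted.\<close>

definition restr :: "'x word \<Rightarrow> 'x word" where
  "restr w = reduce (filter (\<lambda>a. fst a \<in> X) w)"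

lemma restr_closed: "restr w \<in> carrier F"
  unfolding restr_def by (rule reduce_in_carrier) (auto simp: words_def)

lemma restr_append: "restr (u @ v) = restr u \<otimes>\<^bsub>F\<^esub> restr v"
  unfolding restr_def by (simp, rule reduce_hom) (auto simp: words_def)

lemma restr_words: "w \<in> words X \<Longrightarrow> restr w = reduce w"
proof -
  assume "w \<in> words X"
  then have "filter (\<lambda>a. fst a \<in> X) w = w" by (auto simp: words_def filter_id_conv)
  then show ?thesis by (simp add: restr_def)
qed

text \<open>A relator step \<open>u r v\<close> to \<open>u v\<close> contributes the single
  conjugate \<open>u r u^-1\<close>; symmetry inverts a product of conjugates, and transitivity
  concatenates two of them.\<close>

lemma eqv_restr: "eqv R k u v \<Longrightarrow> restr u \<otimes>\<^bsub>F\<^esub> inv\<^bsub>F\<^esub> restr v \<in> prods k"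
proof (induction rule: eqv.induct)
  case (eqv_cancel u a v)
  have "reduce [a, inv_letter a] = []" by (simp add: reduce_def inv_letter_def)
  then have "restr [a, inv_letter a] = \<one>\<^bsub>F\<^esub>"
    by (simp add: restr_def one_free_group, simp add: reduce_def)
  then have "restr (u @ [a, inv_letter a] @ v) = restr (u @ v)"
    by (simp only: restr_append) (simp add: restr_closed)
  then show ?case using prods_one restr_closed[of "u @ v"] by simp
next
  case (eqv_relator r u v)
  have r: "restr r = r" using eqv_relator relators restr_words[of r]
    by (auto simp: carrier_free_group reduce_reduced)
  have "inv\<^bsub>F\<^esub> (inv\<^bsub>F\<^esub> restr u) \<otimes>\<^bsub>F\<^esub> r \<otimes>\<^bsub>F\<^esub> inv\<^bsub>F\<^esub> restr u \<in> prods 1"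
    using eqv_relator restr_closed by (intro prods_single) auto
  moreover have "v' \<otimes>\<^bsub>F\<^esub> (inv\<^bsub>F\<^esub> v' \<otimes>\<^bsub>F\<^esub> y) = y" if "y \<in> carrier F" "v' \<in> carrier F" for y v'
    using that by (simp add: F.m_assoc[symmetric])
  moreover have "r \<in> carrier F" using eqv_relator relators by auto
  ultimately show ?case
    using restr_closed by (simp add: restr_append r F.inv_mult_group F.m_assoc)
next
  case (eqv_sym k u v)
  then show ?case using prods_inv[of _ k] restr_closed by (fastforce simp: F.inv_mult_group)
next
  case (eqv_trans k u v l w)
  have "inv\<^bsub>F\<^esub> restr v \<otimes>\<^bsub>F\<^esub> (restr v \<otimes>\<^bsub>F\<^esub> y) = y" if "y \<in> carrier F" for y
    using that restr_closed by (simp add: F.m_assoc[symmetric])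
  then show ?case
    using prods_mult[OF eqv_trans.IH] restr_closed by (simp add: F.m_assoc)
qed (auto simp: restr_closed prods_one intro: prods_mono)

lemma eqv_area:
  assumes "eqv R k w []" "w \<in> words X" "reduce w \<in> normal_closure F R"
  shows "area X R (reduce w) \<le> k"
proof -
  have "restr w \<otimes>\<^bsub>F\<^esub> inv\<^bsub>F\<^esub> restr [] \<in> prods k" by (rule eqv_restr[OF assms(1)])
  moreover have "restr [] = \<one>\<^bsub>F\<^esub>" by (simp add: restr_def reduce_def one_free_group)
  ultimately have "reduce w \<in> prods k"
    using restr_closed[of w] restr_words[OF assms(2)] by simp
  then show ?thesis using area_le_iff_prods[OF assms(3)] by simp
qed

text \<open>A filling removes a relator by inserting its inverse next to it, hence
  \<open>winv\<close>; the rotations provide the closure that \<open>fill_uncancel\<close>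
  requires.\<close>

definition rotations :: "'x word set" where
  "rotations = {rotate n (winv r) | n r. r \<in> R \<union> (\<lambda>s. inv\<^bsub>F\<^esub> s) ` R}"

lemma cyclic_closed_rotations: "cyclic_closed rotations"
  unfolding cyclic_closed_def
proof (intro allI impI)
  fix p q assume "p @ q \<in> rotations"
  then obtain n r where "r \<in> R \<union> (\<lambda>s. inv\<^bsub>F\<^esub> s) ` R" "p @ q = rotate n (winv r)"
    by (auto simp: rotations_def)
  moreover have "q @ p = rotate (length p) (p @ q)" by (simp add: rotate_append)
  ultimately have "q @ p = rotate (length p + n) (winv r)" by (simp add: rotate_rotate)
  then show "q @ p \<in> rotations"
    using \<open>r \<in> _\<close> unfolding rotations_def by blast
qed

lemma rotations_words: "rotations \<subseteq> words X"
proof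
  fix w assume "w \<in> rotations"
  then obtain n r where r: "r \<in> carrier F" "w = rotate n (winv r)"
    unfolding rotations_def using sym_relators by blast
  then have "winv r \<in> words X" by (simp add: carrier_free_group)
  then show "w \<in> words X" by (simp add: r(2) words_def)
qed

lemma finite_rotations:
  assumes "finite X" "finite R"
  shows "finite rotations"
proof -
  let ?S = "R \<union> (\<lambda>s. inv\<^bsub>F\<^esub> s) ` R"
  have S: "finite ?S" using assms by simp
  define m where "m = Max (length ` ?S)"
  have "length r \<le> m" if "r \<in> ?S" for r unfolding m_def using that S by (intro Max_ge) auto
  then have "length w \<le> m" if "w \<in> rotations" for w
  proof -
    from that obtain n r where "r \<in> ?S" "w = rotate n (winv r)" unfolding rotations_def by blast
    then show ?thesis using \<open>\<And>r. r \<in> ?S \<Longrightarrow> length r \<le> m\<close>[of r] by simp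
  qed
  then have "rotations \<subseteq> {w \<in> words X. length w \<le> m}"
    using rotations_words by auto
  then show ?thesis using finite_words_le[OF assms(1)] finite_subset by blast
qed

text \<open>In the unreduced product, inserting \<open>winv r\<close> behind \<open>r\<close> makes
  a whole factor cancel. The conjugators may be long, but they are already part of the word, so
  nothing is inserted for them.\<close>

lemma fill_conj_product:
  assumes "conj_pairs X R ps"
  shows "\<exists>w. conj_product X ps = reduce w \<and> fill rotations (length ps) w"
  using assms
proof (induction ps)
  case Nil
  then show ?case
    by (intro exI[of _ "[]"]) (simp add: reduce_def one_free_group fill_Nil)
next
  case (Cons p ps)
  obtain r t where p: "p = (r, t)" by (cases p)
  with Cons have r: "r \<in> R \<union> (\<lambda>s. inv\<^bsub>F\<^esub> s) ` R" and t: "t \<in> carrier F" and ps: "conj_pairs X R ps"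
    by (auto simp: conj_pairs_Cons)
  obtain w where w: "conj_product X ps = reduce w" "fill rotations (length ps) w"
    using Cons.IH[OF ps] by blast
  have "winv r \<in> rotations"
    using r unfolding rotations_def by (intro CollectI exI[of _ 0] exI[of _ r]) simp
  have "fill rotations (length ps) (winv t @ winv (winv t) @ w)"
    using fill_cancel_word[of _ _ "[]" w "winv t"] w(2) by simp
  then have "fill rotations (length ps) (winv t @ r @ winv r @ t @ w)"
    using fill_cancel_word[of _ _ "winv t" "t @ w" "r"] by simp
  then have "fill rotations (Suc (length ps)) ((winv t @ r) @ t @ w)"
    using fill_insert[of _ _ "winv t @ r" "winv r" "t @ w"] \<open>winv r \<in> rotations\<close> by simp
  moreover have "conj_product X (p # ps) = reduce ((winv t @ r) @ t @ w)"
    using t w(1) by (simp add: p conj_product_Cons inv_free_group mult_free_group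
        reduce_append_left reduce_append_right)
  ultimately show ?case by auto
qed

text \<open>The unreduced product of conjugates and \<open>w\<close> have the same reduction, so
  \<open>fill_reduce\<close> carries the filling over to \<open>w\<close>. There the intermediate
  words are controlled by \<open>length w\<close> and \<open>k\<close>, whatever the conjugators
  were.\<close>

lemma fill_area:
  assumes "reduce w \<in> normal_closure F R" "area X R (reduce w) \<le> k"
  shows "fill rotations k w"
proof -
  obtain ps where ps: "conj_pairs X R ps" "length ps \<le> k" "reduce w = conj_product X ps"
    using assms area_le_iff_prods[OF assms(1)] by (auto simp: prods_def)
  obtain v where "reduce w = reduce v" "fill rotations (length ps) v"
    using fill_conj_product[OF ps(1)] ps(3) by auto
  then have "fill rotations (length ps) w"
    using fill_reduce[OF cyclic_closed_rotations] by metis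
  then show ?thesis using ps(2) by (rule fill_mono)
qed

definition trivial_le :: "nat \<Rightarrow> 'x word set" where
  "trivial_le n = {w \<in> carrier F. w \<in> normal_closure F R \<and> length w \<le> n}"

lemma dehn_alt: "dehn X R n = Max (area X R ` trivial_le n)"
proof -
  have "{area X R w | w. w \<in> carrier F \<and>
      normal_closure F R #>\<^bsub>F\<^esub> w = \<one>\<^bsub>presented_group X R\<^esub> \<and> length w \<le> n} = area X R ` trivial_le n"
    using F.coset_eq_one_iff[OF F.normal_closure_normal[OF relators]]
    by (auto simp: trivial_le_def presented_group_def)
  then show ?thesis by (simp add: dehn_def)
qed

lemma finite_trivial_le:
  assumes "finite X"
  shows "finite (trivial_le n)"
proof (rule finite_subset)
  show "trivial_le n \<subseteq> {w \<in> words X. length w \<le> n}"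
    by (auto simp: trivial_le_def carrier_free_group)
qed (rule finite_words_le[OF assms])

lemma Nil_in_trivial_le: "[] \<in> trivial_le n"
  using F.normal_closure_normal[OF relators] subgroup.one_closed[OF normal_imp_subgroup]
  by (fastforce simp: trivial_le_def carrier_free_group reduced_def one_free_group)

lemma area_le_dehn:
  assumes "finite X" "w \<in> words X" "reduce w \<in> normal_closure F R" "length w \<le> n"
  shows "area X R (reduce w) \<le> dehn X R n"
proof -
  have "reduce w \<in> trivial_le n"
    using assms reduce_in_carrier[of w X] length_reduce_le[of w] by (simp add: trivial_le_def)
  then show ?thesis
    unfolding dehn_alt using finite_trivial_le[OF assms(1)] by simp
qed

lemma dehn_leI:
  assumes "finite X" "\<And>w. w \<in> trivial_le n \<Longrightarrow> area X R w \<le> b"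
  shows "dehn X R n \<le> b"
  unfolding dehn_alt using assms finite_trivial_le[OF assms(1)] Nil_in_trivial_le[of n]
  by (subst Max_le_iff) auto

lemma dehn_mono:
  assumes "finite X" "m \<le> n"
  shows "dehn X R m \<le> dehn X R n"
  unfolding dehn_alt
  using assms finite_trivial_le[OF assms(1)] Nil_in_trivial_le[of m]
  by (intro Max_mono) (auto simp: trivial_le_def)

end


section \<open>The group \<open>\<E>(G)\<close>\<close>

context group
begin

lemma commute_inv:
  assumes "x \<in> carrier G" "y \<in> carrier G" "x \<otimes> y = y \<otimes> x"
  shows "inv x \<otimes> y = y \<otimes> inv x"
proof -
  have "inv x \<otimes> y = inv x \<otimes> (y \<otimes> x) \<otimes> inv x" using assms(1,2) by (simp add: m_assoc)
  also have "\<dots> = inv x \<otimes> (x \<otimes> y) \<otimes> inv x" using assms(3) by simp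
  also have "\<dots> = y \<otimes> inv x" using assms(1,2) by (simp add: m_assoc[symmetric])
  finally show ?thesis .
qed

lemma commute_mult:
  assumes "x \<in> carrier G" "y \<in> carrier G" "z \<in> carrier G" "x \<otimes> z = z \<otimes> x" "y \<otimes> z = z \<otimes> y"
  shows "x \<otimes> y \<otimes> z = z \<otimes> (x \<otimes> y)"
proof -
  have "x \<otimes> y \<otimes> z = x \<otimes> z \<otimes> y" using assms(1-3,5) by (simp add: m_assoc)
  then show ?thesis using assms by (simp add: m_assoc)
qed

lemma generate_commute:
  assumes "S \<subseteq> carrier G" "y \<in> carrier G" "\<And>s. s \<in> S \<Longrightarrow> s \<otimes> y = y \<otimes> s"
    and "x \<in> generate G S"
  shows "x \<otimes> y = y \<otimes> x"
  using assms(4)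
proof (induction rule: generate.induct)
  case (inv s)
  then show ?case using assms by (intro commute_inv) auto
next
  case (eng a b)
  then show ?case using generate_in_carrier[OF assms(1)] assms(2) by (intro commute_mult) auto
qed (use assms in auto)

lemma generate_commute_generate:
  assumes "S \<subseteq> carrier G" "T \<subseteq> carrier G" "\<And>s t. s \<in> S \<Longrightarrow> t \<in> T \<Longrightarrow> s \<otimes> t = t \<otimes> s"
    and "x \<in> generate G S" "y \<in> generate G T"
  shows "x \<otimes> y = y \<otimes> x"
proof (rule generate_commute[OF assms(1) _ _ assms(4)])
  show y: "y \<in> carrier G" using generate_in_carrier[OF assms(2,5)] .
  fix s assume "s \<in> S"
  then have "y \<otimes> s = s \<otimes> y"
    using assms by (intro generate_commute[OF assms(2) _ _ assms(5)]) auto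
  then show "s \<otimes> y = y \<otimes> s" ..
qed

lemma commutator_closed [simp]: "x \<in> carrier G \<Longrightarrow> y \<in> carrier G \<Longrightarrow> commutator G x y \<in> carrier G"
  by (simp add: commutator_def)

lemma commutator_eq_one_iff:
  assumes "x \<in> carrier G" "y \<in> carrier G"
  shows "commutator G x y = \<one> \<longleftrightarrow> x \<otimes> y = y \<otimes> x"
proof -
  have "commutator G x y = inv (y \<otimes> x) \<otimes> (x \<otimes> y)"
    using assms by (simp add: commutator_def inv_mult_group m_assoc)
  then show ?thesis
    using assms by (metis inv_closed inv_equality inv_inv l_inv m_closed)
qed

lemma commutator_hom:
  assumes "group H" "h \<in> hom G H" "x \<in> carrier G" "y \<in> carrier G"
  shows "h (commutator G x y) = commutator H (h x) (h y)"
proof -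
  interpret group_hom G H h using assms by (simp add: group_hom_def group_hom_axioms_def group_axioms)
  show ?thesis using assms by (simp add: commutator_def)
qed

end

definition E_gen :: "('a, 'b) monoid_scheme \<Rightarrow> 'a + 'a \<Rightarrow> ('a + 'a) word set set" where
  "E_gen G z = normal_closure (free_product G G)
     {commutator (free_product G G) x y | x y. x \<in> D_subgroup G \<and> y \<in> L_subgroup G}
     #>\<^bsub>free_product G G\<^esub> free_product_gen G G z"

locale E_construction = group G for G :: "('a, 'b) monoid_scheme" (structure)
begin

abbreviation XX where "XX \<equiv> carrier G <+> carrier G"
abbreviation F where "F \<equiv> free_group XX"
abbreviation N where "N \<equiv> normal_closure F (table_relators G G)"
abbreviation P where "P \<equiv> free_product G G"
abbreviation cgen where "cgen \<equiv> free_product_gen G G"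
abbreviation DL where "DL \<equiv> {commutator P x y | x y. x \<in> D_subgroup G \<and> y \<in> L_subgroup G}"
abbreviation E where "E \<equiv> E_group G"

lemma table_relators_closed: "table_relators G G \<subseteq> carrier F"
  by (auto simp: table_relators_def intro!: reduce_in_carrier)

sublocale F: group F
  by (rule group_free_group)

sublocale N: normal N F
  by (rule F.normal_closure_normal[OF table_relators_closed])

sublocale P: group P
  unfolding free_product_def by (rule group_presented_group[OF table_relators_closed])

lemma P_eq: "P = F Mod N"
  by (simp add: free_product_def presented_group_def)

lemma c_eq: "cgen z = N #>\<^bsub>F\<^esub> [(z, True)]"
  by (simp add: free_product_gen_def Let_def)

lemma coset_eq_ev: "w \<in> words XX \<Longrightarrow> N #>\<^bsub>F\<^esub> reduce w = ev P cgen w"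
  using hom_free_group_eq_ev[OF P.is_group, of "\<lambda>w. N #>\<^bsub>F\<^esub> w" XX w] N.r_coset_hom_Mod
  by (simp add: P_eq c_eq[abs_def])

lemma c_closed: "cgen \<in> XX \<rightarrow> carrier P"
proof
  fix z assume "z \<in> XX"
  then have "[(z, True)] \<in> carrier F" by (simp add: carrier_free_group reduced_def)
  then show "cgen z \<in> carrier P" by (simp add: c_eq P_eq carrier_FactGroup)
qed

lemma P_surj: "x \<in> carrier P \<Longrightarrow> \<exists>w \<in> words XX. x = ev P cgen w"
proof -
  assume "x \<in> carrier P"
  then obtain w where "w \<in> carrier F" "x = N #>\<^bsub>F\<^esub> w"
    by (auto simp: P_eq carrier_FactGroup)
  then show ?thesis using coset_eq_ev[of w] by (auto simp: carrier_free_group reduce_reduced)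
qed

lemma c_mult_table:
  assumes "i = Inl \<or> i = Inr" "x \<in> carrier G" "y \<in> carrier G"
  shows "cgen (i (x \<otimes> y)) = cgen (i x) \<otimes>\<^bsub>P\<^esub> cgen (i y)"
proof -
  let ?r = "[(i x, True), (i y, True), (i (x \<otimes> y), False)]"
  have xy: "i x \<in> XX" "i y \<in> XX" "i (x \<otimes> y) \<in> XX" using assms by auto
  have "reduce ?r \<in> table_relators G G" using assms by (auto simp: table_relators_def)
  then have "reduce ?r \<in> N" by (rule F.normal_closure_incl[OF table_relators_closed])
  then have "N #>\<^bsub>F\<^esub> reduce ?r = \<one>\<^bsub>P\<^esub>"
    using F.coset_eq_one_iff[OF N.normal_axioms] xy reduce_in_carrier[of ?r XX] by (simp add: P_eq)
  then have "ev P cgen ?r = \<one>\<^bsub>P\<^esub>" using coset_eq_ev[of ?r] xy by simp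
  moreover have "cgen (i x) \<in> carrier P" "cgen (i y) \<in> carrier P" "cgen (i (x \<otimes> y)) \<in> carrier P"
    using xy c_closed by auto
  ultimately show ?thesis
    by (simp add: ev_letter_def P.m_assoc[symmetric] P.inv_equality)
       (metis P.inv_closed P.inv_equality P.inv_inv P.m_closed)
qed

lemma c_In_closed: "g \<in> carrier G \<Longrightarrow> cgen (Inl g) \<in> carrier P" "g \<in> carrier G \<Longrightarrow> cgen (Inr g) \<in> carrier P"
  using c_closed by auto

lemma c_hom: "(\<lambda>g. cgen (Inl g)) \<in> hom G P" "(\<lambda>g. cgen (Inr g)) \<in> hom G P"
  using c_mult_table[of Inl] c_mult_table[of Inr] c_closed by (auto simp: hom_def)

lemma P_universal:
  assumes "group K" and f: "f1 \<in> hom G K" "f2 \<in> hom G K"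
  obtains h where "h \<in> hom P K" "\<And>g. g \<in> carrier G \<Longrightarrow> h (cgen (Inl g)) = f1 g"
    "\<And>g. g \<in> carrier G \<Longrightarrow> h (cgen (Inr g)) = f2 g"
proof -
  interpret K: group K by fact
  let ?f = "case_sum f1 f2"
  have fc: "?f \<in> XX \<rightarrow> carrier K" using f by (auto simp: hom_def)
  have "ev K ?f s = \<one>\<^bsub>K\<^esub>" if "s \<in> table_relators G G" for s
  proof -
    have rel: "ev K ?f (reduce [(i x, True), (i y, True), (i (x \<otimes> y), False)]) = \<one>\<^bsub>K\<^esub>"
      if "i = Inl \<or> i = Inr" "x \<in> carrier G" "y \<in> carrier G" for i x y
    proof -
      have xy: "i x \<in> XX" "i y \<in> XX" "i (x \<otimes> y) \<in> XX" using that by auto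
      then have "?f (i x) \<in> carrier K" "?f (i y) \<in> carrier K"
        using Pi_mem[OF fc, of "i x"] Pi_mem[OF fc, of "i y"] by simp_all
      moreover have "?f (i (x \<otimes> y)) = ?f (i x) \<otimes>\<^bsub>K\<^esub> ?f (i y)"
        using f that by (auto simp: hom_def)
      ultimately show ?thesis
        using K.ev_reduce[OF fc, of "[(i x, True), (i y, True), (i (x \<otimes> y), False)]"] xy
        by (simp add: ev_letter_def K.m_assoc[symmetric])
    qed
    show ?thesis using that unfolding table_relators_def by (auto simp: rel)
  qed
  then have "ev K ?f x = \<one>\<^bsub>K\<^esub>" if "x \<in> N" for x
    using F.normal_closure_hom[OF assms(1) ev_free_group_hom[OF assms(1) fc] table_relators_closed _ that] by blast
  then obtain h where h: "h \<in> hom (F Mod N) K" "\<And>w. w \<in> carrier F \<Longrightarrow> h (N #>\<^bsub>F\<^esub> w) = ev K ?f w"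
    using F.hom_from_factor[OF N.normal_axioms assms(1) ev_free_group_hom[OF assms(1) fc]] by blast
  have hc: "h (cgen z) = ?f z" if "z \<in> XX" for z
  proof -
    have "[(z, True)] \<in> carrier F" using that by (simp add: carrier_free_group reduced_def)
    moreover have "?f z \<in> carrier K" using fc that by blast
    ultimately show ?thesis using h(2)[of "[(z, True)]"] by (simp add: c_eq ev_letter_def)
  qed
  have "h (cgen (Inl g)) = f1 g" "h (cgen (Inr g)) = f2 g" if "g \<in> carrier G" for g
    using hc[of "Inl g"] hc[of "Inr g"] that by auto
  then show thesis using that[of h] h(1) by (simp add: P_eq)
qed

lemma D_gens_closed:
  "{commutator P x y | x y. x \<in> copy1 G ` carrier G \<and> y \<in> copy2 G ` carrier G} \<subseteq> carrier P"
  using c_In_closed by auto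

lemma L_gens_closed:
  "{inv\<^bsub>P\<^esub> (copy1 G g) \<otimes>\<^bsub>P\<^esub> copy2 G g | g. g \<in> carrier G} \<subseteq> carrier P"
  using c_In_closed by auto

lemma D_closed: "x \<in> D_subgroup G \<Longrightarrow> x \<in> carrier P"
  unfolding D_subgroup_def commutator_subgroup_def by (rule P.generate_in_carrier[OF D_gens_closed])

lemma L_closed: "x \<in> L_subgroup G \<Longrightarrow> x \<in> carrier P"
  unfolding L_subgroup_def by (rule P.generate_in_carrier[OF L_gens_closed])

lemma DL_closed: "DL \<subseteq> carrier P"
  using D_closed L_closed by auto

sublocale M: normal "normal_closure P DL" P
  by (rule P.normal_closure_normal[OF DL_closed])

lemma E_eq: "E = P Mod normal_closure P DL"
  by (simp add: E_group_def)

sublocale E: group E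
  unfolding E_eq by (rule M.factorgroup_is_group)

abbreviation q where "q \<equiv> \<lambda>x. normal_closure P DL #>\<^bsub>P\<^esub> x"

lemma q_hom: "q \<in> hom P E"
  unfolding E_eq by (rule M.r_coset_hom_Mod)

lemma E_gen_eq: "E_gen G z = q (cgen z)"
  by (simp add: E_gen_def)

lemma E_gen_closed: "E_gen G \<in> XX \<rightarrow> carrier E"
proof
  fix z assume "z \<in> XX"
  then show "E_gen G z \<in> carrier E"
    using c_closed hom_in_carrier[OF q_hom, of "cgen z"] by (auto simp: E_gen_eq)
qed

lemma E_gen_hom: "(\<lambda>g. E_gen G (Inl g)) \<in> hom G E" "(\<lambda>g. E_gen G (Inr g)) \<in> hom G E"
  unfolding E_gen_eq using Group.hom_compose[OF c_hom(1) q_hom] Group.hom_compose[OF c_hom(2) q_hom]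
  by (simp_all add: comp_def)

lemma E_surj:
  assumes "x \<in> carrier E"
  shows "\<exists>w \<in> words XX. x = ev E (E_gen G) w"
proof -
  obtain y where y: "y \<in> carrier P" "x = q y" using assms by (auto simp: E_eq carrier_FactGroup)
  then obtain w where w: "w \<in> words XX" "y = ev P cgen w" using P_surj by blast
  then have "x = ev E (\<lambda>z. q (cgen z)) w"
    using P.ev_hom[OF E.is_group q_hom c_closed w(1)] y by simp
  then show ?thesis using w by (auto simp: E_gen_eq[abs_def])
qed

lemma E_gen_commute:
  assumes "g \<in> carrier G" "h \<in> carrier G" "k \<in> carrier G"
  defines "d \<equiv> commutator E (E_gen G (Inl g)) (E_gen G (Inr h))"
    and "l \<equiv> inv\<^bsub>E\<^esub> (E_gen G (Inl k)) \<otimes>\<^bsub>E\<^esub> E_gen G (Inr k)"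
  shows "d \<otimes>\<^bsub>E\<^esub> l = l \<otimes>\<^bsub>E\<^esub> d"
proof -
  interpret q: group_hom P E q
    using q_hom by (simp add: group_hom_def group_hom_axioms_def P.is_group E.is_group)
  have cl: "cgen (Inl g) \<in> carrier P" "cgen (Inr h) \<in> carrier P" "cgen (Inl k) \<in> carrier P" "cgen (Inr k) \<in> carrier P"
    using c_closed assms(1-3) by auto
  let ?x = "commutator P (cgen (Inl g)) (cgen (Inr h))" and ?y = "inv\<^bsub>P\<^esub> (cgen (Inl k)) \<otimes>\<^bsub>P\<^esub> cgen (Inr k)"
  have x: "?x \<in> D_subgroup G"
    unfolding D_subgroup_def commutator_subgroup_def using assms(1-3) by (intro generate.incl) blast
  have y: "?y \<in> L_subgroup G"
    unfolding L_subgroup_def using assms(1-3) by (intro generate.incl) blast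
  have "commutator P ?x ?y \<in> DL" using x y by blast
  then have "commutator P ?x ?y \<in> normal_closure P DL" by (rule P.normal_closure_incl[OF DL_closed])
  then have "q (commutator P ?x ?y) = \<one>\<^bsub>E\<^esub>"
    using P.coset_eq_one_iff[OF M.normal_axioms] D_closed[OF x] L_closed[OF y] by (simp add: E_eq)
  then have "commutator E (q ?x) (q ?y) = \<one>\<^bsub>E\<^esub>"
    using P.commutator_hom[OF E.is_group q_hom D_closed[OF x] L_closed[OF y]] by simp
  then have "q ?x \<otimes>\<^bsub>E\<^esub> q ?y = q ?y \<otimes>\<^bsub>E\<^esub> q ?x"
    using E.commutator_eq_one_iff D_closed[OF x] L_closed[OF y] by simp
  moreover have "q ?x = d" "q ?y = l"
    using cl P.commutator_hom[OF E.is_group q_hom] by (simp_all add: d_def l_def E_gen_eq)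
  ultimately show ?thesis by simp
qed

text \<open>The defining relations range over the whole subgroups \<open>D_subgroup\<close> and
  \<open>L_subgroup\<close>, but generating sets that commute elementwise generate subgroups that do
  so too. Hence the relations need testing on generators only.\<close>

lemma E_universal:
  assumes "group K" and f: "f1 \<in> hom G K" "f2 \<in> hom G K"
    and comm: "\<And>g h k. g \<in> carrier G \<Longrightarrow> h \<in> carrier G \<Longrightarrow> k \<in> carrier G \<Longrightarrow>
      commutator K (f1 g) (f2 h) \<otimes>\<^bsub>K\<^esub> (inv\<^bsub>K\<^esub> f1 k \<otimes>\<^bsub>K\<^esub> f2 k) =
      (inv\<^bsub>K\<^esub> f1 k \<otimes>\<^bsub>K\<^esub> f2 k) \<otimes>\<^bsub>K\<^esub> commutator K (f1 g) (f2 h)"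
  obtains \<phi> where "\<phi> \<in> hom E K" "\<And>g. g \<in> carrier G \<Longrightarrow> \<phi> (E_gen G (Inl g)) = f1 g"
    "\<And>g. g \<in> carrier G \<Longrightarrow> \<phi> (E_gen G (Inr g)) = f2 g"
proof -
  interpret K: group K by fact
  obtain h where h: "h \<in> hom P K" and h1: "\<And>g. g \<in> carrier G \<Longrightarrow> h (cgen (Inl g)) = f1 g"
    and h2: "\<And>g. g \<in> carrier G \<Longrightarrow> h (cgen (Inr g)) = f2 g"
    using P_universal[OF assms(1) f] by metis
  interpret h: group_hom P K h
    using h by (simp add: group_hom_def group_hom_axioms_def P.is_group K.is_group)
  let ?D = "{commutator P x y | x y. x \<in> copy1 G ` carrier G \<and> y \<in> copy2 G ` carrier G}"
  let ?L = "{inv\<^bsub>P\<^esub> (copy1 G g) \<otimes>\<^bsub>P\<^esub> copy2 G g | g. g \<in> carrier G}"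
  have cc: "cgen (Inl g) \<in> carrier P" "cgen (Inr g) \<in> carrier P" if "g \<in> carrier G" for g
    using c_closed that by auto
  have DL: "h x \<otimes>\<^bsub>K\<^esub> h y = h y \<otimes>\<^bsub>K\<^esub> h x" if "x \<in> D_subgroup G" "y \<in> L_subgroup G" for x y
  proof (rule K.generate_commute_generate)
    show "h ` ?D \<subseteq> carrier K" using h.hom_closed D_gens_closed by blast
    show "h ` ?L \<subseteq> carrier K" using h.hom_closed L_gens_closed by blast
    show "h x \<in> generate K (h ` ?D)"
      using that(1) h.generate_img[OF D_gens_closed]
      unfolding D_subgroup_def commutator_subgroup_def by blast
    show "h y \<in> generate K (h ` ?L)"
      using that(2) h.generate_img[OF L_gens_closed] unfolding L_subgroup_def by blast
    fix s t assume "s \<in> h ` ?D" "t \<in> h ` ?L"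
    then obtain g g' k where gk: "g \<in> carrier G" "g' \<in> carrier G" "k \<in> carrier G"
      "s = h (commutator P (cgen (Inl g)) (cgen (Inr g')))" "t = h (inv\<^bsub>P\<^esub> (cgen (Inl k)) \<otimes>\<^bsub>P\<^esub> cgen (Inr k))"
      by blast
    then have "s = commutator K (f1 g) (f2 g')" "t = inv\<^bsub>K\<^esub> f1 k \<otimes>\<^bsub>K\<^esub> f2 k"
      using P.commutator_hom[OF K.is_group h] cc h1 h2 by simp_all
    then show "s \<otimes>\<^bsub>K\<^esub> t = t \<otimes>\<^bsub>K\<^esub> s" using comm gk by simp
  qed
  have "h s = \<one>\<^bsub>K\<^esub>" if "s \<in> DL" for s
  proof -
    obtain x y where xy: "x \<in> D_subgroup G" "y \<in> L_subgroup G" "s = commutator P x y"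
      using \<open>s \<in> DL\<close> by blast
    then show ?thesis
      using P.commutator_hom[OF K.is_group h D_closed L_closed] DL[OF xy(1,2)]
        K.commutator_eq_one_iff[of "h x" "h y"] D_closed L_closed by simp
  qed
  then have "h x = \<one>\<^bsub>K\<^esub>" if "x \<in> normal_closure P DL" for x
    using P.normal_closure_hom[OF assms(1) h DL_closed _ that] by blast
  then obtain \<phi> where \<phi>: "\<phi> \<in> hom (P Mod normal_closure P DL) K" "\<And>x. x \<in> carrier P \<Longrightarrow> \<phi> (q x) = h x"
    using P.hom_from_factor[OF M.normal_axioms assms(1) h] by blast
  show thesis
    using that[of \<phi>] \<phi> cc h1 h2 by (simp add: E_eq E_gen_eq)
qed

end


section \<open>Changing generators\<close>

lemma (in relators) normal_closure_eqv:
  assumes "w \<in> normal_closure F R"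
  shows "\<exists>k. eqv R k w []"
  using assms unfolding normal_closure_def
proof (induction rule: generate.induct)
  case one
  then show ?case by (auto simp: one_free_group)
next
  have conj: "eqv R 1 (inv\<^bsub>F\<^esub> t \<otimes>\<^bsub>F\<^esub> s \<otimes>\<^bsub>F\<^esub> t) []" if "s \<in> R" "t \<in> carrier F" for s t
  proof -
    have "eqv R 0 (inv\<^bsub>F\<^esub> t \<otimes>\<^bsub>F\<^esub> s \<otimes>\<^bsub>F\<^esub> t) (winv t @ s @ t)"
      using that eqv_sym[OF eqv_reduce[of R "winv t @ s @ t"]]
      by (simp add: mult_free_group inv_free_group reduce_append_left)
    moreover have "eqv R 1 (winv t @ s @ t) (winv t @ t)" using that by (intro eqv_relator)
    moreover have "eqv R 0 (winv t @ t) []" using eqv_winv_left_cancel[of R "[]" t "[]"] by simp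
    ultimately show ?thesis by (metis add.left_neutral add.right_neutral eqv_trans)
  qed
  {
    case (incl h)
    then show ?case using conj by blast
  next
    case (inv h)
    then obtain s t where st: "s \<in> R" "t \<in> carrier F" "h = inv\<^bsub>F\<^esub> t \<otimes>\<^bsub>F\<^esub> s \<otimes>\<^bsub>F\<^esub> t" by blast
    then have "h \<in> carrier F" using relators by auto
    then have "inv\<^bsub>F\<^esub> h = reduce (winv h)" by (rule inv_free_group)
    moreover have "eqv R 1 (winv h) []" using eqv_winv[OF conj[OF st(1,2)]] st(3) by simp
    ultimately show ?case using eqv_trans[OF eqv_sym[OF eqv_reduce[of R "winv h"]]] by metis
  }
next
  case (eng g h)
  then obtain k l where "eqv R k g []" "eqv R l h []" by blast
  then have "eqv R (k + l) (g @ h) []" using eqv_append by fastforce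
  then show ?case
    using eqv_trans[OF eqv_sym[OF eqv_reduce[of R "g @ h"]]] by (fastforce simp: mult_free_group)
qed

lemma subst_subst: "subst g (subst f w) = subst (\<lambda>x. subst g (f x)) w"
  by (induction w) (auto simp: signed_def)

lemma eqv_subst_letters:
  assumes "\<And>x. x \<in> X \<Longrightarrow> eqv P c [(x, True)] (f x)"
  shows "w \<in> words X \<Longrightarrow> eqv P (c * length w) w (subst f w)"
proof (induction w)
  case (Cons a w)
  obtain x s where a: "a = (x, s)" by (cases a)
  have "eqv P c [a] (signed f a)"
    using assms[of x] Cons.prems eqv_winv[OF assms[of x]]
    by (cases s) (auto simp: a signed_def inv_letter_def)
  from eqv_append[OF this Cons.IH] Cons.prems show ?case by simp
qed simp

text \<open>Tietze transformations: the old relators are translated by \<open>s\<close>, and each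
  new generator \<open>b\<close> is set equal to its double translation \<open>s (t b)\<close>. A
  trivial word over \<open>B\<close> is first replaced by its double translation and then filled
  with translated relators. This makes finite presentability usable on any finite generating
  set.\<close>

lemma finite_complete_relators:
  assumes E: "group E" and pres: "finite_presentation X R E"
    and B: "finite B" and \<epsilon>: "\<epsilon> \<in> B \<rightarrow> carrier E"
    and gen: "\<And>g. g \<in> carrier E \<Longrightarrow> \<exists>w \<in> words B. ev E \<epsilon> w = g"
  obtains P where "finite P" "\<And>p. p \<in> P \<Longrightarrow> p \<in> words B \<and> ev E \<epsilon> p = \<one>\<^bsub>E\<^esub>"
    "\<And>v. v \<in> words B \<Longrightarrow> ev E \<epsilon> v = \<one>\<^bsub>E\<^esub> \<Longrightarrow> \<exists>k. eqv P k v []"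
proof -
  interpret E: group E by fact
  interpret relators X R using pres by (simp add: relators_def finite_presentation_def)
  obtain \<eta> where \<eta>: "\<eta> \<in> UNIV \<rightarrow> carrier E"
    and surj: "\<And>g. g \<in> carrier E \<Longrightarrow> \<exists>w \<in> words X. ev E \<eta> w = g"
    and triv: "\<And>w. w \<in> words X \<Longrightarrow> ev E \<eta> w = \<one>\<^bsub>E\<^esub> \<longleftrightarrow> reduce w \<in> normal_closure F R"
    using finite_presentationE[OF E pres] by metis
  have \<eta>X: "\<eta> \<in> X \<rightarrow> carrier E" using \<eta> by auto
  have "\<exists>w \<in> words B. ev E \<epsilon> w = \<eta> x" for x using gen \<eta> by blast
  then obtain s where s: "\<And>x. s x \<in> words B" "\<And>x. ev E \<epsilon> (s x) = \<eta> x" by metis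
  have "\<exists>w \<in> words X. b \<in> B \<longrightarrow> ev E \<eta> w = \<epsilon> b" for b
    using surj[of "\<epsilon> b"] \<epsilon> by (cases "b \<in> B") (auto simp: Pi_iff intro: exI[of _ "[]"])
  then obtain t where t: "\<And>b. t b \<in> words X" "\<And>b. b \<in> B \<Longrightarrow> ev E \<eta> (t b) = \<epsilon> b" by metis
  let ?P1 = "subst s ` R" and ?P2 = "(\<lambda>b. (b, True) # winv (subst s (t b))) ` B"
  show thesis
  proof
    show "finite (?P1 \<union> ?P2)" using B pres by (simp add: finite_presentation_def)
  next
    have evs: "ev E \<epsilon> (subst s w) = ev E \<eta> w" if "w \<in> words X" for w
      using E.ev_subst[OF \<epsilon> _ that, of s] s by simp
    fix p assume "p \<in> ?P1 \<union> ?P2"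
    then consider r where "r \<in> R" "p = subst s r" | b where "b \<in> B" "p = (b, True) # winv (subst s (t b))"
      by blast
    then show "p \<in> words B \<and> ev E \<epsilon> p = \<one>\<^bsub>E\<^esub>"
    proof cases
      case 1
      then have r: "r \<in> words X" "reduce r = r"
        using relators by (auto simp: carrier_free_group reduce_reduced)
      have "r \<in> normal_closure F R" using 1(1) relators by (intro F.normal_closure_incl)
      then show ?thesis using 1(2) r triv evs subst_in_words[OF r(1), of s B] s by simp
    next
      case 2
      have "subst s (t b) \<in> words B" using subst_in_words[OF t(1)] s by blast
      then show ?thesis
        using 2 \<epsilon> evs[OF t(1)] t(2) by (auto simp: E.ev_winv[OF \<epsilon>] ev_letter_def Pi_iff)
    qed
  next
    fix v assume v: "v \<in> words B" "ev E \<epsilon> v = \<one>\<^bsub>E\<^esub>"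
    let ?P = "?P1 \<union> ?P2"
    have "eqv ?P 1 [(b, True)] (subst s (t b))" if "b \<in> B" for b
    proof -
      have "(b, True) # winv (subst s (t b)) \<in> ?P" using that by blast
      from eqv_relator[OF this, of "[]" "subst s (t b)"]
      have "eqv ?P 1 ((b, True) # winv (subst s (t b)) @ subst s (t b)) (subst s (t b))" by simp
      moreover have "eqv ?P 0 ((b, True) # winv (subst s (t b)) @ subst s (t b)) [(b, True)]"
        using eqv_winv_left_cancel[of ?P "[(b, True)]" "subst s (t b)" "[]"] by simp
      ultimately show ?thesis using eqv_trans[OF eqv_sym] by fastforce
    qed
    from eqv_subst_letters[OF this v(1)]
    have 1: "eqv ?P (length v) v (subst s (subst t v))" by (simp add: subst_subst)
    have tv: "subst t v \<in> words X" using subst_in_words[OF v(1)] t by blast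
    have "ev E \<eta> (subst t v) = \<one>\<^bsub>E\<^esub>"
      using E.ev_subst[OF \<eta>X _ v(1), of t] t v ev_cong[OF v(1), of "\<lambda>b. ev E \<eta> (t b)" \<epsilon> E] by simp
    then obtain k where "eqv R k (reduce (subst t v)) []"
      using triv[OF tv] normal_closure_eqv by blast
    then have "eqv R k (subst t v) []"
      using eqv_trans[OF eqv_reduce[of R "subst t v"]] by fastforce
    moreover have "eqv ?P 1 (subst s r) []" if "r \<in> R" for r
      using eqv_relator[of "subst s r" ?P "[]" "[]"] that by simp
    ultimately have "eqv ?P (1 * k) (subst s (subst t v)) (subst s [])"
      by (intro eqv_subst)
    then show "\<exists>k. eqv ?P k v []" using eqv_trans[OF 1] by auto
  qed
qed


section \<open>The abelianization of \<open>G\<close> is finite\<close>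

definition perm_group :: "('c \<Rightarrow> 'c) monoid" where
  "perm_group = \<lparr>carrier = {f. bij f}, mult = (\<circ>), one = id\<rparr>"

definition perm_families :: "('i \<Rightarrow> 'c \<Rightarrow> 'c) monoid" where
  "perm_families = \<lparr>carrier = {f. \<forall>i. bij (f i)}, mult = (\<lambda>f g i. f i \<circ> g i), one = (\<lambda>i. id)\<rparr>"

lemma group_perm_group: "group perm_group"
proof (rule groupI)
  fix f :: "'c \<Rightarrow> 'c" assume "f \<in> carrier perm_group"
  then have "bij f" by (simp add: perm_group_def)
  then have "inv_into UNIV f \<in> carrier perm_group"
    "inv_into UNIV f \<otimes>\<^bsub>perm_group\<^esub> f = \<one>\<^bsub>perm_group\<^esub>"
    by (auto simp: perm_group_def bij_imp_bij_inv bij_is_inj)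
  then show "\<exists>g\<in>carrier perm_group. g \<otimes>\<^bsub>perm_group\<^esub> f = \<one>\<^bsub>perm_group\<^esub>" by blast
qed (auto simp: perm_group_def bij_comp comp_assoc)

lemma group_perm_families: "group perm_families"
proof (rule groupI)
  fix f :: "'i \<Rightarrow> 'c \<Rightarrow> 'c" assume "f \<in> carrier perm_families"
  then have "\<forall>i. bij (f i)" by (simp add: perm_families_def)
  then have "(\<lambda>i. inv_into UNIV (f i)) \<in> carrier perm_families"
    "(\<lambda>i. inv_into UNIV (f i)) \<otimes>\<^bsub>perm_families\<^esub> f = \<one>\<^bsub>perm_families\<^esub>"
    by (auto simp: perm_families_def bij_imp_bij_inv bij_is_inj)
  then show "\<exists>g\<in>carrier perm_families. g \<otimes>\<^bsub>perm_families\<^esub> f = \<one>\<^bsub>perm_families\<^esub>" by blast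
qed (auto simp: perm_families_def bij_comp comp_assoc)

lemma perm_families_component: "(\<lambda>f. f i) \<in> hom perm_families perm_group"
  by (auto simp: hom_def perm_group_def perm_families_def)

lemma inv_perm_families: "f \<in> carrier perm_families \<Longrightarrow> (inv\<^bsub>perm_families\<^esub> f) i = inv\<^bsub>perm_group\<^esub> (f i)"
  using group_hom.hom_inv[of perm_families perm_group "\<lambda>f. f i" f] perm_families_component[of i]
  by (simp add: group_hom_def group_hom_axioms_def group_perm_group group_perm_families)

text \<open>The restricted product inside the full product of permutation groups: modulo it, a
  relation holds once it holds at all but finitely many indices.\<close>

definition eventually_id :: "('i \<Rightarrow> 'c \<Rightarrow> 'c) set" where
  "eventually_id = {f \<in> carrier perm_families. finite {i. f i \<noteq> id}}"

lemma eventually_id_normal: "(eventually_id :: ('i \<Rightarrow> 'c \<Rightarrow> 'c) set) \<lhd> perm_families"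
proof -
  interpret group "perm_families :: ('i \<Rightarrow> 'c \<Rightarrow> 'c) monoid" by (rule group_perm_families)
  interpret S: group "perm_group :: ('c \<Rightarrow> 'c) monoid" by (rule group_perm_group)
  have mult: "(f \<otimes>\<^bsub>perm_families\<^esub> g) i = f i \<otimes>\<^bsub>perm_group\<^esub> g i" for f g :: "'i \<Rightarrow> 'c \<Rightarrow> 'c" and i
    by (simp add: perm_families_def perm_group_def)
  have one: "(id :: 'c \<Rightarrow> 'c) = \<one>\<^bsub>perm_group\<^esub>" by (simp add: perm_group_def)
  have cl: "f i \<in> carrier perm_group" if "f \<in> carrier perm_families" for f :: "'i \<Rightarrow> 'c \<Rightarrow> 'c" and i
    using that by (simp add: perm_families_def perm_group_def)
  show ?thesis
    unfolding normal_inv_iff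
  proof (intro conjI ballI)
    show "subgroup (eventually_id :: ('i \<Rightarrow> 'c \<Rightarrow> 'c) set) perm_families"
    proof (rule subgroup.intro)
      fix f g :: "'i \<Rightarrow> 'c \<Rightarrow> 'c" assume fg: "f \<in> eventually_id" "g \<in> eventually_id"
      have "{i. (f \<otimes>\<^bsub>perm_families\<^esub> g) i \<noteq> id} \<subseteq> {i. f i \<noteq> id} \<union> {i. g i \<noteq> id}"
        by (auto simp: perm_families_def)
      then have "finite {i. (f \<otimes>\<^bsub>perm_families\<^esub> g) i \<noteq> id}"
        using fg by (elim finite_subset) (auto simp: eventually_id_def)
      then show "f \<otimes>\<^bsub>perm_families\<^esub> g \<in> eventually_id"
        using fg by (simp add: eventually_id_def)
    next
      fix f :: "'i \<Rightarrow> 'c \<Rightarrow> 'c" assume f: "f \<in> eventually_id"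
      then have "{i. (inv\<^bsub>perm_families\<^esub> f) i \<noteq> id} \<subseteq> {i. f i \<noteq> id}"
        by (auto simp: eventually_id_def inv_perm_families one)
      then have "finite {i. (inv\<^bsub>perm_families\<^esub> f) i \<noteq> id}"
        using f by (elim finite_subset) (auto simp: eventually_id_def)
      then show "inv\<^bsub>perm_families\<^esub> f \<in> eventually_id" using f by (simp add: eventually_id_def)
    next
      show "eventually_id \<subseteq> carrier (perm_families :: ('i \<Rightarrow> 'c \<Rightarrow> 'c) monoid)"
        by (auto simp: eventually_id_def)
    next
      show "\<one>\<^bsub>perm_families\<^esub> \<in> (eventually_id :: ('i \<Rightarrow> 'c \<Rightarrow> 'c) set)"
        unfolding eventually_id_def by (simp, simp add: perm_families_def)
    qed
  next
    fix x h :: "'i \<Rightarrow> 'c \<Rightarrow> 'c" assume x: "x \<in> carrier perm_families" and h: "h \<in> eventually_id"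
    then have "{i. (x \<otimes>\<^bsub>perm_families\<^esub> h \<otimes>\<^bsub>perm_families\<^esub> inv\<^bsub>perm_families\<^esub> x) i \<noteq> id} \<subseteq> {i. h i \<noteq> id}"
      using cl[OF x] by (auto simp: mult inv_perm_families one)
    then have "finite {i. (x \<otimes>\<^bsub>perm_families\<^esub> h \<otimes>\<^bsub>perm_families\<^esub> inv\<^bsub>perm_families\<^esub> x) i \<noteq> id}"
      using h by (elim finite_subset) (auto simp: eventually_id_def)
    then show "x \<otimes>\<^bsub>perm_families\<^esub> h \<otimes>\<^bsub>perm_families\<^esub> inv\<^bsub>perm_families\<^esub> x \<in> eventually_id"
      using x h by (simp add: eventually_id_def)
  qed
qed

section \<open>An abelian group of elements and its conjugate by one further element\<close>

context group
begin

text \<open>With \<open>a\<close> and \<open>b\<close> commuting, the commutator of \<open>a\<close>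
  with the conjugate of \<open>b\<close> by \<open>s\<close> becomes a product of conjugates of
  \<open>s\<close> and its inverse by \<open>a\<close>, \<open>b a\<close>, \<open>b\<close> and the
  identity.\<close>

lemma commutator_conjugate:
  assumes ab: "a \<in> carrier G" "b \<in> carrier G" "a \<otimes> b = b \<otimes> a" and s: "s \<in> carrier G"
  shows "commutator G a (inv s \<otimes> b \<otimes> s) =
    inv (inv a \<otimes> s \<otimes> a) \<otimes> (inv (b \<otimes> a) \<otimes> s \<otimes> (b \<otimes> a)) \<otimes> inv (inv b \<otimes> s \<otimes> b) \<otimes> s"
proof -
  have canc: "inv x \<otimes> (x \<otimes> y) = y" "x \<otimes> (inv x \<otimes> y) = y" if "x \<in> carrier G" "y \<in> carrier G" for x y
    using that by (simp_all add: m_assoc[symmetric])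
  have "b \<otimes> (a \<otimes> (inv b \<otimes> y)) = a \<otimes> y" if y: "y \<in> carrier G" for y
  proof -
    have "b \<otimes> (a \<otimes> (inv b \<otimes> y)) = (a \<otimes> b) \<otimes> (inv b \<otimes> y)"
      unfolding ab(3) using ab(1,2) y by (simp add: m_assoc)
    then show ?thesis using ab(1,2) y by (simp add: m_assoc canc)
  qed
  then show ?thesis
    using ab(1,2) s by (simp add: commutator_def inv_mult_group m_assoc canc)
qed

text \<open>Sending one copy of \<open>H\<close> through \<alpha> and the other through \<alpha>
  conjugated by \<open>s\<close> satisfies the relations of \<open>\<E>(H)\<close>: \<open>d\<close>
  and \<open>l\<close> both lie in the subgroup generated by the conjugates \<open>\<tau> x\<close>
  of \<open>s\<close>. This subgroup is abelian, because conjugation takes the pair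
  \<open>\<tau> a\<close>, \<open>\<tau> b\<close> to the pair \<open>s\<close>,
  \<open>\<tau> (b a^-1)\<close>, which commutes by assumption.\<close>

lemma conjugate_commuting:
  assumes H: "group H" and \<alpha>: "\<alpha> \<in> hom H G"
    and ab: "\<And>g h. g \<in> carrier H \<Longrightarrow> h \<in> carrier H \<Longrightarrow> \<alpha> g \<otimes> \<alpha> h = \<alpha> h \<otimes> \<alpha> g"
    and s: "s \<in> carrier G"
    and comm: "\<And>g. g \<in> carrier H \<Longrightarrow> s \<otimes> (inv \<alpha> g \<otimes> s \<otimes> \<alpha> g) = (inv \<alpha> g \<otimes> s \<otimes> \<alpha> g) \<otimes> s"
    and ghk: "g \<in> carrier H" "h \<in> carrier H" "k \<in> carrier H"
  defines "d \<equiv> commutator G (\<alpha> g) (inv s \<otimes> \<alpha> h \<otimes> s)"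
    and "l \<equiv> inv \<alpha> k \<otimes> (inv s \<otimes> \<alpha> k \<otimes> s)"
  shows "d \<otimes> l = l \<otimes> d"
proof -
  interpret H: group H by fact
  have cl [simp]: "\<alpha> x \<in> carrier G" if "x \<in> carrier H" for x using \<alpha> that by (auto simp: hom_def)
  note [simp] = s
  have hm: "\<alpha> (x \<otimes>\<^bsub>H\<^esub> y) = \<alpha> x \<otimes> \<alpha> y" if "x \<in> carrier H" "y \<in> carrier H" for x y
    using \<alpha> that by (auto simp: hom_def)
  have hi: "\<alpha> (inv\<^bsub>H\<^esub> x) = inv \<alpha> x" if "x \<in> carrier H" for x
    using group_hom.hom_inv[of H G \<alpha> x] that \<alpha> H by (simp add: group_hom_def group_hom_axioms_def group_axioms)
  have h1: "\<alpha> \<one>\<^bsub>H\<^esub> = \<one>"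
    using group_hom.hom_one[of H G \<alpha>] \<alpha> H by (simp add: group_hom_def group_hom_axioms_def group_axioms)
  have canc: "inv x \<otimes> (x \<otimes> y) = y" "x \<otimes> (inv x \<otimes> y) = y" if "x \<in> carrier G" "y \<in> carrier G" for x y
    using that by (simp_all add: m_assoc[symmetric])
  define \<tau> where "\<tau> = (\<lambda>g. inv \<alpha> g \<otimes> s \<otimes> \<alpha> g)"
  have \<tau>c: "\<tau> x \<in> carrier G" if "x \<in> carrier H" for x using that by (simp add: \<tau>_def)
  have \<tau>1: "\<tau> \<one>\<^bsub>H\<^esub> = s" by (simp add: \<tau>_def h1)
  let ?S = "\<tau> ` carrier H"
  have S: "?S \<subseteq> carrier G" using \<tau>c by auto
  have gen: "\<tau> x \<in> generate G ?S" "inv \<tau> x \<in> generate G ?S" if "x \<in> carrier H" for x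
    using that by (auto intro: generate.incl generate.inv)
  have l: "l = inv \<tau> k \<otimes> \<tau> \<one>\<^bsub>H\<^esub>"
    unfolding \<tau>1 using ghk by (simp add: l_def \<tau>_def inv_mult_group m_assoc)
  have d: "d = inv \<tau> g \<otimes> \<tau> (h \<otimes>\<^bsub>H\<^esub> g) \<otimes> inv \<tau> h \<otimes> \<tau> \<one>\<^bsub>H\<^esub>"
    using commutator_conjugate[OF cl[OF ghk(1)] cl[OF ghk(2)] ab[OF ghk(1,2)] s]
    unfolding \<tau>1 unfolding \<tau>_def d_def hm[OF ghk(2,1)] .
  have "x \<otimes> y = y \<otimes> x" if xy: "x \<in> ?S" "y \<in> ?S" for x y
  proof -
    obtain a b where a: "a \<in> carrier H" "x = \<tau> a" and b: "b \<in> carrier H" "y = \<tau> b"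
      using xy by auto
    let ?c = "b \<otimes>\<^bsub>H\<^esub> inv\<^bsub>H\<^esub> a"
    have c: "?c \<in> carrier H" using a b by simp
    have y: "y = inv \<alpha> a \<otimes> \<tau> ?c \<otimes> \<alpha> a"
      using a b by (simp add: \<tau>_def hm hi inv_mult_group m_assoc canc)
    have x: "x = inv \<alpha> a \<otimes> s \<otimes> \<alpha> a" using a(2) by (simp only: \<tau>_def)
    have "x \<otimes> y = inv \<alpha> a \<otimes> (s \<otimes> \<tau> ?c) \<otimes> \<alpha> a"
      unfolding x y using a(1) c \<tau>c[OF c] by (simp add: m_assoc canc)
    also have "s \<otimes> \<tau> ?c = \<tau> ?c \<otimes> s" using comm[OF c] by (simp add: \<tau>_def)
    also have "inv \<alpha> a \<otimes> (\<tau> ?c \<otimes> s) \<otimes> \<alpha> a = y \<otimes> x"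
      unfolding x y using a(1) c \<tau>c[OF c] by (simp add: m_assoc canc)
    finally show ?thesis .
  qed
  moreover have "d \<in> generate G ?S"
    unfolding d using ghk gen by (intro generate.eng) auto
  moreover have "l \<in> generate G ?S"
    unfolding l using ghk gen by (intro generate.eng) auto
  ultimately show ?thesis using generate_commute_generate[OF S S] by blast
qed

end

text \<open>Two transpositions, on levels 0, 1 over \<open>a\<close> and on levels 1, 2 over
  \<open>b\<close>. They generate a nonabelian group as soon as translations bring them over the
  same point, and this is what will violate the relations.\<close>

definition swap_levels :: "'c \<Rightarrow> 'c \<Rightarrow> 'c \<times> nat \<Rightarrow> 'c \<times> nat" where
  "swap_levels a b = (\<lambda>(x, i).
     if x = a \<and> i = 0 then (a, 1) else if x = a \<and> i = 1 then (a, 0)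
     else if x = b \<and> i = 1 then (b, 2) else if x = b \<and> i = 2 then (b, 1) else (x, i))"

lemma swap_levels_involution: "a \<noteq> b \<Longrightarrow> swap_levels a b (swap_levels a b p) = p"
  by (cases p) (auto simp: swap_levels_def)

text \<open>Under these conditions the two maps either coincide or have disjoint supports.\<close>

lemma swap_levels_commute:
  assumes "a \<noteq> b" "c \<noteq> d" "b \<noteq> c" "a \<noteq> d" "a = c \<longleftrightarrow> b = d"
  shows "swap_levels a b (swap_levels c d p) = swap_levels c d (swap_levels a b p)"
  using assms by (cases p) (auto simp: swap_levels_def)

text \<open>The regular action on the first coordinate, extended by the identity off the carrier to
  obtain a permutation of the whole type.\<close>

definition translate :: "('c, 'e) monoid_scheme \<Rightarrow> 'c \<Rightarrow> 'c \<times> nat \<Rightarrow> 'c \<times> nat" where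
  "translate A x = (\<lambda>(y, i). (if y \<in> carrier A then x \<otimes>\<^bsub>A\<^esub> y else y, i))"

section \<open>Permutation representations indexed by an abelian quotient\<close>

locale infinite_quotient = G: group G + A: comm_group A
  for G :: "('a, 'b) monoid_scheme" and A :: "('c, 'e) monoid_scheme" +
  fixes \<pi> :: "'a \<Rightarrow> 'c"
  assumes \<pi>: "\<pi> \<in> hom G A"
begin

lemma \<pi>_closed [simp]: "g \<in> carrier G \<Longrightarrow> \<pi> g \<in> carrier A"
  using \<pi> by (auto simp: hom_def)

sublocale \<pi>: group_hom G A \<pi>
  using \<pi> by (simp add: group_hom_def group_hom_axioms_def)

sublocale PF: group "perm_families :: ('c \<Rightarrow> 'c \<times> nat \<Rightarrow> 'c \<times> nat) monoid"
  by (rule group_perm_families)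

lemma translate_mult: "x \<in> carrier A \<Longrightarrow> y \<in> carrier A \<Longrightarrow>
    translate A x \<circ> translate A y = translate A (x \<otimes>\<^bsub>A\<^esub> y)"
  by (auto simp: translate_def fun_eq_iff A.m_assoc)

lemma translate_one: "translate A \<one>\<^bsub>A\<^esub> = id"
  by (auto simp: translate_def fun_eq_iff)

lemma bij_translate: "x \<in> carrier A \<Longrightarrow> bij (translate A x)"
  using translate_mult[of x "inv\<^bsub>A\<^esub> x"] translate_mult[of "inv\<^bsub>A\<^esub> x" x]
  by (intro o_bij[of "translate A (inv\<^bsub>A\<^esub> x)"]) (auto simp: translate_one)

text \<open>Constant in the index: only \<open>swaps\<close> varies, and the indices are themselves
  elements of \<open>A\<close>, each naming the second point over which levels are
  exchanged.\<close>

definition shift :: "'a \<Rightarrow> 'c \<Rightarrow> 'c \<times> nat \<Rightarrow> 'c \<times> nat" where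
  "shift g = (\<lambda>n. translate A (\<pi> g))"

text \<open>\<open>swap_levels\<close> is an involution only over two distinct points, so the
  remaining indices get the identity.\<close>

definition swaps :: "'c \<Rightarrow> 'c \<times> nat \<Rightarrow> 'c \<times> nat" where
  "swaps n = (if n \<in> carrier A \<and> n \<noteq> \<one>\<^bsub>A\<^esub> then swap_levels \<one>\<^bsub>A\<^esub> n else id)"

lemma shift_hom: "shift \<in> hom G perm_families"
  by (auto simp: hom_def shift_def perm_families_def bij_translate translate_mult)

lemma shift_commute: "g \<in> carrier G \<Longrightarrow> h \<in> carrier G \<Longrightarrow>
    shift g \<otimes>\<^bsub>perm_families\<^esub> shift h = shift h \<otimes>\<^bsub>perm_families\<^esub> shift g"
  by (simp add: shift_def perm_families_def translate_mult A.m_comm)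

lemma shift_closed [simp]: "g \<in> carrier G \<Longrightarrow> shift g \<in> carrier perm_families"
  using shift_hom by (auto simp: hom_def)

lemma inv_shift: "g \<in> carrier G \<Longrightarrow> inv\<^bsub>perm_families\<^esub> shift g = shift (inv\<^bsub>G\<^esub> g)"
  using group_hom.hom_inv[of G perm_families shift g] shift_hom
  by (simp add: group_hom_def group_hom_axioms_def PF.is_group)

lemma swaps_involution: "swaps n \<circ> swaps n = id"
  by (auto simp: swaps_def swap_levels_involution fun_eq_iff)

lemma swaps_closed [simp]: "swaps \<in> carrier perm_families"
proof -
  have "bij (swaps n)" for n by (rule o_bij[OF swaps_involution swaps_involution])
  then show ?thesis by (simp add: perm_families_def)
qed

lemma inv_swaps: "inv\<^bsub>perm_families\<^esub> swaps = swaps"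
proof (rule PF.inv_equality)
  show "swaps \<otimes>\<^bsub>perm_families\<^esub> swaps = \<one>\<^bsub>perm_families\<^esub>"
    by (simp add: perm_families_def swaps_involution)
qed simp_all

text \<open>The action of the second copy of \<open>G\<close>: it is the first one conjugated by
  \<open>swaps\<close>, as in \<open>conjugate_commuting\<close>.\<close>

definition twisted :: "'a \<Rightarrow> 'c \<Rightarrow> 'c \<times> nat \<Rightarrow> 'c \<times> nat" where
  "twisted g = inv\<^bsub>perm_families\<^esub> swaps \<otimes>\<^bsub>perm_families\<^esub> shift g \<otimes>\<^bsub>perm_families\<^esub> swaps"

lemma twisted_closed [simp]: "g \<in> carrier G \<Longrightarrow> twisted g \<in> carrier perm_families"
  by (simp add: twisted_def)

lemma twisted_hom: "twisted \<in> hom G perm_families"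
proof (rule homI)
  fix g h assume gh: "g \<in> carrier G" "h \<in> carrier G"
  have "swaps \<otimes>\<^bsub>perm_families\<^esub> (inv\<^bsub>perm_families\<^esub> swaps \<otimes>\<^bsub>perm_families\<^esub> y) = y"
    if "y \<in> carrier perm_families" for y
    using that by (simp add: PF.m_assoc[symmetric] del: inv_swaps)
  then show "twisted (g \<otimes>\<^bsub>G\<^esub> h) = twisted g \<otimes>\<^bsub>perm_families\<^esub> twisted h"
    using gh shift_hom by (simp add: twisted_def hom_mult PF.m_assoc)
qed simp

lemma inv_twisted: "g \<in> carrier G \<Longrightarrow> inv\<^bsub>perm_families\<^esub> twisted g = twisted (inv\<^bsub>G\<^esub> g)"
  using group_hom.hom_inv[of G perm_families twisted g] twisted_hom
  by (simp add: group_hom_def group_hom_axioms_def PF.is_group)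

lemma twisted_eq: "twisted g n = swaps n \<circ> translate A (\<pi> g) \<circ> swaps n"
  by (simp add: twisted_def inv_swaps) (simp add: perm_families_def shift_def)

lemma translated_swaps:
  assumes "t \<in> carrier A" "n \<in> carrier A" "n \<noteq> \<one>\<^bsub>A\<^esub>"
  shows "translate A (inv\<^bsub>A\<^esub> t) \<circ> swaps n \<circ> translate A t =
    swap_levels (inv\<^bsub>A\<^esub> t) (inv\<^bsub>A\<^esub> t \<otimes>\<^bsub>A\<^esub> n)"
proof
  fix p :: "'c \<times> nat"
  obtain y i where p: "p = (y, i)" by (cases p)
  have 1: "t \<otimes>\<^bsub>A\<^esub> y = \<one>\<^bsub>A\<^esub> \<longleftrightarrow> y = inv\<^bsub>A\<^esub> t" if "y \<in> carrier A"
    using that assms by (metis A.inv_equality A.inv_inv A.inv_closed A.r_inv)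
  have 2: "t \<otimes>\<^bsub>A\<^esub> y = n \<longleftrightarrow> y = inv\<^bsub>A\<^esub> t \<otimes>\<^bsub>A\<^esub> n" if "y \<in> carrier A"
    using that assms by (metis A.inv_solve_left)
  have 4: "t \<otimes>\<^bsub>A\<^esub> (inv\<^bsub>A\<^esub> t \<otimes>\<^bsub>A\<^esub> n) = n"
    using assms by (simp add: A.m_assoc[symmetric])
  have 3: "inv\<^bsub>A\<^esub> t \<otimes>\<^bsub>A\<^esub> (t \<otimes>\<^bsub>A\<^esub> y) = y" if "y \<in> carrier A"
    using that assms by (simp add: A.m_assoc[symmetric])
  show "(translate A (inv\<^bsub>A\<^esub> t) \<circ> swaps n \<circ> translate A t) p =
    swap_levels (inv\<^bsub>A\<^esub> t) (inv\<^bsub>A\<^esub> t \<otimes>\<^bsub>A\<^esub> n) p"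
  proof (cases "y \<in> carrier A")
    case True
    then show ?thesis using assms 1 2 3 4
      by (simp add: p translate_def swaps_def swap_levels_def)
  next
    case False
    then have "y \<noteq> \<one>\<^bsub>A\<^esub>" "y \<noteq> n" "y \<noteq> inv\<^bsub>A\<^esub> t" "y \<noteq> inv\<^bsub>A\<^esub> t \<otimes>\<^bsub>A\<^esub> n" using assms by auto
    then show ?thesis using False assms by (simp add: p translate_def swaps_def swap_levels_def)
  qed
qed

text \<open>The swaps exchange points on the levels 0 and 1 over \<open>\<one>\<close> and on the levels 1 and 2 over \<open>n\<close>, so
  a nontrivial translate has common support with them only if it is by \<open>n\<close> or its inverse.\<close>

lemma swaps_almost_commute:
  assumes "g \<in> carrier G" and n: "n \<notin> {\<one>\<^bsub>A\<^esub>, \<pi> g, inv\<^bsub>A\<^esub> \<pi> g}"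
  defines "T \<equiv> translate A (inv\<^bsub>A\<^esub> \<pi> g) \<circ> swaps n \<circ> translate A (\<pi> g)"
  shows "swaps n \<circ> T = T \<circ> swaps n"
proof (cases "n \<in> carrier A")
  case True
  have t: "\<pi> g \<in> carrier A" using assms by simp
  have T: "T = swap_levels (inv\<^bsub>A\<^esub> \<pi> g) (inv\<^bsub>A\<^esub> \<pi> g \<otimes>\<^bsub>A\<^esub> n)"
    unfolding T_def using n True t by (intro translated_swaps) auto
  have S: "swaps n = swap_levels \<one>\<^bsub>A\<^esub> n" using n True by (simp add: swaps_def)
  have "inv\<^bsub>A\<^esub> \<pi> g \<noteq> inv\<^bsub>A\<^esub> \<pi> g \<otimes>\<^bsub>A\<^esub> n"
    using n True t by (metis A.inv_closed A.l_cancel_one insertCI)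
  moreover have "\<one>\<^bsub>A\<^esub> \<noteq> inv\<^bsub>A\<^esub> \<pi> g \<otimes>\<^bsub>A\<^esub> n"
    using n True t by (metis A.inv_closed A.inv_solve_left A.one_closed A.r_one insertCI)
  moreover have "\<one>\<^bsub>A\<^esub> = inv\<^bsub>A\<^esub> \<pi> g \<longleftrightarrow> n = inv\<^bsub>A\<^esub> \<pi> g \<otimes>\<^bsub>A\<^esub> n"
    using True t by (metis A.inv_closed A.r_cancel_one)
  ultimately show ?thesis
    unfolding T S fun_eq_iff comp_def using n by (intro allI swap_levels_commute) auto
next
  case False
  then have "T = id"
    using assms(1) translate_mult[of "inv\<^bsub>A\<^esub> \<pi> g" "\<pi> g"] by (simp add: T_def swaps_def translate_one)
  then show ?thesis by simp
qed

text \<open>For fixed \<open>g\<close> at most three indices are exceptional, so modulo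
  \<open>eventually_id\<close> the swaps commute with all their translates. This is the commutation
  hypothesis of \<open>conjugate_commuting\<close> in the quotient.\<close>

lemma swaps_commute_mod:
  assumes g: "g \<in> carrier G"
  defines "t \<equiv> inv\<^bsub>perm_families\<^esub> shift g \<otimes>\<^bsub>perm_families\<^esub> swaps \<otimes>\<^bsub>perm_families\<^esub> shift g"
  shows "commutator perm_families swaps t \<in> eventually_id"
proof -
  have t: "t \<in> carrier perm_families" using g by (simp add: t_def)
  have "{n. commutator perm_families swaps t n \<noteq> id} \<subseteq> {\<one>\<^bsub>A\<^esub>, \<pi> g, inv\<^bsub>A\<^esub> \<pi> g}"
  proof (rule subsetI, rule ccontr)
    fix n assume n: "n \<in> {n. commutator perm_families swaps t n \<noteq> id}" "n \<notin> {\<one>\<^bsub>A\<^esub>, \<pi> g, inv\<^bsub>A\<^esub> \<pi> g}"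
    interpret S: group "perm_group :: ('c \<times> nat \<Rightarrow> 'c \<times> nat) monoid" by (rule group_perm_group)
    have "commutator perm_families swaps t n = commutator perm_group (swaps n) (t n)"
      by (rule PF.commutator_hom[OF S.is_group perm_families_component]) (use t in simp_all)
    moreover have "t n = translate A (inv\<^bsub>A\<^esub> \<pi> g) \<circ> swaps n \<circ> translate A (\<pi> g)"
      using g by (simp add: t_def inv_shift) (simp add: perm_families_def shift_def)
    then have "swaps n \<circ> t n = t n \<circ> swaps n" using swaps_almost_commute[OF g n(2)] by simp
    then have "commutator perm_group (swaps n) (t n) = \<one>\<^bsub>perm_group\<^esub>"
      using hom_in_carrier[OF perm_families_component, of _ n] t swaps_closed
      by (subst S.commutator_eq_one_iff) (auto simp: perm_group_def perm_families_def)
    ultimately show False using n(1) by (simp add: perm_group_def)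
  qed
  then have "finite {n. commutator perm_families swaps t n \<noteq> id}" by (rule finite_subset) simp
  then show ?thesis using t by (simp add: eventually_id_def)
qed

text \<open>The permutations \<open>shift g\<close> and \<open>twisted g\<close> violate the relations of \<open>\<E>(G)\<close> for each
  fixed \<open>n\<close>.\<close>

lemma not_commuting:
  assumes n: "n \<in> carrier A" "n \<noteq> \<one>\<^bsub>A\<^esub>"
    and p: "p \<in> carrier A" "p \<noteq> \<one>\<^bsub>A\<^esub>" "p \<noteq> n" and q: "q \<in> carrier A" "q \<noteq> \<one>\<^bsub>A\<^esub>" "q \<noteq> p"
    and ghk: "g \<in> carrier G" "h \<in> carrier G" "k \<in> carrier G"
    and \<pi>s: "\<pi> g = inv\<^bsub>A\<^esub> p" "\<pi> h = inv\<^bsub>A\<^esub> q" "\<pi> k = inv\<^bsub>A\<^esub> p \<otimes>\<^bsub>A\<^esub> n"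
  defines "d \<equiv> commutator perm_families (shift g) (twisted h)"
    and "l \<equiv> inv\<^bsub>perm_families\<^esub> shift k \<otimes>\<^bsub>perm_families\<^esub> twisted k"
  shows "d n \<circ> l n \<noteq> l n \<circ> d n"
proof
  assume eq: "d n \<circ> l n = l n \<circ> d n"
  let ?s = "swaps n" and ?t = "translate A"
  have d: "d n = ?t p \<circ> (?s \<circ> ?t q \<circ> ?s) \<circ> ?t (inv\<^bsub>A\<^esub> p) \<circ> (?s \<circ> ?t (inv\<^bsub>A\<^esub> q) \<circ> ?s)"
    using ghk \<pi>s p q by (simp add: d_def commutator_def inv_shift inv_twisted)
       (simp add: perm_families_def shift_def twisted_eq)
  have k: "inv\<^bsub>A\<^esub> (inv\<^bsub>A\<^esub> p \<otimes>\<^bsub>A\<^esub> n) = inv\<^bsub>A\<^esub> n \<otimes>\<^bsub>A\<^esub> p" using n p by (simp add: A.inv_mult_group)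
  have l: "l n = ?t (inv\<^bsub>A\<^esub> n \<otimes>\<^bsub>A\<^esub> p) \<circ> (?s \<circ> ?t (inv\<^bsub>A\<^esub> p \<otimes>\<^bsub>A\<^esub> n) \<circ> ?s)"
    using ghk \<pi>s p n by (simp add: l_def inv_shift)
       (simp add: perm_families_def shift_def twisted_eq k)
  have s: "?s = swap_levels \<one>\<^bsub>A\<^esub> n" using n by (simp add: swaps_def)
  have qp: "inv\<^bsub>A\<^esub> q \<otimes>\<^bsub>A\<^esub> p \<noteq> \<one>\<^bsub>A\<^esub>"
    using p q by (metis A.inv_equality A.inv_inv A.inv_closed)
  have p1: "inv\<^bsub>A\<^esub> p \<otimes>\<^bsub>A\<^esub> (inv\<^bsub>A\<^esub> q \<otimes>\<^bsub>A\<^esub> p) = inv\<^bsub>A\<^esub> q"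
    using p q by (metis A.inv_closed A.inv_solve_left A.m_closed A.m_comm)
  have q1: "inv\<^bsub>A\<^esub> q \<noteq> \<one>\<^bsub>A\<^esub>" using q by (metis A.inv_inv A.inv_one)
  have n1: "inv\<^bsub>A\<^esub> p \<otimes>\<^bsub>A\<^esub> n \<otimes>\<^bsub>A\<^esub> p = n"
    using n p by (metis A.inv_closed A.m_assoc A.m_comm A.r_inv A.r_one)
  have n2: "inv\<^bsub>A\<^esub> n \<otimes>\<^bsub>A\<^esub> p \<otimes>\<^bsub>A\<^esub> n = p"
    using n p by (metis A.inv_closed A.m_assoc A.m_comm A.r_inv A.r_one)
  \<comment> \<open>The witness is \<open>(p, 0)\<close>. Translation by \<open>p^-1 n\<close>
    carries \<open>p\<close> to \<open>n\<close>, so over \<open>p\<close> the map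
    \<open>l n\<close> exchanges levels 1 and 2; translation by \<open>p^-1\<close> carries it to
    the identity, where \<open>d n\<close> picks up the exchange of levels 0 and 1. Thus one order
    ends at level 1 and the other at level 2.\<close>
  have lp0: "l n (p, 0) = (p, 0)"
    using n p by (simp add: l s swap_levels_def translate_def n1 n2)
  have lp1: "l n (p, 1) = (p, 2)"
    using n p by (simp add: l s swap_levels_def translate_def n1 n2)
  have dp0: "d n (p, 0) = (p, 1)"
    using n p q qp q1 by (simp add: d s swap_levels_def translate_def p1)
  show False using fun_cong[OF eq, of "(p, 0)"] by (simp add: lp0 lp1[simplified] dp0)
qed

end


section \<open>Generators of E(G) and finiteness of its abelian data\<close>

locale E_generated = E_construction G for G :: "('a, 'b) monoid_scheme" (structure) +
  fixes Y :: "'y set" and \<gamma> :: "'y \<Rightarrow> 'a"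
  assumes finite_Y: "finite Y" and \<gamma>: "\<gamma> \<in> UNIV \<rightarrow> carrier G"
    and \<gamma>_gen: "\<And>g. g \<in> carrier G \<Longrightarrow> \<exists>w \<in> words Y. ev G \<gamma> w = g"
begin

abbreviation B where "B \<equiv> Y <+> Y"

definition both :: "('a \<Rightarrow> 'k) \<Rightarrow> ('a \<Rightarrow> 'k) \<Rightarrow> 'y + 'y \<Rightarrow> 'k" where
  "both f1 f2 = case_sum (\<lambda>y. f1 (\<gamma> y)) (\<lambda>y. f2 (\<gamma> y))"

abbreviation iota1 where "iota1 \<equiv> \<lambda>g. E_gen G (Inl g)"
abbreviation iota2 where "iota2 \<equiv> \<lambda>g. E_gen G (Inr g)"

definition \<epsilon> :: "'y + 'y \<Rightarrow> ('a + 'a) word set set" where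
  "\<epsilon> = both iota1 iota2"

definition copyL :: "'y word \<Rightarrow> ('y + 'y) word" where
  "copyL = subst (\<lambda>y. [(Inl y, True)])"

definition copyR :: "'y word \<Rightarrow> ('y + 'y) word" where
  "copyR = subst (\<lambda>y. [(Inr y, True)])"

lemma \<gamma>_closed [simp]: "\<gamma> y \<in> carrier G"
  using \<gamma> by auto

lemma both_closed: "f1 \<in> carrier G \<rightarrow> carrier K \<Longrightarrow> f2 \<in> carrier G \<rightarrow> carrier K \<Longrightarrow> both f1 f2 \<in> UNIV \<rightarrow> carrier K"
  by (auto simp: both_def Pi_iff split: sum.split)

lemma \<epsilon>_closed: "\<epsilon> \<in> UNIV \<rightarrow> carrier E"
  unfolding \<epsilon>_def using E_gen_hom by (intro both_closed) (auto simp: hom_def)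

lemma copy_words: "w \<in> words Y \<Longrightarrow> copyL w \<in> words B" "w \<in> words Y \<Longrightarrow> copyR w \<in> words B"
  by (auto simp: copyL_def copyR_def intro!: subst_in_words[of w Y])

lemma ev_copy:
  assumes "group K" and f: "f1 \<in> hom G K" "f2 \<in> hom G K"
  shows "ev K (both f1 f2) (copyL w) = f1 (ev G \<gamma> w)" "ev K (both f1 f2) (copyR w) = f2 (ev G \<gamma> w)"
proof -
  interpret K: group K by fact
  have U: "v \<in> words UNIV" for v :: "'z word" by (simp add: words_def)
  have b: "both f1 f2 \<in> UNIV \<rightarrow> carrier K" using f by (intro both_closed) (auto simp: hom_def)
  have cl: "f1 (\<gamma> y) \<in> carrier K" "f2 (\<gamma> y) \<in> carrier K" for y
    using f by (auto simp: hom_def)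
  show "ev K (both f1 f2) (copyL w) = f1 (ev G \<gamma> w)"
    unfolding copyL_def K.ev_subst[OF b U U] ev_hom[OF assms(1) f(1) \<gamma> U]
    using cl by (simp add: ev_letter_def both_def)
  show "ev K (both f1 f2) (copyR w) = f2 (ev G \<gamma> w)"
    unfolding copyR_def K.ev_subst[OF b U U] ev_hom[OF assms(1) f(2) \<gamma> U]
    using cl by (simp add: ev_letter_def both_def)
qed

lemma \<epsilon>_gen: "x \<in> carrier E \<Longrightarrow> \<exists>w \<in> words B. ev E \<epsilon> w = x"
proof -
  assume "x \<in> carrier E"
  then obtain v where v: "v \<in> words XX" "x = ev E (E_gen G) v" using E_surj by blast
  have \<epsilon>B: "\<epsilon> \<in> B \<rightarrow> carrier E" using \<epsilon>_closed by auto
  have "\<exists>w. z \<in> XX \<longrightarrow> w \<in> words B \<and> ev E \<epsilon> w = E_gen G z" for z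
  proof (cases "z \<in> XX")
    case True
    then obtain g where g: "g \<in> carrier G" "z = Inl g \<or> z = Inr g" by blast
    obtain u where u: "u \<in> words Y" "ev G \<gamma> u = g" using \<gamma>_gen[OF g(1)] by blast
    then have "ev E \<epsilon> (copyL u) = E_gen G (Inl g)" "ev E \<epsilon> (copyR u) = E_gen G (Inr g)"
      unfolding \<epsilon>_def using ev_copy[OF E.is_group E_gen_hom] by simp_all
    then show ?thesis using g copy_words[OF u(1)] by blast
  qed simp
  then obtain s where s: "\<And>z. z \<in> XX \<Longrightarrow> s z \<in> words B" "\<And>z. z \<in> XX \<Longrightarrow> ev E \<epsilon> (s z) = E_gen G z"
    by metis
  have "subst s v \<in> words B" using subst_in_words[OF v(1) s(1)] .
  moreover have "ev E \<epsilon> (subst s v) = x"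
    using E.ev_subst[OF \<epsilon>B s(1) v(1)] ev_cong[OF v(1), of "\<lambda>z. ev E \<epsilon> (s z)" "E_gen G" E] s(2) v(2) by simp
  ultimately show ?thesis by blast
qed

text \<open>Modulo almost trivial families, \<open>shift\<close> and \<open>twisted\<close> define a
  homomorphism on \<open>E\<close>. A finite complete set of relators then holds exactly at all but
  finitely many indices. If \<open>A\<close> were infinite, some index other than the identity would
  remain, and there all relations of \<open>E\<close> would hold exactly, against
  \<open>not_commuting\<close>.\<close>

lemma finite_quotient:
  fixes A :: "('c, 'e) monoid_scheme"
  assumes pres: "finite_presentation X R E" and A: "comm_group A"
    and \<pi>: "\<pi> \<in> hom G A" and surj: "\<pi> ` carrier G = carrier A"
  shows "finite (carrier A)"
proof (rule ccontr)
  assume inf: "infinite (carrier A)"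
  have grp: "group G" by (rule is_group)
  interpret A: comm_group A by fact
  interpret infinite_quotient G A \<pi> using \<pi> by unfold_locales
  interpret S: group "perm_group :: ('c \<times> nat \<Rightarrow> 'c \<times> nat) monoid" by (rule group_perm_group)
  have \<epsilon>B: "\<epsilon> \<in> B \<rightarrow> carrier E" using \<epsilon>_closed by auto
  have U: "v \<in> words UNIV" for v :: "'z word" by (simp add: words_def)
  obtain P where finP: "finite P" and P: "\<And>p. p \<in> P \<Longrightarrow> p \<in> words B \<and> ev E \<epsilon> p = \<one>\<^bsub>E\<^esub>"
    and compl: "\<And>v. v \<in> words B \<Longrightarrow> ev E \<epsilon> v = \<one>\<^bsub>E\<^esub> \<Longrightarrow> \<exists>k. eqv P k v []"
    using finite_complete_relators[OF E.is_group pres _ \<epsilon>B \<epsilon>_gen] finite_Y by auto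
  let ?I = "eventually_id :: ('c \<Rightarrow> 'c \<times> nat \<Rightarrow> 'c \<times> nat) set"
  let ?PF = "perm_families :: ('c \<Rightarrow> 'c \<times> nat \<Rightarrow> 'c \<times> nat) monoid"
  interpret I: normal ?I ?PF by (rule eventually_id_normal)
  define K where "K = ?PF Mod ?I"
  define \<kappa> where "\<kappa> = (\<lambda>x. ?I #>\<^bsub>?PF\<^esub> x)"
  have \<kappa>: "\<kappa> \<in> hom ?PF K" unfolding K_def \<kappa>_def by (rule I.r_coset_hom_Mod)
  interpret K: group K unfolding K_def by (rule I.factorgroup_is_group)
  interpret \<kappa>: group_hom ?PF K \<kappa>
    using \<kappa> by (simp add: group_hom_def group_hom_axioms_def PF.is_group K.is_group)
  have \<kappa>1: "\<kappa> x = \<one>\<^bsub>K\<^esub> \<longleftrightarrow> x \<in> ?I" if "x \<in> carrier ?PF" for x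
    using PF.coset_eq_one_iff[OF I.normal_axioms that] by (simp add: K_def \<kappa>_def)
  let ?f1 = "\<lambda>g. \<kappa> (shift g)" and ?f2 = "\<lambda>g. \<kappa> (twisted g)"
  have f1: "?f1 \<in> hom G K" using Group.hom_compose[OF shift_hom \<kappa>] by (simp add: comp_def)
  have f2: "?f2 \<in> hom G K" using Group.hom_compose[OF twisted_hom \<kappa>] by (simp add: comp_def)
  have comm: "commutator K (?f1 g) (?f2 h) \<otimes>\<^bsub>K\<^esub> (inv\<^bsub>K\<^esub> ?f1 k \<otimes>\<^bsub>K\<^esub> ?f2 k) =
      (inv\<^bsub>K\<^esub> ?f1 k \<otimes>\<^bsub>K\<^esub> ?f2 k) \<otimes>\<^bsub>K\<^esub> commutator K (?f1 g) (?f2 h)"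
    if ghk: "g \<in> carrier G" "h \<in> carrier G" "k \<in> carrier G" for g h k
  proof -
    have tw: "?f2 g = inv\<^bsub>K\<^esub> \<kappa> swaps \<otimes>\<^bsub>K\<^esub> ?f1 g \<otimes>\<^bsub>K\<^esub> \<kappa> swaps" if "g \<in> carrier G" for g
      using that by (simp add: twisted_def del: inv_swaps)
    show ?thesis unfolding tw[OF ghk(2)] tw[OF ghk(3)]
    proof (rule K.conjugate_commuting[OF grp f1 _ _ _ ghk])
      show "?f1 g \<otimes>\<^bsub>K\<^esub> ?f1 h = ?f1 h \<otimes>\<^bsub>K\<^esub> ?f1 g" if "g \<in> carrier G" "h \<in> carrier G" for g h
        using that shift_commute[OF that] by (simp flip: \<kappa>.hom_mult)
      show "\<kappa> swaps \<in> carrier K" by simp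
      fix g assume g: "g \<in> carrier G"
      let ?t = "inv\<^bsub>?PF\<^esub> shift g \<otimes>\<^bsub>?PF\<^esub> swaps \<otimes>\<^bsub>?PF\<^esub> shift g"
      have t: "?t \<in> carrier ?PF" using g by simp
      have "\<kappa> (commutator ?PF swaps ?t) = \<one>\<^bsub>K\<^esub>"
        using \<kappa>1 swaps_commute_mod[OF g] I.subset by blast
      then have "commutator K (\<kappa> swaps) (\<kappa> ?t) = \<one>\<^bsub>K\<^esub>"
        using PF.commutator_hom[OF K.is_group \<kappa> swaps_closed t] by simp
      then have "\<kappa> swaps \<otimes>\<^bsub>K\<^esub> \<kappa> ?t = \<kappa> ?t \<otimes>\<^bsub>K\<^esub> \<kappa> swaps"
        using K.commutator_eq_one_iff[of "\<kappa> swaps" "\<kappa> ?t"] t by simp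
      moreover have "\<kappa> ?t = inv\<^bsub>K\<^esub> ?f1 g \<otimes>\<^bsub>K\<^esub> \<kappa> swaps \<otimes>\<^bsub>K\<^esub> ?f1 g" using g by simp
      ultimately show "\<kappa> swaps \<otimes>\<^bsub>K\<^esub> (inv\<^bsub>K\<^esub> ?f1 g \<otimes>\<^bsub>K\<^esub> \<kappa> swaps \<otimes>\<^bsub>K\<^esub> ?f1 g) =
          (inv\<^bsub>K\<^esub> ?f1 g \<otimes>\<^bsub>K\<^esub> \<kappa> swaps \<otimes>\<^bsub>K\<^esub> ?f1 g) \<otimes>\<^bsub>K\<^esub> \<kappa> swaps" by simp
    qed
  qed
  obtain \<phi> where \<phi>: "\<phi> \<in> hom E K"
    and \<phi>1: "\<And>g. g \<in> carrier G \<Longrightarrow> \<phi> (iota1 g) = ?f1 g" and \<phi>2: "\<And>g. g \<in> carrier G \<Longrightarrow> \<phi> (iota2 g) = ?f2 g"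
    using E_universal[OF K.is_group f1 f2 comm] by blast
  let ?b = "both shift twisted"
  have b: "?b \<in> UNIV \<rightarrow> carrier ?PF" by (intro both_closed) auto
  have ev_PF: "ev ?PF ?b p \<in> carrier ?PF" for p by (rule PF.ev_closed[OF b U])
  \<comment> \<open>The homomorphism \<phi> sends \<open>p\<close> to the identity of the quotient,
    so the family that represents \<open>p\<close> is the identity at almost every index.\<close>
  have inI: "ev ?PF ?b p \<in> ?I" if p: "p \<in> P" for p
  proof -
    have "\<one>\<^bsub>K\<^esub> = \<phi> (ev E \<epsilon> p)"
      using P[OF p] group_hom.hom_one[of E K \<phi>] \<phi> by (simp add: group_hom_def group_hom_axioms_def E.is_group K.is_group)
    also have "\<dots> = ev K (\<lambda>x. \<phi> (\<epsilon> x)) p" by (rule E.ev_hom[OF K.is_group \<phi> \<epsilon>_closed U])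
    also have "(\<lambda>x. \<phi> (\<epsilon> x)) = (\<lambda>x. \<kappa> (?b x))"
      by (auto simp: fun_eq_iff \<epsilon>_def both_def \<phi>1 \<phi>2 split: sum.split)
    also have "ev K (\<lambda>x. \<kappa> (?b x)) p = \<kappa> (ev ?PF ?b p)" by (rule PF.ev_hom[OF K.is_group \<kappa> b U, symmetric])
    finally show ?thesis using \<kappa>1[OF ev_PF[of p]] by metis
  qed
  have "finite (\<Union>p \<in> P. {n. ev ?PF ?b p n \<noteq> id})"
  proof (rule finite_UN_I[OF finP])
    fix p assume "p \<in> P"
    from inI[OF this] show "finite {n. ev ?PF ?b p n \<noteq> id}" unfolding eventually_id_def by blast
  qed
  then have "finite ((\<Union>p \<in> P. {n. ev ?PF ?b p n \<noteq> id}) \<union> {\<one>\<^bsub>A\<^esub>})" by (rule finite_UnI) simp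
  from Diff_infinite_finite[OF this inf]
  have "infinite (carrier A - ((\<Union>p \<in> P. {n. ev ?PF ?b p n \<noteq> id}) \<union> {\<one>\<^bsub>A\<^esub>}))" .
  then obtain n where "n \<in> carrier A - ((\<Union>p \<in> P. {n. ev ?PF ?b p n \<noteq> id}) \<union> {\<one>\<^bsub>A\<^esub>})"
    using infinite_imp_nonempty by blast
  then have n: "n \<in> carrier A" "n \<noteq> \<one>\<^bsub>A\<^esub>" and nP: "\<And>p. p \<in> P \<Longrightarrow> ev ?PF ?b p n = id" by auto
  have ex: "\<exists>p. p \<in> carrier A \<and> p \<notin> F" if "finite F" for F
    using inf that by (meson finite_subset subsetI)
  obtain p where p: "p \<in> carrier A" "p \<notin> {\<one>\<^bsub>A\<^esub>, n}" using ex[of "{\<one>\<^bsub>A\<^esub>, n}"] by auto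
  obtain q where q: "q \<in> carrier A" "q \<notin> {\<one>\<^bsub>A\<^esub>, p}" using ex[of "{\<one>\<^bsub>A\<^esub>, p}"] by auto
  have "\<exists>g \<in> carrier G. \<pi> g = x" if "x \<in> carrier A" for x
    using that unfolding surj[symmetric] by blast
  then obtain g h k where ghk: "g \<in> carrier G" "h \<in> carrier G" "k \<in> carrier G"
    and \<pi>s: "\<pi> g = inv\<^bsub>A\<^esub> p" "\<pi> h = inv\<^bsub>A\<^esub> q" "\<pi> k = inv\<^bsub>A\<^esub> p \<otimes>\<^bsub>A\<^esub> n"
    using p(1) q(1) n(1) by (metis A.inv_closed A.m_closed)
  obtain ug uh uk where u: "ug \<in> words Y" "uh \<in> words Y" "uk \<in> words Y"
    and eu: "ev G \<gamma> ug = g" "ev G \<gamma> uh = h" "ev G \<gamma> uk = k" using \<gamma>_gen ghk by metis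
  \<comment> \<open>\<open>?v\<close> spells a defining relation \<open>[d, l] = 1\<close> over the
    generators \<open>B\<close>: it is trivial in \<open>E\<close>, but its component at
    \<open>n\<close> will not be.\<close>
  let ?wc = "\<lambda>x y. winv x @ winv y @ x @ (y :: ('y + 'y) word)"
  let ?l = "winv (copyL uk) @ copyR uk"
  let ?v = "?wc (?wc (copyL ug) (copyR uh)) ?l"
  have v: "?v \<in> words B" using copy_words u by simp
  have wc: "ev H f (?wc x y) = commutator H (ev H f x) (ev H f y)"
    if "group H" "f \<in> UNIV \<rightarrow> carrier H" for H :: "'h monoid" and f x y
    using that group.ev_closed[OF that U]
    by (simp add: group.ev_append[OF that U U] group.ev_winv[OF that U] commutator_def group.is_monoid
        monoid.m_assoc monoid.m_closed group.inv_closed)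
  have wl: "ev H f ?l = inv\<^bsub>H\<^esub> (ev H f (copyL uk)) \<otimes>\<^bsub>H\<^esub> ev H f (copyR uk)"
    if "group H" "f \<in> UNIV \<rightarrow> carrier H" for H :: "'h monoid" and f
    by (simp add: group.ev_append[OF that U U] group.ev_winv[OF that U])
  have "ev E \<epsilon> ?v = \<one>\<^bsub>E\<^esub>"
  proof -
    have eL: "ev E \<epsilon> (copyL u) = iota1 (ev G \<gamma> u)" "ev E \<epsilon> (copyR u) = iota2 (ev G \<gamma> u)" for u
      unfolding \<epsilon>_def using ev_copy[OF E.is_group E_gen_hom] by simp_all
    have "iota1 x \<in> carrier E" "iota2 x \<in> carrier E" if "x \<in> carrier G" for x
      using that E_gen_closed by auto
    then show ?thesis
      unfolding wc[OF E.is_group \<epsilon>_closed] wl[OF E.is_group \<epsilon>_closed] eL eu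
      using E_gen_commute[OF ghk] ghk by (subst E.commutator_eq_one_iff) auto
  qed
  then obtain m where m: "eqv P m ?v []" using compl v by blast
  let ?bn = "\<lambda>x. ?b x n"
  have evn: "ev perm_group ?bn w = ev ?PF ?b w n" for w
    using PF.ev_hom[OF S.is_group perm_families_component b U, of w n] by simp
  have bn: "?bn \<in> UNIV \<rightarrow> carrier perm_group"
    using b by (auto simp: perm_families_def perm_group_def Pi_iff)
  \<comment> \<open>At this index all relators in \<open>P\<close> act as the identity, hence so
    does every word derivable from them.\<close>
  have "ev perm_group ?bn ?v = ev perm_group ?bn []"
    by (rule S.ev_eqv[OF bn _ m]) (simp add: evn nP, simp add: perm_group_def)
  then have "ev ?PF ?b ?v n = id" by (simp add: evn[symmetric]) (simp add: perm_group_def)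
  moreover have "ev ?PF ?b ?v = commutator ?PF (commutator ?PF (shift g) (twisted h))
      (inv\<^bsub>?PF\<^esub> shift k \<otimes>\<^bsub>?PF\<^esub> twisted k)" (is "_ = commutator ?PF ?d ?e")
    unfolding wc[OF PF.is_group b] wl[OF PF.is_group b] ev_copy[OF PF.is_group shift_hom twisted_hom] eu ..
  moreover have de: "?d \<in> carrier ?PF" "?e \<in> carrier ?PF" using ghk by simp_all
  ultimately have "commutator perm_group (?d n) (?e n) = id"
    using PF.commutator_hom[OF S.is_group perm_families_component de, of n] by simp
  then have "?d n \<circ> ?e n = ?e n \<circ> ?d n"
    using S.commutator_eq_one_iff[of "?d n" "?e n"] de by (simp add: perm_group_def perm_families_def)
  then show False
    using not_commuting[OF n p(1) _ _ q(1) _ _ ghk \<pi>s] p q by blast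
qed

end


section \<open>Words in commuting generators\<close>

definition l1 :: "'z set \<Rightarrow> ('z \<Rightarrow> int) \<Rightarrow> nat" where
  "l1 I e = (\<Sum>z\<in>I. nat \<bar>e z\<bar>)"

lemma l1_insert: "finite I \<Longrightarrow> i \<notin> I \<Longrightarrow> l1 (insert i I) e = nat \<bar>e i\<bar> + l1 I e"
  by (simp add: l1_def)

lemma l1_diff_le: "l1 I (\<lambda>z. e z - q * f z) \<le> l1 I e + nat \<bar>q\<bar> * l1 I f"
proof -
  have "nat \<bar>e z - q * f z\<bar> \<le> nat \<bar>e z\<bar> + nat \<bar>q\<bar> * nat \<bar>f z\<bar>" for z
    using abs_triangle_ineq4[of "e z" "q * f z"]
    by (simp add: nat_le_iff abs_mult)
  then show ?thesis
    by (simp add: l1_def sum_distrib_left flip: sum.distrib) (rule sum_mono)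
qed

text \<open>Splitting off one coordinate at a time produces a triangular generating set, as in the
  Hermite normal form. It also bounds the number of generators needed linearly in the norm of the
  vector; without this linear bound the area estimate would not be quadratic.\<close>

lemma subgroup_undistorted:
  fixes K :: "('z \<Rightarrow> int) set"
  assumes "finite I" "\<And>e z. e \<in> K \<Longrightarrow> z \<notin> I \<Longrightarrow> e z = 0"
    and "(\<lambda>z. 0) \<in> K" "\<And>e f. e \<in> K \<Longrightarrow> f \<in> K \<Longrightarrow> (\<lambda>z. e z - f z) \<in> K"
  shows "\<exists>T C. finite T \<and> T \<subseteq> K \<and> (\<forall>e \<in> K. \<exists>js. set js \<subseteq> T \<and> length js \<le> C * l1 I e \<and>
    (\<forall>z. e z = (\<Sum>j\<leftarrow>js. j z)))"
  using assms
proof (induction I arbitrary: K rule: finite_induct)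
  case empty
  show ?case
  proof (intro exI[of _ "{}"] exI[of _ 0] conjI ballI)
    fix e assume "e \<in> K"
    then show "\<exists>js. set js \<subseteq> {} \<and> length js \<le> 0 * l1 {} e \<and> (\<forall>z. e z = (\<Sum>j\<leftarrow>js. j z))"
      using empty.prems(1) by (intro exI[of _ "[]"]) simp
  qed auto
next
  case (insert i I)
  have neg: "(\<lambda>z. - e z) \<in> K" if "e \<in> K" for e
    using insert.prems(3)[OF insert.prems(2) that] by simp
  have add: "(\<lambda>z. e z + f z) \<in> K" if "e \<in> K" "f \<in> K" for e f
    using insert.prems(3)[OF that(1) neg[OF that(2)]] by simp
  have nmult: "(\<lambda>z. int n * f z) \<in> K" if "f \<in> K" for n f
  proof (induction n)
    case (Suc n)
    then show ?case using add[OF that Suc] by (simp add: algebra_simps)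
  qed (use insert.prems(2) in simp)
  have mult: "(\<lambda>z. q * f z) \<in> K" if "f \<in> K" for q f
    using nmult[OF that, of "nat q"] neg[OF nmult[OF that, of "nat (- q)"]] by (cases "q \<ge> 0") simp_all
  let ?K0 = "{e \<in> K. e i = 0}"
  have "\<exists>T C. finite T \<and> T \<subseteq> ?K0 \<and> (\<forall>e \<in> ?K0. \<exists>js. set js \<subseteq> T \<and> length js \<le> C * l1 I e \<and>
    (\<forall>z. e z = (\<Sum>j\<leftarrow>js. j z)))"
  proof (rule insert.IH)
    show "e z = 0" if "e \<in> ?K0" "z \<notin> I" for e z
      using that insert.prems(1) by (cases "z = i") auto
    show "(\<lambda>z. 0) \<in> ?K0" using insert.prems(2) by simp
    show "(\<lambda>z. e z - f z) \<in> ?K0" if "e \<in> ?K0" "f \<in> ?K0" for e f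
      using that insert.prems(3) by simp
  qed
  then obtain T C where TC: "finite T \<and> T \<subseteq> ?K0 \<and> (\<forall>e \<in> ?K0. \<exists>js. set js \<subseteq> T \<and> length js \<le> C * l1 I e \<and>
    (\<forall>z. e z = (\<Sum>j\<leftarrow>js. j z)))" by (elim exE)
  then have T: "finite T" "T \<subseteq> ?K0" by simp_all
  have C: "\<exists>js. set js \<subseteq> T \<and> length js \<le> C * l1 I e \<and> (\<forall>z. e z = (\<Sum>j\<leftarrow>js. j z))" if "e \<in> ?K0" for e
    using TC by (elim conjE) (erule bspec[OF _ that])
  show ?case
  proof (cases "\<forall>e \<in> K. e i = 0")
    case True
    then have "?K0 = K" by auto
    moreover have "l1 (insert i I) e = l1 I e" if "e \<in> K" for e
      using True that insert.hyps by (simp add: l1_insert)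
    ultimately show ?thesis using T C by (intro exI[of _ T] exI[of _ C]) auto
  next
    case False
    \<comment> \<open>The values \<open>e i\<close> form a nonzero subgroup of the integers. Its
      least positive element is \<open>d\<close>, so division of \<open>e i\<close> by
      \<open>f i\<close> leaves remainder 0.\<close>
    define d where "d = (LEAST d. d > 0 \<and> (\<exists>f \<in> K. nat \<bar>f i\<bar> = d))"
    have "\<exists>d. d > 0 \<and> (\<exists>f \<in> K. nat \<bar>f i\<bar> = d)"
    proof -
      from False obtain e where "e \<in> K" "e i \<noteq> 0" by blast
      then show ?thesis by (intro exI[of _ "nat \<bar>e i\<bar>"]) auto
    qed
    from LeastI_ex[OF this] have "d > 0 \<and> (\<exists>f \<in> K. nat \<bar>f i\<bar> = d)" by (simp only: d_def)
    then obtain f where f: "f \<in> K" "nat \<bar>f i\<bar> = d" "d > 0" by blast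
    have min: "e i = 0" if "e \<in> K" "nat \<bar>e i\<bar> < d" for e
      using that not_less_Least[of "nat \<bar>e i\<bar>" "\<lambda>d. d > 0 \<and> (\<exists>f \<in> K. nat \<bar>f i\<bar> = d)"]
      unfolding d_def by auto
    \<comment> \<open>One unit pays for the \<open>q\<close> copies of \<open>f\<close>, since
      \<open>q\<close> is bounded by the norm of \<open>e\<close>; subtracting them enlarges the
      remaining norm by at most the factor \<open>1 + l1 I f\<close>.\<close>
    let ?T = "T \<union> {f, \<lambda>z. - f z}" and ?C = "1 + C * (1 + l1 I f)"
    have "\<exists>js. set js \<subseteq> ?T \<and> length js \<le> ?C * l1 (insert i I) e \<and> (\<forall>z. e z = (\<Sum>j\<leftarrow>js. j z))"
      if e: "e \<in> K" for e
    proof -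
      define q where "q = e i div f i"
      let ?e = "\<lambda>z. e z - q * f z"
      have eK: "?e \<in> K" using insert.prems(3)[OF e mult[OF f(1)]] .
      have fi: "f i \<noteq> 0" using f by auto
      have "?e i = e i mod f i" by (simp add: q_def minus_div_mult_eq_mod)
      moreover have "\<bar>e i mod f i\<bar> < \<bar>f i\<bar>" using fi by (rule abs_mod_less)
      ultimately have "?e i = 0" using min[OF eK] f(2) by linarith
      then have "?e \<in> ?K0" using eK by simp
      then obtain js where js: "set js \<subseteq> T" "length js \<le> C * l1 I ?e" "\<And>z. ?e z = (\<Sum>j\<leftarrow>js. j z)"
        using C[of ?e] by auto
      have "e i = q * f i" using \<open>?e i = 0\<close> by simp
      then have "\<bar>q\<bar> \<le> \<bar>e i\<bar>" using fi mult_left_mono[of 1 "\<bar>f i\<bar>" "\<bar>q\<bar>"] by (simp add: abs_mult)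
      then have q: "nat \<bar>q\<bar> \<le> l1 (insert i I) e" using insert.hyps by (simp add: l1_insert)
      have I: "l1 I e \<le> l1 (insert i I) e" using insert.hyps by (simp add: l1_insert)
      define g where "g = (if q \<ge> 0 then f else (\<lambda>z. - f z))"
      let ?js = "replicate (nat \<bar>q\<bar>) g @ js"
      have "set ?js \<subseteq> ?T" using js(1) by (auto simp: g_def)
      moreover have "e z = (\<Sum>j\<leftarrow>?js. j z)" for z
        using js(3)[of z] by (simp add: sum_list_replicate g_def algebra_simps)
      moreover have "length ?js \<le> ?C * l1 (insert i I) e"
      proof -
        have "l1 I ?e \<le> l1 I e + nat \<bar>q\<bar> * l1 I f" by (rule l1_diff_le)
        also have "\<dots> \<le> l1 (insert i I) e + l1 (insert i I) e * l1 I f"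
          by (intro add_mono mult_right_mono q I) simp
        finally have "C * l1 I ?e \<le> C * (l1 (insert i I) e + l1 (insert i I) e * l1 I f)" by simp
        then show ?thesis using js(2) q by (simp add: algebra_simps)
      qed
      ultimately show ?thesis by blast
    qed
    moreover have "finite ?T" "?T \<subseteq> K" using T f(1) neg by auto
    ultimately show ?thesis by (intro exI[of _ ?T] exI[of _ ?C]) blast
  qed
qed

definition expo :: "'z word \<Rightarrow> 'z \<Rightarrow> int" where
  "expo w z = (\<Sum>a\<leftarrow>w. if fst a = z then if snd a then 1 else - 1 else 0)"

lemma expo_simps [simp]:
  "expo [] z = 0"
  "expo (a # w) z = (if fst a = z then if snd a then 1 else - 1 else 0) + expo w z"
  "expo (u @ v) z = expo u z + expo v z"
  by (simp_all add: expo_def)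

lemma expo_winv [simp]: "expo (winv w) z = - expo w z"
  by (induction w) auto

lemma expo_concat: "expo (concat ws) z = (\<Sum>w\<leftarrow>ws. expo w z)"
  by (induction ws) auto

lemma expo_words: "w \<in> words I \<Longrightarrow> z \<notin> I \<Longrightarrow> expo w z = 0"
  by (induction w) auto

lemma l1_expo_le: "finite I \<Longrightarrow> l1 I (expo w) \<le> length w"
proof (induction w)
  case (Cons a w)
  have "l1 I (expo (a # w)) \<le> (\<Sum>z\<in>I. (if fst a = z then 1 else 0) + nat \<bar>expo w z\<bar>)"
    unfolding l1_def by (intro sum_mono) auto
  also have "\<dots> \<le> 1 + l1 I (expo w)"
    using Cons.prems by (simp add: sum.distrib l1_def sum.delta')
  finally show ?case using Cons by (simp del: expo_simps)
qed (simp add: l1_def)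

lemma expo_one_sign:
  "inv_letter a \<notin> set w \<Longrightarrow> (if snd a then expo w (fst a) \<ge> 0 else expo w (fst a) \<le> 0)"
  by (induction w) (auto simp: inv_letter_def prod_eq_iff)

text \<open>Stated for signed letters, so that moving past an inverse letter also costs one
  relator.\<close>

definition commuting :: "'b word set \<Rightarrow> 'z set \<Rightarrow> ('z \<Rightarrow> 'b word) \<Rightarrow> bool" where
  "commuting P I \<phi> \<longleftrightarrow> (\<forall>a b. fst a \<in> I \<longrightarrow> fst b \<in> I \<longrightarrow>
     eqv P 1 (signed \<phi> a @ signed \<phi> b) (signed \<phi> b @ signed \<phi> a))"

lemma commutingD: "commuting P I \<phi> \<Longrightarrow> fst a \<in> I \<Longrightarrow> fst b \<in> I \<Longrightarrow>
    eqv P 1 (signed \<phi> a @ signed \<phi> b) (signed \<phi> b @ signed \<phi> a)"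
  by (simp only: commuting_def)

lemma commuting_move:
  assumes "commuting P I \<phi>" "fst a \<in> I"
  shows "u \<in> words I \<Longrightarrow> eqv P (length u) (signed \<phi> a @ subst \<phi> u) (subst \<phi> u @ signed \<phi> a)"
proof (induction u)
  case (Cons b u)
  have "eqv P 1 (signed \<phi> a @ signed \<phi> b) (signed \<phi> b @ signed \<phi> a)"
    by (rule commutingD[OF assms]) (use Cons.prems in simp)
  then have 1: "eqv P 1 (signed \<phi> a @ subst \<phi> (b # u)) (signed \<phi> b @ signed \<phi> a @ subst \<phi> u)"
    using eqv_append_right[of P 1 _ _ "subst \<phi> u"] by fastforce
  have "eqv P (length u) (signed \<phi> b @ signed \<phi> a @ subst \<phi> u) (signed \<phi> b @ subst \<phi> u @ signed \<phi> a)"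
    using Cons by (intro eqv_append_left) simp
  from eqv_trans[OF 1 this] show ?case by simp
qed simp

text \<open>Since all exponent sums vanish, the inverse of the first letter occurs further on.
  Carrying the first letter there costs at most the current length, after which both letters
  disappear; the costs add up to at most the square.\<close>

lemma commuting_expo_zero:
  assumes "commuting P I \<phi>"
  shows "w \<in> words I \<Longrightarrow> (\<And>z. expo w z = 0) \<Longrightarrow> eqv P ((length w)\<^sup>2) (subst \<phi> w) []"
proof (induction w rule: length_induct)
  case (1 w)
  show ?case
  proof (cases w)
    case (Cons a t)
    have "inv_letter a \<in> set t"
    proof (rule ccontr)
      assume "inv_letter a \<notin> set t"
      from expo_one_sign[OF this] 1(3)[of "fst a"] Cons show False by (cases "snd a") auto
    qed
    then obtain u v where t: "t = u @ inv_letter a # v" by (meson split_list)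
    have u: "u \<in> words I" "v \<in> words I" "fst a \<in> I" using 1(2) Cons t by auto
    have "expo (u @ v) z = 0" for z using 1(3)[of z] by (auto simp: Cons t split: if_splits)
    then have IH: "eqv P ((length (u @ v))\<^sup>2) (subst \<phi> (u @ v)) []"
      using 1(1)[rule_format, of "u @ v"] u by (simp add: Cons t)
    have "eqv P (length u) (signed \<phi> a @ subst \<phi> u) (subst \<phi> u @ signed \<phi> a)"
      by (rule commuting_move[OF assms u(3,1)])
    from eqv_append_right[OF this, of "winv (signed \<phi> a) @ subst \<phi> v"]
    have "eqv P (length u) (subst \<phi> w) (subst \<phi> u @ signed \<phi> a @ winv (signed \<phi> a) @ subst \<phi> v)"
      by (simp add: Cons t)
    from eqv_trans[OF this eqv_winv_right_cancel]
    have "eqv P (length u) (subst \<phi> w) (subst \<phi> (u @ v))" by simp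
    then show ?thesis
      by (rule eqv_trans'[OF _ IH]) (simp add: Cons t power2_eq_square)
  qed simp
qed

text \<open>The exponent vectors of trivial words form a subgroup of a free abelian group of finite
  rank. By \<open>subgroup_undistorted\<close> the vector of \<open>w\<close> is realized by a
  product \<open>v\<close> of linearly many words from a finite set \<open>W\<close>, and
  \<open>w v^-1\<close> has exponent sums 0. \<open>W\<close> and \<open>C\<close> are chosen before
  \<open>P\<close> and \<phi>, so that the set of relators may later be made large enough for
  \<open>W\<close>.\<close>

lemma commuting_words_quadratic:
  fixes val :: "'z \<Rightarrow> 'e" and I :: "'z set"
  assumes "group E" "finite I" "val \<in> I \<rightarrow> carrier E"
  obtains W C where "finite W" "\<And>w. w \<in> W \<Longrightarrow> w \<in> words I \<and> ev E val w = \<one>\<^bsub>E\<^esub>"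
    "\<And>P (\<phi> :: 'z \<Rightarrow> 'b word) w. commuting P I \<phi> \<Longrightarrow> (\<And>v. v \<in> W \<Longrightarrow> eqv P 1 (subst \<phi> v) []) \<Longrightarrow>
       w \<in> words I \<Longrightarrow> ev E val w = \<one>\<^bsub>E\<^esub> \<Longrightarrow> eqv P (C * (length w + 1)\<^sup>2) (subst \<phi> w) []"
proof -
  interpret E: group E by fact
  define triv where "triv = {w \<in> words I. ev E val w = \<one>\<^bsub>E\<^esub>}"
  have tapp: "u @ winv v \<in> triv" if "u \<in> triv" "v \<in> triv" for u v
    using that by (simp add: triv_def E.ev_append[OF assms(3)] E.ev_winv[OF assms(3)])
  have "\<exists>T C. finite T \<and> T \<subseteq> expo ` triv \<and> (\<forall>e \<in> expo ` triv. \<exists>js. set js \<subseteq> T \<and>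
      length js \<le> C * l1 I e \<and> (\<forall>z. e z = (\<Sum>j\<leftarrow>js. j z)))"
  proof (rule subgroup_undistorted[OF assms(2)])
    show "e z = 0" if "e \<in> expo ` triv" "z \<notin> I" for e z
      using that by (auto simp: triv_def expo_words)
    have "[] \<in> triv" by (simp add: triv_def)
    then show "(\<lambda>z. 0) \<in> expo ` triv" by (intro image_eqI[of _ _ "[]"]) auto
    fix e f assume "e \<in> expo ` triv" "f \<in> expo ` triv"
    then obtain u v where "u \<in> triv" "v \<in> triv" "e = expo u" "f = expo v" by blast
    then show "(\<lambda>z. e z - f z) \<in> expo ` triv"
      using tapp by (intro image_eqI[of _ _ "u @ winv v"]) auto
  qed
  then obtain T C where TC: "finite T \<and> T \<subseteq> expo ` triv \<and> (\<forall>e \<in> expo ` triv. \<exists>js. set js \<subseteq> T \<and>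
      length js \<le> C * l1 I e \<and> (\<forall>z. e z = (\<Sum>j\<leftarrow>js. j z)))" by (elim exE)
  then have T: "finite T" "T \<subseteq> expo ` triv" by simp_all
  have C: "\<exists>js. set js \<subseteq> T \<and> length js \<le> C * l1 I e \<and> (\<forall>z. e z = (\<Sum>j\<leftarrow>js. j z))"
    if "e \<in> expo ` triv" for e
    using TC by (elim conjE) (erule bspec[OF _ that])
  have "\<forall>j \<in> T. \<exists>w. w \<in> triv \<and> expo w = j" using T(2) by blast
  then obtain rp where rp: "\<And>j. j \<in> T \<Longrightarrow> rp j \<in> triv" "\<And>j. j \<in> T \<Longrightarrow> expo (rp j) = j" by metis
  obtain M where M: "\<And>j. j \<in> T \<Longrightarrow> length (rp j) \<le> M"
    using T(1) finite_nat_set_iff_bounded_le[of "(\<lambda>j. length (rp j)) ` T"] by auto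
  show thesis
  proof
    show "finite (rp ` T)" using T(1) by simp
    show "w \<in> words I \<and> ev E val w = \<one>\<^bsub>E\<^esub>" if "w \<in> rp ` T" for w
      using that rp by (auto simp: triv_def)
    fix P and \<phi> :: "'z \<Rightarrow> 'b word" and w
    assume comm: "commuting P I \<phi>" and W: "\<And>v. v \<in> rp ` T \<Longrightarrow> eqv P 1 (subst \<phi> v) []"
      and w: "w \<in> words I" "ev E val w = \<one>\<^bsub>E\<^esub>"
    let ?n = "length w"
    have "expo w \<in> expo ` triv" using w by (simp add: triv_def)
    from C[OF this] obtain js where js: "set js \<subseteq> T" "length js \<le> C * l1 I (expo w)"
      "\<And>z. expo w z = (\<Sum>j\<leftarrow>js. j z)" by blast
    have ljs: "length js \<le> C * ?n"
      using js(2) mult_le_mono2[OF l1_expo_le[OF assms(2), of w], of C] by linarith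
    define v where "v = concat (map rp js)"
    have "v \<in> words I" using js(1) rp(1) by (force simp: v_def triv_def words_def)
    have vexp: "expo v z = expo w z" for z
    proof -
      have "map (\<lambda>j. expo (rp j) z) js = map (\<lambda>j. j z) js"
        using js(1) rp(2) by (intro map_cong) auto
      then have "(\<Sum>j\<leftarrow>js. expo (rp j) z) = (\<Sum>j\<leftarrow>js. j z)" by (rule arg_cong)
      then show ?thesis using js(3)[of z] by (simp add: v_def expo_concat comp_def)
    qed
    have lv: "length v \<le> M * length js"
      using js(1) M unfolding v_def by (induction js) (auto simp: add_mono)
    have "eqv P ((length (w @ winv v))\<^sup>2) (subst \<phi> (w @ winv v)) []"
      using w(1) \<open>v \<in> words I\<close> vexp by (intro commuting_expo_zero[OF comm]) auto
    then have "eqv P ((?n + length v)\<^sup>2) (subst \<phi> w @ winv (subst \<phi> v)) []" by simp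
    then have "eqv P ((?n + length v)\<^sup>2) (subst \<phi> w) (subst \<phi> v)"
      using eqv_append_right[of P _ "subst \<phi> w @ winv (subst \<phi> v)" "[]" "subst \<phi> v"]
        eqv_trans[OF eqv_sym[OF eqv_winv_left_cancel[of P "subst \<phi> w" "subst \<phi> v" "[]"]]] by fastforce
    moreover have "eqv P (length js) (subst \<phi> v) []"
      using js(1) unfolding v_def
    proof (induction js)
      case (Cons j js)
      then show ?case using eqv_append[OF W[of "rp j"] Cons.IH] by simp
    qed simp
    ultimately have e: "eqv P ((?n + length v)\<^sup>2 + length js) (subst \<phi> w) []" by (rule eqv_trans)
    have "length v \<le> M * (C * ?n)" using lv mult_le_mono2[OF ljs, of M] by linarith
    then have "(?n + length v)\<^sup>2 \<le> ((1 + M * C) * (?n + 1))\<^sup>2"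
      by (intro power_mono) (auto simp: algebra_simps)
    moreover have "length js \<le> C * (?n + 1)\<^sup>2"
      using ljs mult_le_mono2[of ?n "(?n + 1)\<^sup>2" C] by (simp add: power2_eq_square)
    ultimately have "(?n + length v)\<^sup>2 + length js \<le> ((1 + M * C) * (?n + 1))\<^sup>2 + C * (?n + 1)\<^sup>2"
      by (rule add_mono)
    also have "\<dots> = ((1 + M * C)\<^sup>2 + C) * (?n + 1)\<^sup>2"
      unfolding power_mult_distrib by (rule distrib_right[symmetric])
    finally have "(?n + length v)\<^sup>2 + length js \<le> ((1 + M * C)\<^sup>2 + C) * (?n + 1)\<^sup>2" .
    then show "eqv P (((1 + M * C)\<^sup>2 + C) * (?n + 1)\<^sup>2) (subst \<phi> w) []" by (rule eqv_weaken[OF e])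
  qed
qed


section \<open>Extensions with a kernel centralized by a subgroup of finite index\<close>

text \<open>Here \<open>cl x\<close> is a representative of the coset \<open>N x\<close>.  Words over \<open>A\<close>, which describe
  elements of \<open>\<Gamma>\<close>, are translated into words over the generators \<open>B\<close> of \<open>E\<close> along these
  representatives, as in the Reidemeister-Schreier rewriting process.\<close>

locale virtually_central = E: group E + \<Gamma>: group \<Gamma>
  for E :: "('e, 'm) monoid_scheme" and \<Gamma> :: "('c, 'n) monoid_scheme" +
  fixes \<theta> :: "'e \<Rightarrow> 'c" and N :: "'c set" and cl :: "'c \<Rightarrow> 'c"
    and B :: "'b set" and \<epsilon> :: "'b \<Rightarrow> 'e" and A :: "'a set" and \<alpha> :: "'a \<Rightarrow> 'c"
    and Rel :: "'a word set" and \<iota> :: "'b \<Rightarrow> 'a word"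
  assumes \<theta>: "\<theta> \<in> hom E \<Gamma>"
    and N: "subgroup N \<Gamma>" "N \<subseteq> \<theta> ` carrier E"
    and cl_closed [simp]: "x \<in> carrier \<Gamma> \<Longrightarrow> cl x \<in> carrier \<Gamma>"
    and cl_coset: "x \<in> carrier \<Gamma> \<Longrightarrow> x \<otimes>\<^bsub>\<Gamma>\<^esub> inv\<^bsub>\<Gamma>\<^esub> cl x \<in> N"
    and cl_eq: "x \<in> carrier \<Gamma> \<Longrightarrow> y \<in> carrier \<Gamma> \<Longrightarrow> x \<otimes>\<^bsub>\<Gamma>\<^esub> inv\<^bsub>\<Gamma>\<^esub> y \<in> N \<Longrightarrow> cl x = cl y"
    and finite_cl: "finite (cl ` carrier \<Gamma>)"
    and central: "z \<in> carrier E \<Longrightarrow> t \<in> carrier E \<Longrightarrow> \<theta> z = \<one>\<^bsub>\<Gamma>\<^esub> \<Longrightarrow> \<theta> t \<in> N \<Longrightarrow>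
      z \<otimes>\<^bsub>E\<^esub> t = t \<otimes>\<^bsub>E\<^esub> z"
    and finite_B: "finite B" and \<epsilon>: "\<epsilon> \<in> UNIV \<rightarrow> carrier E"
    and \<epsilon>_gen: "g \<in> carrier E \<Longrightarrow> \<exists>w \<in> words B. ev E \<epsilon> w = g"
    and finite_A: "finite A" and \<alpha>: "\<alpha> \<in> UNIV \<rightarrow> carrier \<Gamma>"
    and finite_Rel: "finite Rel" and Rel: "r \<in> Rel \<Longrightarrow> r \<in> words A \<and> ev \<Gamma> \<alpha> r = \<one>\<^bsub>\<Gamma>\<^esub>"
    and \<iota>: "b \<in> B \<Longrightarrow> \<iota> b \<in> words A \<and> ev \<Gamma> \<alpha> (\<iota> b) = \<theta> (\<epsilon> b)"
begin

sublocale \<theta>: group_hom E \<Gamma> \<theta>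
  using \<theta> by (simp add: group_hom_def group_hom_axioms_def)

lemma all_words: "w \<in> words UNIV"
  by (simp add: words_def)

lemmas evE_append = E.ev_append[OF \<epsilon> all_words all_words]
lemmas evE_winv = E.ev_winv[OF \<epsilon> all_words]
lemmas evE_closed [simp] = E.ev_closed[OF \<epsilon> all_words]
lemmas ev\<Gamma>_winv = \<Gamma>.ev_winv[OF \<alpha> all_words]
lemmas ev\<Gamma>_closed [simp] = \<Gamma>.ev_closed[OF \<alpha> all_words]

lemma letter_closed [simp]: "ev_letter \<Gamma> \<alpha> a \<in> carrier \<Gamma>"
  by (rule \<Gamma>.ev_letter_closed[OF \<alpha>]) simp

lemma \<alpha>_closed [simp]: "\<alpha> a \<in> carrier \<Gamma>"
  using \<alpha> by auto

definition val :: "'b word \<Rightarrow> 'c" where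
  "val w = \<theta> (ev E \<epsilon> w)"

lemma val_simps [simp]:
  "val [] = \<one>\<^bsub>\<Gamma>\<^esub>" "val (u @ v) = val u \<otimes>\<^bsub>\<Gamma>\<^esub> val v" "val (winv w) = inv\<^bsub>\<Gamma>\<^esub> val w"
  "val w \<in> carrier \<Gamma>"
  by (simp_all add: val_def evE_append evE_winv)

lemma val_surj: "x \<in> \<theta> ` carrier E \<Longrightarrow> \<exists>w \<in> words B. val w = x"
  using \<epsilon>_gen by (fastforce simp: val_def)

definition reps :: "'c set" where
  "reps = cl ` carrier \<Gamma>"

text \<open>The cosets that meet the image of \<theta>: only these are reached from the coset of the
  identity by words over \<open>B\<close>, and only their representatives are values of words over
  \<open>B\<close>.\<close>

definition inner_reps :: "'c set" where
  "inner_reps = {x \<in> reps. x \<in> \<theta> ` carrier E}"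

lemma reps_closed [simp]: "x \<in> reps \<Longrightarrow> x \<in> carrier \<Gamma>"
  by (auto simp: reps_def)

lemma cl_in_reps [simp]: "x \<in> carrier \<Gamma> \<Longrightarrow> cl x \<in> reps"
  by (auto simp: reps_def)

lemma cl_coset_inv: "x \<in> carrier \<Gamma> \<Longrightarrow> cl x \<otimes>\<^bsub>\<Gamma>\<^esub> inv\<^bsub>\<Gamma>\<^esub> x \<in> N"
  using subgroup.m_inv_closed[OF N(1) cl_coset] by (simp add: \<Gamma>.inv_mult_group)

lemma cl_mult: "x \<in> carrier \<Gamma> \<Longrightarrow> a \<in> carrier \<Gamma> \<Longrightarrow> cl (cl x \<otimes>\<^bsub>\<Gamma>\<^esub> a) = cl (x \<otimes>\<^bsub>\<Gamma>\<^esub> a)"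
proof (rule cl_eq)
  assume x: "x \<in> carrier \<Gamma>" and a: "a \<in> carrier \<Gamma>"
  have "a \<otimes>\<^bsub>\<Gamma>\<^esub> (inv\<^bsub>\<Gamma>\<^esub> a \<otimes>\<^bsub>\<Gamma>\<^esub> y) = y" if "y \<in> carrier \<Gamma>" for y
    using a that by (simp add: \<Gamma>.m_assoc[symmetric])
  then have "cl x \<otimes>\<^bsub>\<Gamma>\<^esub> a \<otimes>\<^bsub>\<Gamma>\<^esub> inv\<^bsub>\<Gamma>\<^esub> (x \<otimes>\<^bsub>\<Gamma>\<^esub> a) = cl x \<otimes>\<^bsub>\<Gamma>\<^esub> inv\<^bsub>\<Gamma>\<^esub> x"
    using x a by (simp add: \<Gamma>.inv_mult_group \<Gamma>.m_assoc)
  then show "cl x \<otimes>\<^bsub>\<Gamma>\<^esub> a \<otimes>\<^bsub>\<Gamma>\<^esub> inv\<^bsub>\<Gamma>\<^esub> (x \<otimes>\<^bsub>\<Gamma>\<^esub> a) \<in> N" using cl_coset_inv[OF x] by simp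
qed simp_all

lemma cl_reps [simp]: "x \<in> reps \<Longrightarrow> cl x = x"
  unfolding reps_def using cl_mult[of _ "\<one>\<^bsub>\<Gamma>\<^esub>"] by auto

lemma finite_reps: "finite reps"
  unfolding reps_def by (rule finite_cl)

section \<open>Rewriting words over \<open>A\<close> along cosets\<close>

definition step :: "'c \<Rightarrow> 'a \<times> bool \<Rightarrow> 'c" where
  "step x a = cl (x \<otimes>\<^bsub>\<Gamma>\<^esub> ev_letter \<Gamma> \<alpha> a)"

lemma step_reps [simp]: "x \<in> reps \<Longrightarrow> step x a \<in> reps"
  by (simp add: step_def)

lemma step_inv: "x \<in> reps \<Longrightarrow> step (step x a) (inv_letter a) = x"
  by (simp add: step_def cl_mult \<Gamma>.ev_letter_inv[OF \<alpha>] \<Gamma>.m_assoc)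

text \<open>\<open>x\<close> and \<open>y\<close> need not lie in the image of \<theta>, but the
  quotient of \<open>x y\<close> by its representative lies in \<open>N\<close>, which does.\<close>

lemma coset_word:
  assumes "x \<in> reps" "y \<in> carrier \<Gamma>"
  shows "\<exists>w \<in> words B. val w = x \<otimes>\<^bsub>\<Gamma>\<^esub> y \<otimes>\<^bsub>\<Gamma>\<^esub> inv\<^bsub>\<Gamma>\<^esub> cl (x \<otimes>\<^bsub>\<Gamma>\<^esub> y)"
proof -
  have "x \<otimes>\<^bsub>\<Gamma>\<^esub> y \<otimes>\<^bsub>\<Gamma>\<^esub> inv\<^bsub>\<Gamma>\<^esub> cl (x \<otimes>\<^bsub>\<Gamma>\<^esub> y) \<in> N" using assms by (intro cl_coset) simp
  then show ?thesis using val_surj N(2) by blast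
qed

definition tr1 :: "'c \<Rightarrow> 'a \<Rightarrow> 'b word" where
  "tr1 x a = (SOME w. w \<in> words B \<and> val w = x \<otimes>\<^bsub>\<Gamma>\<^esub> \<alpha> a \<otimes>\<^bsub>\<Gamma>\<^esub> inv\<^bsub>\<Gamma>\<^esub> cl (x \<otimes>\<^bsub>\<Gamma>\<^esub> \<alpha> a))"

lemma tr1: "x \<in> reps \<Longrightarrow> tr1 x a \<in> words B \<and>
    val (tr1 x a) = x \<otimes>\<^bsub>\<Gamma>\<^esub> \<alpha> a \<otimes>\<^bsub>\<Gamma>\<^esub> inv\<^bsub>\<Gamma>\<^esub> cl (x \<otimes>\<^bsub>\<Gamma>\<^esub> \<alpha> a)"
  unfolding tr1_def by (rule someI_ex) (use coset_word[of x "\<alpha> a"] in auto)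

text \<open>An inverse letter receives the formal inverse of the word for the same edge of the coset
  graph traversed forwards. Cancelling pairs over \<open>A\<close> thus become words followed by
  their formal inverses, at no cost.\<close>

definition trl :: "'c \<Rightarrow> 'a \<times> bool \<Rightarrow> 'b word" where
  "trl x a = (if snd a then tr1 x (fst a) else winv (tr1 (step x a) (fst a)))"

lemma trl_inv: "x \<in> reps \<Longrightarrow> trl (step x a) (inv_letter a) = winv (trl x a)"
  by (simp add: trl_def step_inv)

lemma trl:
  assumes x: "x \<in> reps"
  shows "trl x a \<in> words B" "val (trl x a) = x \<otimes>\<^bsub>\<Gamma>\<^esub> ev_letter \<Gamma> \<alpha> a \<otimes>\<^bsub>\<Gamma>\<^esub> inv\<^bsub>\<Gamma>\<^esub> step x a"
proof -
  show "trl x a \<in> words B" using tr1[of x "fst a"] tr1[of "step x a" "fst a"] x by (simp add: trl_def)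
  show "val (trl x a) = x \<otimes>\<^bsub>\<Gamma>\<^esub> ev_letter \<Gamma> \<alpha> a \<otimes>\<^bsub>\<Gamma>\<^esub> inv\<^bsub>\<Gamma>\<^esub> step x a"
  proof (cases "snd a")
    case True
    then show ?thesis using tr1[of x "fst a"] x by (simp add: trl_def step_def ev_letter_def)
  next
    case False
    have "cl (step x a \<otimes>\<^bsub>\<Gamma>\<^esub> \<alpha> (fst a)) = x"
      using step_inv[OF x, of a] False by (simp add: step_def[of "step x a"] ev_letter_def)
    then have "val (tr1 (step x a) (fst a)) = step x a \<otimes>\<^bsub>\<Gamma>\<^esub> \<alpha> (fst a) \<otimes>\<^bsub>\<Gamma>\<^esub> inv\<^bsub>\<Gamma>\<^esub> x"
      using tr1[of "step x a" "fst a"] x by simp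
    then show ?thesis
      using False x by (simp add: trl_def ev_letter_def \<Gamma>.inv_mult_group \<Gamma>.m_assoc)
  qed
qed

primrec tr :: "'c \<Rightarrow> 'a word \<Rightarrow> 'b word" where
  "tr x [] = []"
| "tr x (a # w) = trl x a @ tr (step x a) w"

primrec run :: "'c \<Rightarrow> 'a word \<Rightarrow> 'c" where
  "run x [] = x"
| "run x (a # w) = run (step x a) w"

lemma tr_append: "tr x (u @ v) = tr x u @ tr (run x u) v"
  by (induction u arbitrary: x) auto

lemma run_eq: "x \<in> reps \<Longrightarrow> run x w = cl (x \<otimes>\<^bsub>\<Gamma>\<^esub> ev \<Gamma> \<alpha> w)"
proof (induction w arbitrary: x)
  case (Cons a w)
  then show ?case by (simp add: step_def cl_mult \<Gamma>.m_assoc)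
qed simp

lemma run_reps [simp]: "x \<in> reps \<Longrightarrow> run x w \<in> reps"
  by (induction w arbitrary: x) auto

lemma tr_words: "x \<in> reps \<Longrightarrow> tr x w \<in> words B"
  by (induction w arbitrary: x) (auto simp: trl)

lemma val_tr: "x \<in> reps \<Longrightarrow> val (tr x w) = x \<otimes>\<^bsub>\<Gamma>\<^esub> ev \<Gamma> \<alpha> w \<otimes>\<^bsub>\<Gamma>\<^esub> inv\<^bsub>\<Gamma>\<^esub> run x w"
proof (induction w arbitrary: x)
  case (Cons a w)
  let ?y = "step x a"
  have y: "?y \<in> carrier \<Gamma>" "run ?y w \<in> carrier \<Gamma>" using Cons.prems by simp_all
  have "inv\<^bsub>\<Gamma>\<^esub> ?y \<otimes>\<^bsub>\<Gamma>\<^esub> (?y \<otimes>\<^bsub>\<Gamma>\<^esub> z) = z" if "z \<in> carrier \<Gamma>" for z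
    using y that by (simp add: \<Gamma>.m_assoc[symmetric])
  then show ?case using Cons y by (simp add: trl \<Gamma>.m_assoc)
qed simp

text \<open>Inserting a relator therefore leaves the translation of what follows unchanged.\<close>

lemma rel_run: "r \<in> Rel \<Longrightarrow> x \<in> reps \<Longrightarrow> run x r = x"
  using Rel by (simp add: run_eq)

lemma val_rel: "r \<in> Rel \<Longrightarrow> x \<in> reps \<Longrightarrow> val (tr x r) = \<one>\<^bsub>\<Gamma>\<^esub>"
  using Rel by (simp add: val_tr rel_run)

lemma tr_bound: "\<exists>L. \<forall>x \<in> reps. \<forall>w \<in> words A. length (tr x w) \<le> L * length w"
proof -
  have "finite ((\<lambda>(x, a). length (tr1 x a)) ` (reps \<times> A))"
    using finite_A finite_reps by (intro finite_imageI finite_cartesian_product)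
  then obtain L where L: "length (tr1 x a) \<le> L" if "x \<in> reps" "a \<in> A" for x a
    unfolding finite_nat_set_iff_bounded_le by fastforce
  have "length (tr x w) \<le> L * length w" if "x \<in> reps" "w \<in> words A" for x w
    using that
  proof (induction w arbitrary: x)
    case (Cons a w)
    then have "length (trl x a) \<le> L" using L by (auto simp: trl_def)
    then show ?case using Cons.IH[of "step x a"] Cons.prems by simp
  qed simp
  then show ?thesis by blast
qed

definition rep_word :: "'c \<Rightarrow> 'b word" where
  "rep_word x = (SOME w. w \<in> words B \<and> val w = x)"

lemma rep_word: "x \<in> inner_reps \<Longrightarrow> rep_word x \<in> words B \<and> val (rep_word x) = x"
  unfolding rep_word_def by (rule someI_ex) (use val_surj in \<open>auto simp: inner_reps_def\<close>)

lemma inner_repsD [simp]: "x \<in> inner_reps \<Longrightarrow> x \<in> reps"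
  by (simp add: inner_reps_def)

lemma cl_inner:
  assumes "x \<in> \<theta> ` carrier E"
  shows "cl x \<in> inner_reps"
proof -
  have x: "x \<in> carrier \<Gamma>" using assms by auto
  have "cl x \<otimes>\<^bsub>\<Gamma>\<^esub> inv\<^bsub>\<Gamma>\<^esub> x \<in> \<theta> ` carrier E" using cl_coset_inv[OF x] N(2) by blast
  then have "cl x \<otimes>\<^bsub>\<Gamma>\<^esub> inv\<^bsub>\<Gamma>\<^esub> x \<otimes>\<^bsub>\<Gamma>\<^esub> x \<in> \<theta> ` carrier E"
    by (rule subgroup.m_closed[OF \<theta>.img_is_subgroup _ assms])
  then have "cl x \<in> \<theta> ` carrier E" using x by (simp add: \<Gamma>.m_assoc)
  then show ?thesis unfolding inner_reps_def using cl_in_reps[OF x] by blast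
qed

lemma inner_mult: "x \<in> inner_reps \<Longrightarrow> cl (x \<otimes>\<^bsub>\<Gamma>\<^esub> val w) \<in> inner_reps"
proof -
  assume "x \<in> inner_reps"
  then have "x \<otimes>\<^bsub>\<Gamma>\<^esub> val w = val (rep_word x @ w)" using rep_word by simp
  then show ?thesis using cl_inner by (simp add: val_def del: val_simps)
qed

lemma cl_one_inner: "cl \<one>\<^bsub>\<Gamma>\<^esub> \<in> inner_reps"
  by (rule cl_inner) (rule subgroup.one_closed[OF \<theta>.img_is_subgroup])

lemma finite_inner: "finite inner_reps"
  unfolding inner_reps_def by (rule finite_subset[OF _ finite_reps]) blast

lemma \<iota>_signed: "fst b \<in> B \<Longrightarrow> signed \<iota> b \<in> words A \<and> ev \<Gamma> \<alpha> (signed \<iota> b) = val [b]"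
proof -
  assume b: "fst b \<in> B"
  have "\<epsilon> (fst b) \<in> carrier E" using \<epsilon> by auto
  then show ?thesis
    using b \<iota>[OF b] by (auto simp: signed_def val_def ev_letter_def ev\<Gamma>_winv)
qed

text \<open>Elements of the kernel of \<open>\<theta>\<close>: translated relators, and the differences between the generators of
  \<open>E\<close> and their translations.\<close>

definition base_words :: "'b word set" where
  "base_words = (\<lambda>(x, r). tr x r) ` (reps \<times> Rel) \<union>
    (\<lambda>(x, b). rep_word x @ [b] @ winv (rep_word (cl (x \<otimes>\<^bsub>\<Gamma>\<^esub> val [b]))) @ winv (tr x (signed \<iota> b)))
      ` (inner_reps \<times> (B \<times> UNIV))"

lemma finite_base_words: "finite base_words"
  using finite_reps finite_inner finite_B finite_Rel
  unfolding base_words_def by (intro finite_UnI finite_imageI finite_cartesian_product) simp_all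

lemma base_words: "p \<in> base_words \<Longrightarrow> p \<in> words B \<and> val p = \<one>\<^bsub>\<Gamma>\<^esub>"
proof -
  assume "p \<in> base_words"
  then consider x r where "x \<in> reps" "r \<in> Rel" "p = tr x r"
    | x b where "x \<in> inner_reps" "fst b \<in> B"
      "p = rep_word x @ [b] @ winv (rep_word (cl (x \<otimes>\<^bsub>\<Gamma>\<^esub> val [b]))) @ winv (tr x (signed \<iota> b))"
    unfolding base_words_def by force
  then show ?thesis
  proof cases
    case 1
    then show ?thesis by (simp add: tr_words val_rel)
  next
    case 2
    let ?y = "cl (x \<otimes>\<^bsub>\<Gamma>\<^esub> val [b])"
    have y: "?y \<in> inner_reps" using inner_mult[OF 2(1)] .
    have xc: "x \<in> carrier \<Gamma>" "?y \<in> carrier \<Gamma>" using 2(1) by simp_all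
    have run: "run x (signed \<iota> b) = ?y" using \<iota>_signed[OF 2(2)] 2(1) by (simp add: run_eq)
    have "inv\<^bsub>\<Gamma>\<^esub> ?y \<otimes>\<^bsub>\<Gamma>\<^esub> (?y \<otimes>\<^bsub>\<Gamma>\<^esub> z) = z" if "z \<in> carrier \<Gamma>" for z
      using xc that by (simp add: \<Gamma>.m_assoc[symmetric])
    moreover have "val [b] \<otimes>\<^bsub>\<Gamma>\<^esub> (inv\<^bsub>\<Gamma>\<^esub> val [b] \<otimes>\<^bsub>\<Gamma>\<^esub> z) = z" if "z \<in> carrier \<Gamma>" for z
      using that by (simp add: \<Gamma>.m_assoc[symmetric])
    moreover have "val p = x \<otimes>\<^bsub>\<Gamma>\<^esub> (val [b] \<otimes>\<^bsub>\<Gamma>\<^esub> (inv\<^bsub>\<Gamma>\<^esub> ?y \<otimes>\<^bsub>\<Gamma>\<^esub> inv\<^bsub>\<Gamma>\<^esub> (x \<otimes>\<^bsub>\<Gamma>\<^esub> val [b] \<otimes>\<^bsub>\<Gamma>\<^esub> inv\<^bsub>\<Gamma>\<^esub> ?y)))"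
      unfolding 2(3) using rep_word[OF y] rep_word[OF 2(1)] 2(1) \<iota>_signed[OF 2(2)] run
      by (simp only: val_simps(2,3) val_tr inner_repsD)
    ultimately have "val p = \<one>\<^bsub>\<Gamma>\<^esub>" using xc by (simp add: \<Gamma>.inv_mult_group \<Gamma>.m_assoc)
    moreover have "p \<in> words B"
      unfolding 2(3) using rep_word[OF y] rep_word[OF 2(1)] 2(1,2) tr_words[of x] by simp
    ultimately show ?thesis by simp
  qed
qed

text \<open>All conjugates of base words that can arise: the kernel of \<theta> is centralized by
  the preimage of \<open>N\<close>, so conjugating by an element of \<open>E\<close> depends only on
  its coset. This finite set is closed under moving past generators.\<close>

definition tokens :: "'b word set" where
  "tokens = (\<lambda>(x, p). winv (rep_word x) @ p @ rep_word x) ` (inner_reps \<times> base_words)"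

lemma tokensI: "x \<in> inner_reps \<Longrightarrow> p \<in> base_words \<Longrightarrow> winv (rep_word x) @ p @ rep_word x \<in> tokens"
  unfolding tokens_def by (rule image_eqI[of _ _ "(x, p)"]) simp_all

lemma finite_tokens: "finite tokens"
  using finite_base_words finite_inner by (simp add: tokens_def)

lemma tokens: "z \<in> tokens \<Longrightarrow> z \<in> words B \<and> val z = \<one>\<^bsub>\<Gamma>\<^esub>"
  using base_words rep_word by (auto simp: tokens_def)

text \<open>All short relations of \<open>E\<close> at once: any identity between words of bounded
  total length then costs a single relator.\<close>

definition relations :: "nat \<Rightarrow> 'b word set" where
  "relations m = {w \<in> words B. length w \<le> m \<and> ev E \<epsilon> w = \<one>\<^bsub>E\<^esub>}"

lemma relations_eqv:
  assumes "u \<in> words B" "v \<in> words B" "ev E \<epsilon> u = ev E \<epsilon> v" "length u + length v \<le> m"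
  shows "eqv (relations m) 1 u v"
proof -
  have "u @ winv v \<in> relations m"
    using assms by (simp add: relations_def evE_append evE_winv)
  from eqv_relator[OF this, of "[]" v] have "eqv (relations m) 1 (u @ winv v @ v) v" by simp
  moreover have "eqv (relations m) 0 u (u @ winv v @ v)"
    using eqv_sym[OF eqv_winv_left_cancel[of "relations m" u v "[]"]] by simp
  ultimately show ?thesis using eqv_trans'[of _ 0 u _ 1 v 1] by simp
qed

text \<open>By the choice of \<open>y\<close>, the word
  \<open>rep_word x @ w @ winv (rep_word y)\<close> has its value in \<open>N\<close> and hence
  commutes with \<open>p\<close> in \<open>E\<close>. Moving a token past \<open>w\<close> only
  changes its coset from \<open>x\<close> to \<open>y\<close>.\<close>

lemma kernel_conjugate:
  fixes w :: "'b word"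
  assumes p: "val p = \<one>\<^bsub>\<Gamma>\<^esub>" and x: "x \<in> inner_reps"
  defines "y \<equiv> cl (x \<otimes>\<^bsub>\<Gamma>\<^esub> val w)"
  shows "ev E \<epsilon> ((winv (rep_word x) @ p @ rep_word x) @ w) =
    ev E \<epsilon> (w @ (winv (rep_word y) @ p @ rep_word y))"
proof -
  have y: "y \<in> inner_reps" using inner_mult[OF x] by (simp add: y_def)
  let ?t = "rep_word x @ w @ winv (rep_word y)"
  let ?e = "ev E \<epsilon>"
  have "val ?t = x \<otimes>\<^bsub>\<Gamma>\<^esub> val w \<otimes>\<^bsub>\<Gamma>\<^esub> inv\<^bsub>\<Gamma>\<^esub> y"
    using rep_word[OF x] rep_word[OF y] x y by (simp add: \<Gamma>.m_assoc)
  also have "\<dots> \<in> N" unfolding y_def using x by (intro cl_coset) simp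
  finally have "?e p \<otimes>\<^bsub>E\<^esub> ?e ?t = ?e ?t \<otimes>\<^bsub>E\<^esub> ?e p"
    using p by (intro central) (simp_all add: val_def)
  then have "?e (winv (rep_word x)) \<otimes>\<^bsub>E\<^esub> (?e p \<otimes>\<^bsub>E\<^esub> ?e ?t) \<otimes>\<^bsub>E\<^esub> ?e (rep_word y) =
    ?e (winv (rep_word x)) \<otimes>\<^bsub>E\<^esub> (?e ?t \<otimes>\<^bsub>E\<^esub> ?e p) \<otimes>\<^bsub>E\<^esub> ?e (rep_word y)" by simp
  moreover have "inv\<^bsub>E\<^esub> ?e u \<otimes>\<^bsub>E\<^esub> (?e u \<otimes>\<^bsub>E\<^esub> z) = z" if "z \<in> carrier E" for u z
    using that by (simp add: E.m_assoc[symmetric])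
  ultimately show ?thesis by (simp add: evE_append evE_winv E.m_assoc)
qed

text \<open>The representative of \<open>N\<close> need not be the identity, but it lies in
  \<open>N\<close> and so centralizes \<open>p\<close>. This makes a bare base word equal to a
  token.\<close>

lemma base_conjugate:
  assumes p: "val p = \<one>\<^bsub>\<Gamma>\<^esub>"
  defines "q \<equiv> rep_word (cl \<one>\<^bsub>\<Gamma>\<^esub>)"
  shows "ev E \<epsilon> (winv q @ p @ q) = ev E \<epsilon> p"
proof -
  have "val q \<in> N"
    using rep_word[OF cl_one_inner] cl_coset_inv[of "\<one>\<^bsub>\<Gamma>\<^esub>"] by (simp add: q_def)
  then have "ev E \<epsilon> p \<otimes>\<^bsub>E\<^esub> ev E \<epsilon> q = ev E \<epsilon> q \<otimes>\<^bsub>E\<^esub> ev E \<epsilon> p"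
    using p by (intro central) (simp_all add: val_def)
  then show ?thesis by (simp add: evE_append evE_winv E.m_assoc[symmetric])
qed

lemma tokens_commute:
  assumes "z \<in> tokens" "z' \<in> tokens"
  shows "ev E \<epsilon> z \<otimes>\<^bsub>E\<^esub> ev E \<epsilon> z' = ev E \<epsilon> z' \<otimes>\<^bsub>E\<^esub> ev E \<epsilon> z"
  using tokens[OF assms(1)] tokens[OF assms(2)] subgroup.one_closed[OF N(1)]
  by (intro central) (simp_all add: val_def)

section \<open>The cost of moving elements of the kernel through words\<close>

definition token_bound :: nat where
  "token_bound = (SOME t. \<forall>z \<in> tokens \<union> base_words. length z \<le> t)"

lemma token_bound: "z \<in> tokens \<Longrightarrow> length z \<le> token_bound" "z \<in> base_words \<Longrightarrow> length z \<le> token_bound"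
proof -
  have "finite (length ` (tokens \<union> base_words))" using finite_tokens finite_base_words by simp
  then have "\<exists>t. \<forall>z \<in> tokens \<union> base_words. length z \<le> t"
    unfolding finite_nat_set_iff_bounded_le by auto
  then have "\<forall>z \<in> tokens \<union> base_words. length z \<le> token_bound"
    unfolding token_bound_def by (rule someI_ex)
  then show "z \<in> tokens \<Longrightarrow> length z \<le> token_bound" "z \<in> base_words \<Longrightarrow> length z \<le> token_bound" by auto
qed

lemma token_step:
  assumes z: "z \<in> tokens" and b: "fst b \<in> B" and m: "2 * token_bound + 2 \<le> m"
  shows "\<exists>z' \<in> tokens. eqv (relations m) 1 (z @ [b]) ([b] @ z')"
proof -
  obtain x p where xp: "x \<in> inner_reps" "p \<in> base_words" "z = winv (rep_word x) @ p @ rep_word x"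
    using z by (auto simp: tokens_def)
  define y where "y = cl (x \<otimes>\<^bsub>\<Gamma>\<^esub> val [b])"
  define z' where "z' = winv (rep_word y) @ p @ rep_word y"
  have "y \<in> inner_reps" unfolding y_def by (rule inner_mult[OF xp(1)])
  then have z': "z' \<in> tokens" unfolding z'_def using xp(2) by (rule tokensI)
  have "eqv (relations m) 1 (z @ [b]) ([b] @ z')"
  proof (rule relations_eqv)
    show "z @ [b] \<in> words B" "[b] @ z' \<in> words B" using tokens[OF z] tokens[OF z'] b by simp_all
    show "ev E \<epsilon> (z @ [b]) = ev E \<epsilon> ([b] @ z')"
      unfolding xp(3) z'_def y_def using base_words[OF xp(2)] xp(1) by (intro kernel_conjugate) simp_all
    \<comment> \<open>Two tokens and the letter \<open>b\<close> twice: this is the origin of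
      \<open>2 * token_bound + 2\<close>.\<close>
    show "length (z @ [b]) + length ([b] @ z') \<le> m"
      using token_bound(1)[OF z] token_bound(1)[OF z'] m by simp
  qed
  with z' show ?thesis by blast
qed

lemma token_move:
  assumes "w \<in> words B" "z \<in> tokens" and m: "2 * token_bound + 2 \<le> m"
  shows "\<exists>z' \<in> tokens. eqv (relations m) (length w) (z @ w) (w @ z')"
  using assms(1,2)
proof (induction w arbitrary: z)
  case Nil
  then show ?case by (intro bexI[of _ z]) simp_all
next
  case (Cons b w)
  then obtain z1 where z1: "z1 \<in> tokens" "eqv (relations m) 1 (z @ [b]) ([b] @ z1)"
    using token_step[OF _ _ m] by fastforce
  obtain z2 where z2: "z2 \<in> tokens" "eqv (relations m) (length w) (z1 @ w) (w @ z2)"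
    using Cons.IH[OF _ z1(1)] Cons.prems by auto
  have "eqv (relations m) 1 (z @ b # w) (b # z1 @ w)"
    using eqv_append_right[OF z1(2), of w] by simp
  from eqv_trans[OF this, of "length w" "b # w @ z2"]
  have "eqv (relations m) (length (b # w)) (z @ b # w) ((b # w) @ z2)"
    using eqv_append_left[OF z2(2), of "[b]"] by simp
  with z2(1) show ?case by blast
qed

text \<open>One relator turns the base word into a token, and each letter that the token crosses
  costs one more.\<close>

lemma base_move:
  assumes p: "p \<in> base_words" and w: "w \<in> words B" and m: "2 * token_bound + 2 \<le> m"
  shows "\<exists>z \<in> tokens. eqv (relations m) (length w + 1) (p @ w) (w @ z)"
proof -
  let ?q = "rep_word (cl \<one>\<^bsub>\<Gamma>\<^esub>)"
  let ?z = "winv ?q @ p @ ?q"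
  have z: "?z \<in> tokens" using cl_one_inner p by (rule tokensI)
  have "eqv (relations m) 1 p ?z"
  proof (rule relations_eqv)
    show "p \<in> words B" "?z \<in> words B" using tokens[OF z] base_words[OF p] by simp_all
    show "ev E \<epsilon> p = ev E \<epsilon> ?z" using base_conjugate base_words[OF p] by simp
    show "length p + length ?z \<le> m" using token_bound(1)[OF z] token_bound(2)[OF p] m by linarith
  qed
  from eqv_append_right[OF this, of w] have 1: "eqv (relations m) 1 (p @ w) (?z @ w)" .
  obtain z' where z': "z' \<in> tokens" "eqv (relations m) (length w) (?z @ w) (w @ z')"
    using token_move[OF w z m] by blast
  from eqv_trans[OF 1 z'(2)] z'(1) show ?thesis by (auto simp: add.commute)
qed

text \<open>Products of tokens are kept as words whose letters are tokens, so that their length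
  counts tokens and \<open>commuting_words_quadratic\<close> applies to them.\<close>

abbreviation "unpack \<equiv> subst (\<lambda>z. z)"

lemma signed_token_move:
  assumes w: "w \<in> words B" and z: "fst a \<in> tokens" and m: "2 * token_bound + 2 \<le> m"
  shows "\<exists>a'. fst a' \<in> tokens \<and> eqv (relations m) (length w) (signed (\<lambda>z. z) a @ w) (w @ signed (\<lambda>z. z) a')"
proof -
  obtain z s where a: "a = (z, s)" by (cases a)
  then obtain z' where z': "z' \<in> tokens" "eqv (relations m) (length w) (z @ w) (w @ z')"
    using token_move[OF w _ m] z by auto
  show ?thesis
  proof (cases s)
    case True
    then show ?thesis using z' a by (intro exI[of _ "(z', True)"]) (simp add: signed_def)
  next
    case False
    \<comment> \<open>An inverse token is moved with the derivation for the token itself, read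
      backwards, at the same cost.\<close>
    have "eqv (relations m) (length w) (winv z @ w @ z') w"
      unfolding eqv_move_winv by (rule eqv_sym[OF z'(2)])
    from eqv_append_right[OF this, of "winv z'"]
    have "eqv (relations m) (length w) (winv z @ w @ z' @ winv z') (w @ winv z')" by simp
    moreover have "eqv (relations m) 0 (winv z @ w) (winv z @ w @ z' @ winv z')"
      using eqv_sym[OF eqv_winv_right_cancel[of "relations m" "winv z @ w" z' "[]"]] by simp
    ultimately have "eqv (relations m) (length w) (winv z @ w) (w @ winv z')"
      using eqv_trans' by fastforce
    then show ?thesis using False z'(1) a by (intro exI[of _ "(z', False)"]) (simp add: signed_def)
  qed
qed

lemma token_words_move:
  assumes w: "w \<in> words B" and m: "2 * token_bound + 2 \<le> m"
  shows "ts \<in> words tokens \<Longrightarrow> \<exists>ts'. ts' \<in> words tokens \<and> length ts' = length ts \<and>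
    eqv (relations m) (length ts * length w) (unpack ts @ w) (w @ unpack ts')"
proof (induction ts)
  case Nil
  then show ?case by (intro exI[of _ "[]"]) simp
next
  case (Cons a ts)
  then obtain ts' where ts': "ts' \<in> words tokens" "length ts' = length ts"
    "eqv (relations m) (length ts * length w) (unpack ts @ w) (w @ unpack ts')" by auto
  obtain a' where a': "fst a' \<in> tokens"
    "eqv (relations m) (length w) (signed (\<lambda>z. z) a @ w) (w @ signed (\<lambda>z. z) a')"
    using signed_token_move[OF w _ m, of a] Cons.prems by (auto simp del: split_paired_Ex)
  have "eqv (relations m) (length ts * length w) (signed (\<lambda>z. z) a @ unpack ts @ w) (signed (\<lambda>z. z) a @ w @ unpack ts')"
    by (rule eqv_append_left[OF ts'(3)])
  moreover have "eqv (relations m) (length w) (signed (\<lambda>z. z) a @ w @ unpack ts') (w @ signed (\<lambda>z. z) a' @ unpack ts')"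
    using eqv_append_right[OF a'(2), of "unpack ts'"] by simp
  ultimately have "eqv (relations m) (length ts * length w + length w) (unpack (a # ts) @ w) (w @ unpack (a' # ts'))"
    using eqv_trans by simp
  then have "eqv (relations m) (length (a # ts) * length w) (unpack (a # ts) @ w) (w @ unpack (a' # ts'))"
    by (simp add: add.commute)
  then show ?case using ts' a'(1) by (intro exI[of _ "a' # ts'"]) simp
qed

text \<open>\<open>length W + k * M\<close> never exceeds \<open>n\<close> along the filling: an
  insertion lengthens the word by at most \<open>M\<close> and uses up one of the \<open>k\<close>
  relators. So each translated relator, a base word, crosses at most \<open>L * n\<close> letters on
  its way to the end, and the cancellations are free by \<open>trl_inv\<close>.\<close>

lemma fill_tokens:
  assumes L: "\<And>x w. x \<in> reps \<Longrightarrow> w \<in> words A \<Longrightarrow> length (tr x w) \<le> L * length w"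
    and M: "\<And>r. r \<in> Rel \<Longrightarrow> length r \<le> M" and m: "2 * token_bound + 2 \<le> m"
  shows "fill Rel k W \<Longrightarrow> W \<in> words A \<Longrightarrow> x \<in> reps \<Longrightarrow> length W + k * M \<le> n \<Longrightarrow>
    \<exists>ts. ts \<in> words tokens \<and> length ts \<le> k \<and> eqv (relations m) (k * (L * n + 1)) (tr x W) (unpack ts)"
proof (induction arbitrary: n rule: fill.induct)
  case (fill_Nil k)
  then show ?case by (intro exI[of _ "[]"]) simp
next
  case (fill_cancel k u v a)
  have xr: "run x u \<in> reps" using fill_cancel.prems by simp
  have "tr x (u @ a # inv_letter a # v) =
      tr x u @ trl (run x u) a @ winv (trl (run x u) a) @ tr (run x u) v"
    using xr by (simp add: tr_append trl_inv step_inv)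
  then have "eqv (relations m) 0 (tr x (u @ a # inv_letter a # v)) (tr x (u @ v))"
    using eqv_winv_right_cancel by (simp add: tr_append)
  moreover obtain ts where "ts \<in> words tokens" "length ts \<le> k"
    "eqv (relations m) (k * (L * n + 1)) (tr x (u @ v)) (unpack ts)"
    using fill_cancel.IH[of n] fill_cancel.prems by auto
  ultimately show ?case using eqv_trans by (metis add_0)
next
  case (fill_insert k u r v)
  let ?y = "run x u" and ?c = "k * (L * n + 1)"
  have r: "r \<in> words A" "length r \<le> M" using fill_insert.hyps Rel M by auto
  have y: "?y \<in> reps" using fill_insert.prems by simp
  have "length (u @ r @ v) + k * M \<le> n" using fill_insert.prems r by simp
  then obtain ts where ts: "ts \<in> words tokens" "length ts \<le> k"
    "eqv (relations m) ?c (tr x (u @ r @ v)) (unpack ts)"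
    using fill_insert.IH[of n] fill_insert.prems r by auto
  let ?p = "tr ?y r" and ?w = "tr ?y v"
  have p: "?p \<in> base_words" using y fill_insert.hyps by (force simp: base_words_def)
  have w: "?w \<in> words B" using y by (rule tr_words)
  obtain z where z: "z \<in> tokens" "eqv (relations m) (length ?w + 1) (?p @ ?w) (?w @ z)"
    using base_move[OF p w m] by blast
  have "length ?w \<le> L * length v" using L[OF y, of v] fill_insert.prems by simp
  also have "\<dots> \<le> L * n" using fill_insert.prems by (intro mult_le_mono2) simp
  finally have lw: "length ?w + 1 \<le> L * n + 1" by simp
  have "eqv (relations m) (length ?w + 1) (tr x u @ ?p @ ?w) (tr x u @ ?w @ z)"
    by (rule eqv_append_left[OF z(2)])
  moreover have "tr x (u @ r @ v) = tr x u @ ?p @ ?w"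
    using rel_run[OF fill_insert.hyps(2) y] by (simp add: tr_append)
  ultimately have 1: "eqv (relations m) (length ?w + 1) (tr x (u @ r @ v)) (tr x u @ ?w @ z)" by simp
  have "eqv (relations m) (length ?w + 1 + ?c) (tr x u @ ?w @ z) (unpack ts)"
    by (rule eqv_trans[OF eqv_sym[OF 1] ts(3)])
  \<comment> \<open>The longer word is the shorter one followed by \<open>z\<close>; bringing
    \<open>z\<close> to the other side makes it enter the token word with exponent -1.\<close>
  from eqv_append_right[OF this, of "winv z"]
  have "eqv (relations m) (length ?w + 1 + ?c) (tr x u @ ?w @ z @ winv z) (unpack (ts @ [(z, False)]))"
    by (simp add: signed_def)
  moreover have "eqv (relations m) 0 (tr x u @ ?w) (tr x u @ ?w @ z @ winv z)"
    using eqv_sym[OF eqv_winv_right_cancel[of "relations m" "tr x u @ ?w" z "[]"]] by simp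
  ultimately have "eqv (relations m) (Suc k * (L * n + 1)) (tr x (u @ v)) (unpack (ts @ [(z, False)]))"
    unfolding tr_append using eqv_trans'[of _ 0 _ _ "length ?w + 1 + ?c" _ "Suc k * (L * n + 1)"] lw
    by fastforce
  then show ?case using ts z(1) by (intro exI[of _ "ts @ [(z, False)]"]) simp
qed

text \<open>Exchanges \<open>w\<close> for its image under \<iota>, rewritten over \<open>B\<close>.
  Each letter leaves behind one base word, the defect of its translation, which has to cross the
  rest of the translation, of length at most \<open>L * (c * n)\<close>, and a representative, of
  length at most \<open>Q\<close>.\<close>

lemma base_tokens:
  assumes L: "\<And>x w. x \<in> reps \<Longrightarrow> w \<in> words A \<Longrightarrow> length (tr x w) \<le> L * length w"
    and c: "\<And>b. b \<in> B \<Longrightarrow> length (\<iota> b) \<le> c"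
    and Q: "\<And>x. x \<in> inner_reps \<Longrightarrow> length (rep_word x) \<le> Q" and m: "2 * token_bound + 2 \<le> m"
  shows "w \<in> words B \<Longrightarrow> x \<in> inner_reps \<Longrightarrow> length w \<le> n \<Longrightarrow>
    \<exists>ts. ts \<in> words tokens \<and> length ts \<le> length w \<and> eqv (relations m) (length w * (L * (c * n) + Q + 1))
      (rep_word x @ w) (tr x (subst \<iota> w) @ rep_word (cl (x \<otimes>\<^bsub>\<Gamma>\<^esub> val w)) @ unpack ts)"
proof (induction w arbitrary: x)
  case Nil
  then show ?case by (intro exI[of _ "[]"]) simp
next
  case (Cons b w)
  let ?K = "L * (c * n) + Q + 1"
  let ?y = "cl (x \<otimes>\<^bsub>\<Gamma>\<^esub> val [b])"
  have b: "fst b \<in> B" "w \<in> words B" using Cons.prems by auto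
  have y: "?y \<in> inner_reps" using Cons.prems(2) by (rule inner_mult)
  define p where "p = rep_word x @ [b] @ winv (rep_word ?y) @ winv (tr x (signed \<iota> b))"
  have p: "p \<in> base_words"
    unfolding p_def base_words_def using Cons.prems(2) b(1)
    by (intro UnI2 image_eqI[of _ _ "(x, b)"]) (auto simp: mem_Times_iff)
  have run: "run x (signed \<iota> b) = ?y" using \<iota>_signed[OF b(1)] Cons.prems(2) by (simp add: run_eq)
  have "val (b # w) = val [b] \<otimes>\<^bsub>\<Gamma>\<^esub> val w" using val_simps(2)[of "[b]" w] by simp
  then have cy: "cl (?y \<otimes>\<^bsub>\<Gamma>\<^esub> val w) = cl (x \<otimes>\<^bsub>\<Gamma>\<^esub> val (b # w))" (is "?g = _")
    using Cons.prems(2) by (simp add: cl_mult \<Gamma>.m_assoc)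
  have g: "?g \<in> inner_reps" using y by (rule inner_mult)
  obtain ts where ts: "ts \<in> words tokens" "length ts \<le> length w"
    "eqv (relations m) (length w * ?K) (rep_word ?y @ w) (tr ?y (subst \<iota> w) @ rep_word ?g @ unpack ts)"
    using Cons.IH[OF b(2) y] Cons.prems by auto
  let ?u = "tr x (signed \<iota> b) @ tr ?y (subst \<iota> w) @ rep_word ?g"
  have \<iota>w: "subst \<iota> (b # w) \<in> words A"
    using subst_in_words[OF Cons.prems(1), of \<iota> A] \<iota> by blast
  have tru: "?u = tr x (subst \<iota> (b # w)) @ rep_word ?g" by (simp add: tr_append run)
  have u: "?u \<in> words B" using rep_word[OF g] tr_words Cons.prems(2) y by simp
  have "length (tr x (subst \<iota> (b # w))) \<le> L * length (subst \<iota> (b # w))"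
    using Cons.prems(2) \<iota>w by (intro L) simp_all
  also have "length (subst \<iota> (b # w)) \<le> c * n"
    using le_trans[OF length_subst_le[OF Cons.prems(1) c] mult_le_mono2[OF Cons.prems(3), of c]] by simp
  finally have lu: "length ?u + 1 \<le> ?K" using Q[OF g] unfolding tru by simp
  obtain z where z: "z \<in> tokens" "eqv (relations m) (length ?u + 1) (p @ ?u) (?u @ z)"
    using base_move[OF p u m] by blast
  have "eqv (relations m) 0 (p @ tr x (signed \<iota> b) @ rep_word ?y @ w)
      (rep_word x @ [b] @ winv (rep_word ?y) @ rep_word ?y @ w)"
    using eqv_winv_left_cancel[of "relations m" "rep_word x @ [b] @ winv (rep_word ?y)" "tr x (signed \<iota> b)"]
    by (simp add: p_def)
  moreover have "eqv (relations m) 0 (rep_word x @ [b] @ winv (rep_word ?y) @ rep_word ?y @ w) (rep_word x @ b # w)"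
    using eqv_winv_left_cancel[of "relations m" "rep_word x @ [b]" "rep_word ?y"] by simp
  ultimately have "eqv (relations m) 0 (p @ tr x (signed \<iota> b) @ rep_word ?y @ w) (rep_word x @ b # w)"
    using eqv_trans by fastforce
  moreover have "eqv (relations m) (length w * ?K) (p @ tr x (signed \<iota> b) @ rep_word ?y @ w) (p @ ?u @ unpack ts)"
    using eqv_append_left[OF ts(3), of "p @ tr x (signed \<iota> b)"] by simp
  ultimately have 1: "eqv (relations m) (length w * ?K) (rep_word x @ b # w) (p @ ?u @ unpack ts)"
    using eqv_trans[OF eqv_sym] by fastforce
  have 2: "eqv (relations m) (length ?u + 1) (p @ ?u @ unpack ts) (?u @ z @ unpack ts)"
    using eqv_append_right[OF z(2), of "unpack ts"] by simp
  have "eqv (relations m) (length (b # w) * ?K) (rep_word x @ b # w) (?u @ z @ unpack ts)"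
    by (rule eqv_trans'[OF 1 2]) (use lu in simp)
  moreover have "?u @ z @ unpack ts = tr x (subst \<iota> (b # w)) @ rep_word (cl (x \<otimes>\<^bsub>\<Gamma>\<^esub> val (b # w))) @
      unpack ((z, True) # ts)"
    using arg_cong[OF tru, of "\<lambda>u. u @ z @ unpack ts"] by (simp add: signed_def cy)
  ultimately have "eqv (relations m) (length (b # w) * ?K) (rep_word x @ b # w)
      (tr x (subst \<iota> (b # w)) @ rep_word (cl (x \<otimes>\<^bsub>\<Gamma>\<^esub> val (b # w))) @ unpack ((z, True) # ts))"
    by (simp only:)
  then show ?case using ts(1,2) z(1) by (intro exI[of _ "(z, True) # ts"] conjI) simp_all
qed

text \<open>Let \<open>q\<close> represent the coset \<open>N\<close>. The word \<open>q w\<close>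
  is turned into the translation of \<open>w\<close>, then \<open>q\<close>, then tokens; the
  filling converts the translation into at most \<open>k\<close> further tokens, and these are moved
  past \<open>q\<close>. Cancelling \<open>q\<close> leaves a trivial product of at most
  \<open>k + length w\<close> commuting tokens.\<close>

theorem quadratic_filling:
  "\<exists>C m. \<forall>w \<in> words B. \<forall>k. ev E \<epsilon> w = \<one>\<^bsub>E\<^esub> \<longrightarrow> fill Rel k (subst \<iota> w) \<longrightarrow>
     eqv (relations m) (C * (k + length w + 1)\<^sup>2) w []"
proof -
  let ?v = "\<lambda>z. ev E \<epsilon> z"
  have v: "?v \<in> tokens \<rightarrow> carrier E" by simp
  have ev_unpack: "ev E \<epsilon> (unpack ts) = ev E ?v ts" for ts
    using E.ev_subst[OF \<epsilon> all_words all_words, of "\<lambda>z. z" ts] by simp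
  obtain W C0 where W: "finite W" "\<And>w. w \<in> W \<Longrightarrow> w \<in> words tokens \<and> ev E ?v w = \<one>\<^bsub>E\<^esub>"
    and quad: "\<And>P (\<phi> :: 'b word \<Rightarrow> 'b word) w. commuting P tokens \<phi> \<Longrightarrow> (\<And>v. v \<in> W \<Longrightarrow> eqv P 1 (subst \<phi> v) []) \<Longrightarrow>
       w \<in> words tokens \<Longrightarrow> ev E ?v w = \<one>\<^bsub>E\<^esub> \<Longrightarrow> eqv P (C0 * (length w + 1)\<^sup>2) (subst \<phi> w) []"
    using commuting_words_quadratic[OF E.is_group finite_tokens v] by blast
  obtain L where L: "\<And>x w. x \<in> reps \<Longrightarrow> w \<in> words A \<Longrightarrow> length (tr x w) \<le> L * length w"
    using tr_bound by blast
  obtain M where M: "\<And>r. r \<in> Rel \<Longrightarrow> length r \<le> M"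
    using finite_Rel finite_nat_set_iff_bounded_le[of "length ` Rel"] by auto
  obtain c where c: "\<And>b. b \<in> B \<Longrightarrow> length (\<iota> b) \<le> c"
    using finite_B finite_nat_set_iff_bounded_le[of "(\<lambda>b. length (\<iota> b)) ` B"] by auto
  obtain Q where Q: "\<And>x. x \<in> inner_reps \<Longrightarrow> length (rep_word x) \<le> Q"
    using finite_inner finite_nat_set_iff_bounded_le[of "(\<lambda>x. length (rep_word x)) ` inner_reps"] by auto
  obtain U where U: "\<And>v. v \<in> W \<Longrightarrow> length (unpack v) \<le> U"
    using W(1) finite_nat_set_iff_bounded_le[of "(\<lambda>v. length (unpack v)) ` W"] by auto
  \<comment> \<open>\<open>2 * token_bound + 2\<close> is needed for a token passing a letter,
    \<open>4 * token_bound\<close> for two tokens commuting, and \<open>U\<close> for the relators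
    among tokens.\<close>
  define m where "m = 4 * token_bound + 2 + U"
  have m: "2 * token_bound + 2 \<le> m" by (simp add: m_def)
  have comm: "commuting (relations m) tokens (\<lambda>z. z)"
    unfolding commuting_def
  proof (intro allI impI relations_eqv)
    fix a b :: "'b word \<times> bool" assume ab: "fst a \<in> tokens" "fst b \<in> tokens"
    let ?s = "signed (\<lambda>z. z)"
    have words: "?s a \<in> words B" "?s b \<in> words B" using tokens ab by (auto simp: signed_def)
    then show "?s a @ ?s b \<in> words B" "?s b @ ?s a \<in> words B" by simp_all
    have "length (?s a) \<le> token_bound" "length (?s b) \<le> token_bound"
      using token_bound(1) ab by (auto simp: signed_def)
    then show "length (?s a @ ?s b) + length (?s b @ ?s a) \<le> m" by (simp add: m_def)
    have "?v (fst a) \<otimes>\<^bsub>E\<^esub> ?v (fst b) = ?v (fst b) \<otimes>\<^bsub>E\<^esub> ?v (fst a)" using tokens_commute ab .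
    then have "?v (?s a) \<otimes>\<^bsub>E\<^esub> ?v (fst b) = ?v (fst b) \<otimes>\<^bsub>E\<^esub> ?v (?s a)"
      by (auto simp: signed_def evE_winv E.commute_inv)
    then have "?v (?s b) \<otimes>\<^bsub>E\<^esub> ?v (?s a) = ?v (?s a) \<otimes>\<^bsub>E\<^esub> ?v (?s b)"
      by (auto simp: signed_def[of _ b] evE_winv E.commute_inv)
    then show "?v (?s a @ ?s b) = ?v (?s b @ ?s a)" by (simp add: evE_append)
  qed
  have relW: "eqv (relations m) 1 (unpack v) []" if v: "v \<in> W" for v
  proof -
    have "unpack v \<in> words B" using subst_in_words[of v tokens "\<lambda>z. z" B] W(2)[OF v] tokens by blast
    then have "unpack v \<in> relations m"
      using U[OF v] W(2)[OF v] by (simp add: relations_def m_def ev_unpack)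
    from eqv_relator[OF this, of "[]" "[]"] show ?thesis by simp
  qed
  \<comment> \<open>The summands pay, in this order, for translating \<open>w\<close>, filling the
    translation, moving tokens past \<open>q\<close>, and filling the token word.\<close>
  define C where "C = (L * c + Q + 1) + (L * (c + M) + 1) + Q + C0"
  have "eqv (relations m) (C * (k + length w + 1)\<^sup>2) w []"
    if w: "w \<in> words B" and triv: "ev E \<epsilon> w = \<one>\<^bsub>E\<^esub>" and fill: "fill Rel k (subst \<iota> w)" for w k
  proof -
    let ?n = "length w" and ?x = "cl \<one>\<^bsub>\<Gamma>\<^esub>" and ?P = "relations m"
    let ?q = "rep_word ?x" and ?s = "k + length w + 1"
    have x: "?x \<in> inner_reps" by (rule cl_one_inner)
    have "cl (?x \<otimes>\<^bsub>\<Gamma>\<^esub> val w) = ?x" using triv x by (simp add: val_def)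
    then obtain ts1 where ts1: "ts1 \<in> words tokens" "length ts1 \<le> ?n"
      and 1: "eqv ?P (?n * (L * (c * ?n) + Q + 1)) (?q @ w) (tr ?x (subst \<iota> w) @ ?q @ unpack ts1)"
      using base_tokens[OF L c Q m w x order_refl] by auto
    have \<iota>w: "subst \<iota> w \<in> words A" using subst_in_words[OF w, of \<iota> A] \<iota> by blast
    have "length (subst \<iota> w) + k * M \<le> c * ?n + k * M" using length_subst_le[OF w c] by simp
    from fill_tokens[OF L M m fill \<iota>w inner_repsD[OF x] this]
    obtain ts2 where ts2: "ts2 \<in> words tokens" "length ts2 \<le> k"
      and 2: "eqv ?P (k * (L * (c * ?n + k * M) + 1)) (tr ?x (subst \<iota> w)) (unpack ts2)" by blast
    have q: "?q \<in> words B" using rep_word[OF x] by simp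
    obtain ts3 where ts3: "ts3 \<in> words tokens" "length ts3 = length ts2"
      and 3: "eqv ?P (length ts2 * length ?q) (unpack ts2 @ ?q) (?q @ unpack ts3)"
      using token_words_move[OF q m ts2(1)] by blast
    let ?ts = "ts3 @ ts1"
    have "eqv ?P (?n * (L * (c * ?n) + Q + 1) + k * (L * (c * ?n + k * M) + 1) + length ts2 * length ?q)
        (?q @ w) (?q @ unpack ?ts)"
      using eqv_trans[OF eqv_trans[OF 1 eqv_append_right[OF 2]] eqv_append_right[OF 3, of "unpack ts1", simplified]]
      by simp
    then have 4: "eqv ?P (?n * (L * (c * ?n) + Q + 1) + k * (L * (c * ?n + k * M) + 1) + length ts2 * length ?q)
        w (unpack ?ts)" (is "eqv _ ?K _ _") by (rule eqv_cancel_left)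
    have "ev E \<epsilon> (unpack ?ts) = \<one>\<^bsub>E\<^esub>"
      using E.ev_eqv[OF \<epsilon> _ 4] triv by (simp add: relations_def)
    then have "ev E ?v ?ts = \<one>\<^bsub>E\<^esub>" by (simp only: ev_unpack)
    then have 5: "eqv ?P (C0 * (length ?ts + 1)\<^sup>2) (unpack ?ts) []"
      using ts1 ts3 by (intro quad[OF comm relW]) simp_all
    have n: "?n \<le> ?s" and k: "k \<le> ?s" and s1: "1 \<le> ?s" by simp_all
    have "?n * (L * (c * ?n) + Q + 1) \<le> ?s * (L * (c * ?s) + Q * ?s + 1 * ?s)"
      using n s1 by (intro mult_le_mono add_mono order_refl) simp_all
    moreover have "k * (L * (c * ?n + k * M) + 1) \<le> ?s * (L * (c * ?s + ?s * M) + 1 * ?s)"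
      using n k s1 by (intro mult_le_mono add_mono order_refl) simp_all
    moreover have "length ts2 * length ?q \<le> ?s * (Q * ?s)"
      using ts2(2) Q[OF x] k s1 mult_le_mono[of "length ?q" Q 1 ?s] by (intro mult_le_mono) simp_all
    moreover have "C0 * (length ?ts + 1)\<^sup>2 \<le> C0 * ?s\<^sup>2"
      using ts1(2) ts2(2) ts3(2) by (intro mult_le_mono2 power_mono) simp_all
    moreover have "?s * (L * (c * ?s) + Q * ?s + 1 * ?s) + ?s * (L * (c * ?s + ?s * M) + 1 * ?s) + ?s * (Q * ?s) + C0 * ?s\<^sup>2
        = C * ?s\<^sup>2"
      unfolding C_def power2_eq_square by algebra
    ultimately have "?K + C0 * (length ?ts + 1)\<^sup>2 \<le> C * ?s\<^sup>2" by linarith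
    then show ?thesis by (rule eqv_trans'[OF 4 5])
  qed
  then show ?thesis by blast
qed

end

lemma (in group) generate_conjugate:
  assumes S: "S \<subseteq> carrier G" and k: "k \<in> carrier G"
    and conj: "\<And>s. s \<in> S \<Longrightarrow> inv k \<otimes> s \<otimes> k \<in> generate G S"
    and x: "x \<in> generate G S"
  shows "inv k \<otimes> x \<otimes> k \<in> generate G S"
  using x
proof (induction rule: generate.induct)
  case one
  then show ?case using k by (simp add: generate.one)
next
  case (incl h)
  then show ?case by (rule conj)
next
  case (inv h)
  have "inv k \<otimes> inv h \<otimes> k = inv (inv k \<otimes> h \<otimes> k)"
    using k inv S by (auto simp: inv_mult_group m_assoc subset_iff)
  then show ?case using generate_m_inv_closed[OF S conj[OF inv]] by simp
next
  case (eng a b)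
  then have ab: "a \<in> carrier G" "b \<in> carrier G" using generate_in_carrier[OF S] by auto
  have "k \<otimes> (inv k \<otimes> y) = y" if "y \<in> carrier G" for y using k that by (simp add: m_assoc[symmetric])
  then have "inv k \<otimes> (a \<otimes> b) \<otimes> k = (inv k \<otimes> a \<otimes> k) \<otimes> (inv k \<otimes> b \<otimes> k)"
    using k ab by (simp add: m_assoc)
  then show ?case using generate.eng[OF eng.IH] by simp
qed

lemma ev_DirProd:
  assumes "group G" "group H" and f: "f \<in> UNIV \<rightarrow> carrier (G \<times>\<times> H)"
  shows "ev (G \<times>\<times> H) f w = (ev G (\<lambda>x. fst (f x)) w, ev H (\<lambda>x. snd (f x)) w)"
proof (induction w)
  case (Cons a w)
  have "f (fst a) \<in> carrier G \<times> carrier H" using f by auto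
  then obtain g h where "f (fst a) = (g, h)" "g \<in> carrier G" "h \<in> carrier H" by auto
  then show ?case using Cons assms(1,2) by (simp add: ev_letter_def)
qed simp


section \<open>Structure of \<open>\<E>(G)\<close>\<close>

context E_generated
begin

abbreviation G3 where "G3 \<equiv> G \<times>\<times> (G \<times>\<times> G)"

lemma group_G3: "group G3"
  by (intro DirProd_group is_group)

lemma group_G2: "group (G \<times>\<times> G)"
  by (intro DirProd_group is_group)

lemma inv_G3: "a \<in> carrier G \<Longrightarrow> b \<in> carrier G \<Longrightarrow> c \<in> carrier G \<Longrightarrow>
    inv\<^bsub>G3\<^esub> (a, b, c) = (inv a, inv b, inv c)"
  using is_group group_G2 by simp

lemma commutator_G3:
  "a \<in> carrier G \<Longrightarrow> b \<in> carrier G \<Longrightarrow> c \<in> carrier G \<Longrightarrow> a' \<in> carrier G \<Longrightarrow> b' \<in> carrier G \<Longrightarrow> c' \<in> carrier G \<Longrightarrow>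
    commutator G3 (a, b, c) (a', b', c') = (commutator G a a', commutator G b b', commutator G c c')"
  by (simp add: commutator_def inv_G3)

lemma commutator_one [simp]: "x \<in> carrier G \<Longrightarrow> commutator G x \<one> = \<one>" "x \<in> carrier G \<Longrightarrow> commutator G \<one> x = \<one>"
  by (simp_all add: commutator_def)

text \<open>The relations hold because commutators of the two copies land in the third coordinate
  alone and the elements \<open>k^-1 k\<close> with the second factor taken in the second copy land
  in the first two.\<close>

lemma theta_exists:
  obtains \<theta> where "\<theta> \<in> hom E G3" "\<And>g. g \<in> carrier G \<Longrightarrow> \<theta> (iota1 g) = (g, \<one>, g)"
    "\<And>g. g \<in> carrier G \<Longrightarrow> \<theta> (iota2 g) = (\<one>, g, g)"
proof (rule E_universal[OF group_G3])
  show "(\<lambda>g. (g, \<one>, g)) \<in> hom G G3" "(\<lambda>g. (\<one>, g, g)) \<in> hom G G3" by (auto simp: hom_def)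
qed (use that in \<open>auto simp: commutator_G3 inv_G3\<close>)

lemma iota_closed [simp]: "g \<in> carrier G \<Longrightarrow> iota1 g \<in> carrier E" "g \<in> carrier G \<Longrightarrow> iota2 g \<in> carrier E"
  using E_gen_closed by auto

lemma iota_mult: "g \<in> carrier G \<Longrightarrow> h \<in> carrier G \<Longrightarrow> iota1 (g \<otimes> h) = iota1 g \<otimes>\<^bsub>E\<^esub> iota1 h"
    "g \<in> carrier G \<Longrightarrow> h \<in> carrier G \<Longrightarrow> iota2 (g \<otimes> h) = iota2 g \<otimes>\<^bsub>E\<^esub> iota2 h"
  using E_gen_hom by (auto simp: hom_def)

lemma iota_group_hom: "group_hom G E iota1" "group_hom G E iota2"
  using E_gen_hom by (simp_all add: group_hom_def group_hom_axioms_def is_group E.is_group)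

lemma iota_inv: "g \<in> carrier G \<Longrightarrow> iota1 (inv g) = inv\<^bsub>E\<^esub> iota1 g" "g \<in> carrier G \<Longrightarrow> iota2 (inv g) = inv\<^bsub>E\<^esub> iota2 g"
  using group_hom.hom_inv iota_group_hom by fastforce+

lemma iota_one: "iota1 \<one> = \<one>\<^bsub>E\<^esub>" "iota2 \<one> = \<one>\<^bsub>E\<^esub>"
  using group_hom.hom_one iota_group_hom by fastforce+

definition dcom :: "'a \<Rightarrow> 'a \<Rightarrow> ('a + 'a) word set set" where
  "dcom g h = commutator E (iota1 g) (iota2 h)"

definition lgen :: "'a \<Rightarrow> ('a + 'a) word set set" where
  "lgen k = inv\<^bsub>E\<^esub> iota1 k \<otimes>\<^bsub>E\<^esub> iota2 k"

definition DD where "DD = generate E {dcom g h | g h. g \<in> carrier G \<and> h \<in> carrier G}"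
definition LL where "LL = generate E (lgen ` carrier G)"

lemma dcom_closed [simp]: "g \<in> carrier G \<Longrightarrow> h \<in> carrier G \<Longrightarrow> dcom g h \<in> carrier E"
  by (simp add: dcom_def)

lemma lgen_closed [simp]: "k \<in> carrier G \<Longrightarrow> lgen k \<in> carrier E"
  by (simp add: lgen_def)

lemma D_set_closed: "{dcom g h | g h. g \<in> carrier G \<and> h \<in> carrier G} \<subseteq> carrier E"
  by auto

lemma L_set_closed: "lgen ` carrier G \<subseteq> carrier E"
  by auto

lemma subgroup_DD: "subgroup DD E"
  unfolding DD_def by (rule E.generate_is_subgroup[OF D_set_closed])

lemma subgroup_LL: "subgroup LL E"
  unfolding LL_def by (rule E.generate_is_subgroup[OF L_set_closed])

lemma DD_closed: "x \<in> DD \<Longrightarrow> x \<in> carrier E" and LL_closed: "x \<in> LL \<Longrightarrow> x \<in> carrier E"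
  using subgroup.subset[OF subgroup_DD] subgroup.subset[OF subgroup_LL] by auto

lemma dcom_DD: "g \<in> carrier G \<Longrightarrow> h \<in> carrier G \<Longrightarrow> dcom g h \<in> DD"
  unfolding DD_def by (rule generate.incl) blast

lemma lgen_LL: "k \<in> carrier G \<Longrightarrow> lgen k \<in> LL"
  unfolding LL_def by (rule generate.incl) blast

lemma DD_LL_commute: "x \<in> DD \<Longrightarrow> y \<in> LL \<Longrightarrow> x \<otimes>\<^bsub>E\<^esub> y = y \<otimes>\<^bsub>E\<^esub> x"
  unfolding DD_def LL_def
proof (rule E.generate_commute_generate[OF D_set_closed L_set_closed])
  fix s t assume "s \<in> {dcom g h | g h. g \<in> carrier G \<and> h \<in> carrier G}" "t \<in> lgen ` carrier G"
  then show "s \<otimes>\<^bsub>E\<^esub> t = t \<otimes>\<^bsub>E\<^esub> s"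
    using E_gen_commute by (auto simp: dcom_def lgen_def)
qed

lemma E_canc: "x \<in> carrier E \<Longrightarrow> y \<in> carrier E \<Longrightarrow> inv\<^bsub>E\<^esub> x \<otimes>\<^bsub>E\<^esub> (x \<otimes>\<^bsub>E\<^esub> y) = y"
    "x \<in> carrier E \<Longrightarrow> y \<in> carrier E \<Longrightarrow> x \<otimes>\<^bsub>E\<^esub> (inv\<^bsub>E\<^esub> x \<otimes>\<^bsub>E\<^esub> y) = y"
  by (simp_all add: E.m_assoc[symmetric])

text \<open>By \<open>(lgen k)^h = lgen (k h) * (lgen h)^-1\<close> with \<open>h\<close> in the
  first copy. This allows elements of the first copy to be collected in front of
  \<open>LL\<close>.\<close>

lemma LL_conjugate:
  assumes "h \<in> carrier G" "x \<in> LL"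
  shows "inv\<^bsub>E\<^esub> iota1 h \<otimes>\<^bsub>E\<^esub> x \<otimes>\<^bsub>E\<^esub> iota1 h \<in> LL"
  unfolding LL_def
proof (rule E.generate_conjugate[OF L_set_closed])
  show "x \<in> generate E (lgen ` carrier G)" using assms(2) by (simp add: LL_def)
  fix s assume "s \<in> lgen ` carrier G"
  then obtain k where k: "k \<in> carrier G" "s = lgen k" by blast
  have "inv\<^bsub>E\<^esub> iota1 h \<otimes>\<^bsub>E\<^esub> s \<otimes>\<^bsub>E\<^esub> iota1 h = lgen (k \<otimes> h) \<otimes>\<^bsub>E\<^esub> inv\<^bsub>E\<^esub> lgen h"
    using k assms(1) by (simp add: lgen_def iota_mult E.inv_mult_group E.m_assoc E_canc)
  also have "\<dots> \<in> LL"
    using k assms(1) lgen_LL subgroup_LL by (simp add: subgroup.m_closed subgroup.m_inv_closed)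
  finally show "inv\<^bsub>E\<^esub> iota1 h \<otimes>\<^bsub>E\<^esub> s \<otimes>\<^bsub>E\<^esub> iota1 h \<in> generate E (lgen ` carrier G)" by (simp add: LL_def)
qed (use assms in simp)

text \<open>By \<open>[g, h]^k = [g, k]^-1 * [g, h k]\<close> with \<open>h\<close> and
  \<open>k\<close> in the second copy. This allows elements of both copies to be collected in front
  of \<open>DD\<close>.\<close>

lemma DD_conjugate:
  assumes "k \<in> carrier G" "x \<in> DD"
  shows "inv\<^bsub>E\<^esub> iota2 k \<otimes>\<^bsub>E\<^esub> x \<otimes>\<^bsub>E\<^esub> iota2 k \<in> DD"
  unfolding DD_def
proof (rule E.generate_conjugate[OF D_set_closed])
  show "x \<in> generate E {dcom g h | g h. g \<in> carrier G \<and> h \<in> carrier G}" using assms(2) by (simp add: DD_def)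
  fix s assume "s \<in> {dcom g h | g h. g \<in> carrier G \<and> h \<in> carrier G}"
  then obtain g h where gh: "g \<in> carrier G" "h \<in> carrier G" "s = dcom g h" by blast
  have "inv\<^bsub>E\<^esub> iota2 k \<otimes>\<^bsub>E\<^esub> s \<otimes>\<^bsub>E\<^esub> iota2 k = inv\<^bsub>E\<^esub> dcom g k \<otimes>\<^bsub>E\<^esub> dcom g (h \<otimes> k)"
    using gh assms(1) by (simp add: dcom_def commutator_def iota_mult E.inv_mult_group E.m_assoc E_canc)
  also have "\<dots> \<in> DD"
    using gh assms(1) dcom_DD subgroup_DD by (simp add: subgroup.m_closed subgroup.m_inv_closed)
  finally show "inv\<^bsub>E\<^esub> iota2 k \<otimes>\<^bsub>E\<^esub> s \<otimes>\<^bsub>E\<^esub> iota2 k \<in> generate E {dcom g h | g h. g \<in> carrier G \<and> h \<in> carrier G}"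
    by (simp add: DD_def)
qed (use assms in simp)

lemma letter_iota: "\<exists>g \<in> carrier G. ev_letter E \<epsilon> a = iota1 g \<or> ev_letter E \<epsilon> a = iota2 g"
proof -
  obtain y s where "a = (Inl y, s) \<or> a = (Inr y, s)" by (cases a rule: prod.exhaust) (metis sum.exhaust)
  then show ?thesis
    by (cases s) (auto simp: ev_letter_def \<epsilon>_def both_def iota_inv[symmetric])
qed

lemma E_decomp_LL: "\<exists>g \<in> carrier G. \<exists>l \<in> LL. ev E \<epsilon> w = iota1 g \<otimes>\<^bsub>E\<^esub> l"
proof (induction w)
  case Nil
  have "\<one>\<^bsub>E\<^esub> \<in> LL" by (rule subgroup.one_closed[OF subgroup_LL])
  moreover have "\<one>\<^bsub>E\<^esub> = iota1 \<one> \<otimes>\<^bsub>E\<^esub> \<one>\<^bsub>E\<^esub>" by (simp add: iota_one)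
  ultimately show ?case by (metis ev.simps(1) one_closed)
next
  case (Cons a w)
  then obtain h l where h: "h \<in> carrier G" and l: "l \<in> LL" and hl: "ev E \<epsilon> w = iota1 h \<otimes>\<^bsub>E\<^esub> l" by blast
  obtain g m where g: "g \<in> carrier G" and m: "m \<in> LL" and gm: "ev_letter E \<epsilon> a = iota1 g \<otimes>\<^bsub>E\<^esub> m"
  proof -
    from letter_iota obtain g where g: "g \<in> carrier G" "ev_letter E \<epsilon> a = iota1 g \<or> ev_letter E \<epsilon> a = iota2 g" by blast
    moreover have "iota1 g = iota1 g \<otimes>\<^bsub>E\<^esub> \<one>\<^bsub>E\<^esub>" "iota2 g = iota1 g \<otimes>\<^bsub>E\<^esub> lgen g"
      using g by (simp_all add: lgen_def E_canc)
    ultimately show thesis using that subgroup.one_closed[OF subgroup_LL] lgen_LL by metis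
  qed
  have "ev E \<epsilon> (a # w) = iota1 (g \<otimes> h) \<otimes>\<^bsub>E\<^esub> ((inv\<^bsub>E\<^esub> iota1 h \<otimes>\<^bsub>E\<^esub> m \<otimes>\<^bsub>E\<^esub> iota1 h) \<otimes>\<^bsub>E\<^esub> l)"
    using g h LL_closed[OF l] LL_closed[OF m] by (simp add: hl gm iota_mult E.m_assoc E_canc)
  moreover have "(inv\<^bsub>E\<^esub> iota1 h \<otimes>\<^bsub>E\<^esub> m \<otimes>\<^bsub>E\<^esub> iota1 h) \<otimes>\<^bsub>E\<^esub> l \<in> LL"
    by (rule subgroup.m_closed[OF subgroup_LL LL_conjugate[OF h m] l])
  ultimately show ?case using g h by blast
qed

lemma E_decomp_DD: "\<exists>g \<in> carrier G. \<exists>h \<in> carrier G. \<exists>d \<in> DD. ev E \<epsilon> w = iota1 g \<otimes>\<^bsub>E\<^esub> iota2 h \<otimes>\<^bsub>E\<^esub> d"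
proof (induction w)
  case Nil
  have "\<one>\<^bsub>E\<^esub> \<in> DD" by (rule subgroup.one_closed[OF subgroup_DD])
  moreover have "ev E \<epsilon> [] = iota1 \<one> \<otimes>\<^bsub>E\<^esub> iota2 \<one> \<otimes>\<^bsub>E\<^esub> \<one>\<^bsub>E\<^esub>" by (simp add: iota_one)
  ultimately show ?case by blast
next
  case (Cons a w)
  then obtain g h d where gh: "g \<in> carrier G" "h \<in> carrier G" and d: "d \<in> DD"
    and e: "ev E \<epsilon> w = iota1 g \<otimes>\<^bsub>E\<^esub> iota2 h \<otimes>\<^bsub>E\<^esub> d" by blast
  from letter_iota obtain x where x: "x \<in> carrier G" and cases: "ev_letter E \<epsilon> a = iota1 x \<or> ev_letter E \<epsilon> a = iota2 x" by blast
  from cases show ?case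
  proof
    assume "ev_letter E \<epsilon> a = iota1 x"
    then have "ev E \<epsilon> (a # w) = iota1 (x \<otimes> g) \<otimes>\<^bsub>E\<^esub> iota2 h \<otimes>\<^bsub>E\<^esub> d"
      using gh x DD_closed[OF d] by (simp add: e iota_mult E.m_assoc)
    then show ?thesis using gh x d by blast
  next
    assume a: "ev_letter E \<epsilon> a = iota2 x"
    \<comment> \<open>Moving \<open>iota2 x\<close> behind \<open>iota1 g\<close> creates the
      inverse of \<open>dcom g x\<close>, which is then carried past \<open>iota2 h\<close> by
      conjugation.\<close>
    let ?d = "inv\<^bsub>E\<^esub> iota2 h \<otimes>\<^bsub>E\<^esub> inv\<^bsub>E\<^esub> dcom g x \<otimes>\<^bsub>E\<^esub> iota2 h \<otimes>\<^bsub>E\<^esub> d"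
    have "ev E \<epsilon> (a # w) = iota1 g \<otimes>\<^bsub>E\<^esub> iota2 (x \<otimes> h) \<otimes>\<^bsub>E\<^esub> ?d"
      using gh x DD_closed[OF d]
      by (simp add: e a iota_mult dcom_def commutator_def E.inv_mult_group E.m_assoc E_canc)
    moreover have "?d \<in> DD"
      using DD_conjugate[OF gh(2)] subgroup.m_inv_closed[OF subgroup_DD dcom_DD[OF gh(1) x]]
        subgroup.m_closed[OF subgroup_DD _ d] by blast
    ultimately show ?thesis using gh x by blast
  qed
qed

end

section \<open>The kernel of \<theta> and its centralizer\<close>

locale E_theta = E_generated G Y \<gamma> for G :: "('a, 'b) monoid_scheme" (structure) and Y :: "'y set" and \<gamma> +
  fixes \<theta> :: "('a + 'a) word set set \<Rightarrow> 'a \<times> 'a \<times> 'a"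
  assumes \<theta>_hom: "\<theta> \<in> hom E G3" and \<theta>1: "g \<in> carrier G \<Longrightarrow> \<theta> (iota1 g) = (g, \<one>, g)"
    and \<theta>2: "g \<in> carrier G \<Longrightarrow> \<theta> (iota2 g) = (\<one>, g, g)"
begin

sublocale \<theta>: group_hom E G3 \<theta>
  using \<theta>_hom by (simp add: group_hom_def group_hom_axioms_def group_G3 E.is_group)

lemma \<theta>_dcom: "g \<in> carrier G \<Longrightarrow> h \<in> carrier G \<Longrightarrow> \<theta> (dcom g h) = (\<one>, \<one>, commutator G g h)"
  using E.commutator_hom[OF group_G3 \<theta>_hom] by (simp add: dcom_def \<theta>1 \<theta>2 commutator_G3)

lemma \<theta>_lgen: "k \<in> carrier G \<Longrightarrow> \<theta> (lgen k) = (inv k, k, \<one>)"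
  by (simp add: lgen_def \<theta>1 \<theta>2 inv_G3)

lemma \<theta>_LL: "l \<in> LL \<Longrightarrow> snd (snd (\<theta> l)) = \<one>"
  unfolding LL_def
proof (induction rule: generate.induct)
  case (inv h)
  then show ?case by (auto simp: \<theta>_lgen inv_G3)
next
  case (eng a b)
  then have "a \<in> carrier E" "b \<in> carrier E" using LL_closed by (auto simp: LL_def)
  then show ?case using eng by (simp add: mult_DirProd')
qed (auto simp: \<theta>_lgen)

lemma \<theta>_DD: "d \<in> DD \<Longrightarrow> fst (\<theta> d) = \<one> \<and> fst (snd (\<theta> d)) = \<one>"
  unfolding DD_def
proof (induction rule: generate.induct)
  case (inv h)
  then show ?case by (auto simp: \<theta>_dcom inv_G3)
next
  case (eng a b)
  then have "a \<in> carrier E" "b \<in> carrier E" using DD_closed by (auto simp: DD_def)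
  then show ?case using eng by (simp add: mult_DirProd')
qed (auto simp: \<theta>_dcom)

text \<open>The third coordinate identifies the copies: it kills \<open>LL\<close> and is the
  identity on the first copy, so it recovers the first factor of the decomposition.\<close>

lemma in_iota_LL: "x \<in> carrier E \<Longrightarrow> \<exists>l \<in> LL. x = iota1 (snd (snd (\<theta> x))) \<otimes>\<^bsub>E\<^esub> l"
proof -
  assume "x \<in> carrier E"
  then obtain w where "ev E \<epsilon> w = x" using \<epsilon>_gen by blast
  then obtain g l where gl: "g \<in> carrier G" "l \<in> LL" "x = iota1 g \<otimes>\<^bsub>E\<^esub> l" using E_decomp_LL[of w] by blast
  have lc: "l \<in> carrier E" by (rule LL_closed[OF gl(2)])
  have "snd (snd (\<theta> x)) = g \<otimes> snd (snd (\<theta> l))" using gl lc by (simp add: \<theta>1 mult_DirProd')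
  then have "snd (snd (\<theta> x)) = g" using gl \<theta>_LL by simp
  then show ?thesis using gl by blast
qed

lemma kernel_in_LL: "z \<in> carrier E \<Longrightarrow> \<theta> z = \<one>\<^bsub>G3\<^esub> \<Longrightarrow> z \<in> LL"
  using in_iota_LL[of z] LL_closed by (auto simp: iota_one)

text \<open>The first two coordinates kill \<open>DD\<close>, so they read off the factors
  \<open>g\<close> and \<open>h\<close> of the decomposition.\<close>

lemma kernel_in_DD:
  assumes "z \<in> carrier E" "\<theta> z = \<one>\<^bsub>G3\<^esub>"
  shows "z \<in> DD"
proof -
  obtain w where "ev E \<epsilon> w = z" using \<epsilon>_gen assms(1) by blast
  then obtain g h d where gh: "g \<in> carrier G" "h \<in> carrier G" "d \<in> DD" "z = iota1 g \<otimes>\<^bsub>E\<^esub> iota2 h \<otimes>\<^bsub>E\<^esub> d"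
    using E_decomp_DD[of w] by blast
  have d: "d \<in> carrier E" by (rule DD_closed[OF gh(3)])
  obtain a b c where abc: "\<theta> d = (a, b, c)" by (metis prod.exhaust)
  then have ab: "a = \<one>" "b = \<one>" using \<theta>_DD[OF gh(3)] by auto
  have "\<theta> z = (g \<otimes> a, h \<otimes> b, g \<otimes> h \<otimes> c)"
    using gh(1,2) d unfolding gh(4) by (simp add: \<theta>1 \<theta>2 abc)
  then have "g = \<one>" "h = \<one>" using assms(2) gh(1,2) by (auto simp: ab)
  then show ?thesis using gh(3,4) d by (simp add: iota_one)
qed

definition K where "K = derived G (carrier G)"

lemma K_subgroup: "subgroup K G"
  unfolding K_def by (rule derived_is_subgroup) simp

lemma K_closed: "k \<in> K \<Longrightarrow> k \<in> carrier G"
  using subgroup.subset[OF K_subgroup] by auto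

text \<open>\<open>derived_set\<close> is built from \<open>a b a^-1 b^-1\<close>; passing to
  inverses of the arguments gives the convention of \<open>commutator\<close>.\<close>

lemma derived_set_commutator:
  assumes "c \<in> derived_set G (carrier G)"
  obtains g h where "g \<in> carrier G" "h \<in> carrier G" "c = commutator G g h"
proof -
  obtain a b where "a \<in> carrier G" "b \<in> carrier G" "c = a \<otimes> b \<otimes> inv a \<otimes> inv b" using assms by blast
  then show thesis using that[of "inv a" "inv b"] by (simp add: commutator_def)
qed

text \<open>\<open>z\<close> lies in both \<open>DD\<close> and \<open>LL\<close>, which centralize
  each other, so it commutes with both. Commutators in the first copy factor through elements of
  \<open>LL\<close> and \<open>DD\<close>, so \<open>z\<close> commutes with the first copy of
  \<open>K\<close>, and \<open>t\<close> is a product of an element of that copy and one of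
  \<open>LL\<close>.\<close>

lemma kernel_commutes:
  assumes z: "z \<in> carrier E" "\<theta> z = \<one>\<^bsub>G3\<^esub>" and t: "t \<in> carrier E" "snd (snd (\<theta> t)) \<in> K"
  shows "z \<otimes>\<^bsub>E\<^esub> t = t \<otimes>\<^bsub>E\<^esub> z"
proof -
  have zL: "x \<otimes>\<^bsub>E\<^esub> z = z \<otimes>\<^bsub>E\<^esub> x" if "x \<in> LL" for x
    using DD_LL_commute[OF kernel_in_DD[OF z] that] by simp
  have zD: "x \<otimes>\<^bsub>E\<^esub> z = z \<otimes>\<^bsub>E\<^esub> x" if "x \<in> DD" for x
    using DD_LL_commute[OF that kernel_in_LL[OF z]] .
  have com: "iota1 (commutator G g h) \<otimes>\<^bsub>E\<^esub> z = z \<otimes>\<^bsub>E\<^esub> iota1 (commutator G g h)"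
    if gh: "g \<in> carrier G" "h \<in> carrier G" for g h
  proof -
    let ?m = "inv\<^bsub>E\<^esub> iota1 g \<otimes>\<^bsub>E\<^esub> lgen h \<otimes>\<^bsub>E\<^esub> iota1 g"
    have "iota1 (commutator G g h) = ?m \<otimes>\<^bsub>E\<^esub> dcom g h \<otimes>\<^bsub>E\<^esub> inv\<^bsub>E\<^esub> lgen h"
      using gh by (simp add: commutator_hom[OF E.is_group E_gen_hom(1)])
        (simp add: commutator_def dcom_def lgen_def E.inv_mult_group E.m_assoc E_canc)
    moreover have "?m \<in> LL" "inv\<^bsub>E\<^esub> lgen h \<in> LL" "dcom g h \<in> DD"
      using gh LL_conjugate lgen_LL dcom_DD subgroup.m_inv_closed[OF subgroup_LL] by auto
    ultimately show ?thesis
      using zL zD LL_closed DD_closed z(1) by (simp add: E.commute_mult)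
  qed
  have "iota1 k \<otimes>\<^bsub>E\<^esub> z = z \<otimes>\<^bsub>E\<^esub> iota1 k" if k: "k \<in> K" for k
  proof (rule E.generate_commute)
    have sub: "derived_set G (carrier G) \<subseteq> carrier G" by (rule derived_set_in_carrier) simp
    show "iota1 k \<in> generate E (iota1 ` derived_set G (carrier G))"
      using group_hom.generate_img[OF iota_group_hom(1) sub] k by (auto simp: K_def derived_def)
    show "iota1 ` derived_set G (carrier G) \<subseteq> carrier E" by (rule image_subsetI) (rule iota_closed(1)[OF subsetD[OF sub]])
    show "z \<in> carrier E" by fact
    fix s assume "s \<in> iota1 ` derived_set G (carrier G)"
    then obtain c where c: "s = iota1 c" "c \<in> derived_set G (carrier G)" by (rule imageE)
    obtain g h where "g \<in> carrier G" "h \<in> carrier G" "c = commutator G g h"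
      by (rule derived_set_commutator[OF c(2)])
    then show "s \<otimes>\<^bsub>E\<^esub> z = z \<otimes>\<^bsub>E\<^esub> s" using com c(1) by simp
  qed
  moreover obtain l where "l \<in> LL" "t = iota1 (snd (snd (\<theta> t))) \<otimes>\<^bsub>E\<^esub> l" using in_iota_LL[OF t(1)] by blast
  ultimately have "t \<otimes>\<^bsub>E\<^esub> z = z \<otimes>\<^bsub>E\<^esub> t"
    using E.commute_mult[of "iota1 (snd (snd (\<theta> t)))" l z] zL[of l] t(2) K_closed LL_closed z(1) by simp
  then show ?thesis ..
qed

lemma third_in_image: "k \<in> K \<Longrightarrow> \<exists>e \<in> carrier E. \<theta> e = (\<one>, \<one>, k)"
  unfolding K_def derived_def
proof (induction rule: generate.induct)
  case one
  then show ?case using \<theta>.hom_one by (intro bexI[of _ "\<one>\<^bsub>E\<^esub>"]) simp_all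
next
  have comm: "\<exists>e \<in> carrier E. \<theta> e = (\<one>, \<one>, c)" if c: "c \<in> derived_set G (carrier G)" for c
  proof -
    obtain g h where "g \<in> carrier G" "h \<in> carrier G" "c = commutator G g h" by (rule derived_set_commutator[OF c])
    then show ?thesis by (intro bexI[of _ "dcom g h"]) (simp_all add: \<theta>_dcom)
  qed
  {
    case (incl c)
    then show ?case by (rule comm)
  next
    case (inv c)
    have "c \<in> carrier G" using derived_set_in_carrier[of "carrier G"] inv by blast
    moreover obtain e where "e \<in> carrier E" "\<theta> e = (\<one>, \<one>, c)" using comm[OF inv] by blast
    ultimately show ?case by (intro bexI[of _ "inv\<^bsub>E\<^esub> e"]) (simp_all add: inv_G3)
  }
next
  case (eng a b)
  then obtain e f where "e \<in> carrier E" "\<theta> e = (\<one>, \<one>, a)" "f \<in> carrier E" "\<theta> f = (\<one>, \<one>, b)" by blast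
  then show ?case by (intro bexI[of _ "e \<otimes>\<^bsub>E\<^esub> f"]) simp_all
qed

lemma K3_in_image: "K \<times> K \<times> K \<subseteq> \<theta> ` carrier E"
proof
  fix x assume "x \<in> K \<times> K \<times> K"
  then obtain a b c where x: "x = (a, b, c)" and abc: "a \<in> K" "b \<in> K" "c \<in> K" by auto
  \<comment> \<open>\<open>iota1 a\<close> and \<open>iota2 b\<close> already contribute
    \<open>a b\<close> to the third coordinate; this is the correction, and it is supplied by
    commutators of the two copies.\<close>
  have "inv (a \<otimes> b) \<otimes> c \<in> K"
    using abc subgroup.m_closed[OF K_subgroup] subgroup.m_inv_closed[OF K_subgroup] by simp
  then obtain e where e: "e \<in> carrier E" "\<theta> e = (\<one>, \<one>, inv (a \<otimes> b) \<otimes> c)" using third_in_image by blast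
  have "(a \<otimes> b) \<otimes> (inv (a \<otimes> b) \<otimes> c) = c"
    using abc K_closed by (simp add: m_assoc[symmetric] r_inv)
  then have "\<theta> (iota1 a \<otimes>\<^bsub>E\<^esub> iota2 b \<otimes>\<^bsub>E\<^esub> e) = x"
    using abc e K_closed by (simp add: \<theta>1 \<theta>2 x)
  then show "x \<in> \<theta> ` carrier E"
    using abc e K_closed by (intro image_eqI[of _ _ "iota1 a \<otimes>\<^bsub>E\<^esub> iota2 b \<otimes>\<^bsub>E\<^esub> e"]) simp_all
qed

lemma K3_subgroup: "subgroup (K \<times> K \<times> K) G3"
  by (intro DirProd_subgroups is_group group_G2 K_subgroup)

text \<open>Chosen from the coset rather than from \<open>g\<close>, so that elements of one coset
  share their representative.\<close>

definition rp :: "'a \<Rightarrow> 'a" where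
  "rp g = (SOME h. h \<in> K #> g)"

lemma rp: "g \<in> carrier G \<Longrightarrow> rp g \<in> K #> g"
  unfolding rp_def using rcos_self[OF _ K_subgroup] by (rule someI)

lemma rp_closed: "g \<in> carrier G \<Longrightarrow> rp g \<in> carrier G"
  using rp r_coset_subset_G[OF subgroup.subset[OF K_subgroup]] by blast

lemma rp_coset: "g \<in> carrier G \<Longrightarrow> g \<otimes> inv rp g \<in> K"
proof -
  assume g: "g \<in> carrier G"
  then obtain k where k: "k \<in> K" "rp g = k \<otimes> g" using rp[OF g] by (auto simp: r_coset_def)
  then have "g \<otimes> inv rp g = inv k" using g K_closed by (simp add: inv_mult_group m_assoc[symmetric])
  then show ?thesis using k(1) subgroup.m_inv_closed[OF K_subgroup] by simp
qed

lemma rp_eq: "g \<in> carrier G \<Longrightarrow> h \<in> carrier G \<Longrightarrow> g \<otimes> inv h \<in> K \<Longrightarrow> rp g = rp h"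
proof -
  assume gh: "g \<in> carrier G" "h \<in> carrier G" "g \<otimes> inv h \<in> K"
  have "g = g \<otimes> inv h \<otimes> h" using gh by (simp add: m_assoc)
  then have "g \<in> K #> h" using gh(3) by (auto simp: r_coset_def)
  then have "K #> g = K #> h" using repr_independence[OF _ gh(2) K_subgroup] by simp
  then show ?thesis by (simp add: rp_def)
qed

lemma finite_rp:
  assumes "finite (carrier (G Mod K))"
  shows "finite (rp ` carrier G)"
proof -
  have "rp ` carrier G = (\<lambda>C. SOME h. h \<in> C) ` carrier (G Mod K)"
    by (auto simp: carrier_FactGroup rp_def image_image)
  then show ?thesis using assms by simp
qed

end


section \<open>Filling words in \<open>G \<times> G \<times> G\<close>\<close>

text \<open>The relator has the shape in which \<open>fill_swap\<close> inserts it in front of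
  \<open>a b\<close>: after cancellation \<open>b a\<close> remains.\<close>

definition swapping :: "('y \<times> nat) word set \<Rightarrow> 'y set \<Rightarrow> bool" where
  "swapping R Y \<longleftrightarrow> (\<forall>a b. fst (fst a) \<in> Y \<longrightarrow> fst (fst b) \<in> Y \<longrightarrow> snd (fst a) < 3 \<longrightarrow> snd (fst b) < 3 \<longrightarrow>
     snd (fst a) \<noteq> snd (fst b) \<longrightarrow> [b, a, inv_letter b, inv_letter a] \<in> R)"

lemma swappingD: "swapping R Y \<Longrightarrow> fst (fst a) \<in> Y \<Longrightarrow> fst (fst b) \<in> Y \<Longrightarrow> snd (fst a) < 3 \<Longrightarrow>
    snd (fst b) < 3 \<Longrightarrow> snd (fst a) \<noteq> snd (fst b) \<Longrightarrow> [b, a, inv_letter b, inv_letter a] \<in> R"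
  by (simp only: swapping_def simp_thms)

definition colour_part :: "nat \<Rightarrow> ('y \<times> nat) word \<Rightarrow> ('y \<times> nat) word" where
  "colour_part i w = filter (\<lambda>a. snd (fst a) = i) w"

lemma fill_swap:
  assumes "[b, a, inv_letter b, inv_letter a] \<in> R" "fill R k (u @ b # a # v)"
  shows "fill R (Suc k) (u @ a # b # v)"
proof -
  have "fill R k ((u @ [b, a]) @ inv_letter b # inv_letter (inv_letter b) # v)"
    using fill_cancel[of R k "u @ [b, a]" v "inv_letter b"] assms(2) by simp
  then have "fill R k ((u @ [b, a, inv_letter b]) @ inv_letter a # inv_letter (inv_letter a) # b # v)"
    by (intro fill_cancel) simp
  then have "fill R k (u @ [b, a, inv_letter b, inv_letter a] @ a # b # v)" by simp
  from fill_insert[OF this assms(1)] show ?thesis by simp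
qed

lemma fill_move:
  assumes R: "swapping R Y" and a: "fst a \<in> Y \<times> {..<3}"
  shows "x \<in> words (Y \<times> {..<3}) \<Longrightarrow> (\<And>b. b \<in> set x \<Longrightarrow> snd (fst b) \<noteq> snd (fst a)) \<Longrightarrow>
    fill R k (u @ x @ a # v) \<Longrightarrow> fill R (k + length x) (u @ a # x @ v)"
proof (induction x arbitrary: u)
  case (Cons b x)
  have "fill R (k + length x) ((u @ [b]) @ a # x @ v)"
    using Cons.prems by (intro Cons.IH) auto
  moreover have "[b, a, inv_letter b, inv_letter a] \<in> R"
    using a Cons.prems(1) Cons.prems(2)[of b] by (intro swappingD[OF R]) (auto simp: mem_Times_iff)
  ultimately show ?case using fill_swap[of b a R "k + length x" u "x @ v"] by simp
qed simp

text \<open>Insertion sort by colour: the first letter crosses only letters of smaller colour, at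
  most \<open>length w\<close> of them, and each crossing costs one relator.\<close>

lemma fill_sort:
  assumes R: "swapping R Y"
  shows "w \<in> words (Y \<times> {..<3}) \<Longrightarrow>
    fill R k (u @ colour_part 0 w @ colour_part 1 w @ colour_part 2 w) \<Longrightarrow> fill R (k + (length w)\<^sup>2) (u @ w)"
proof (induction w arbitrary: u k)
  case (Cons a w)
  let ?p = "\<lambda>i. colour_part i w"
  have len: "length (?p 0) + length (?p 1) \<le> length w"
  proof -
    have "length (?p 0) + length (?p 1) \<le> length (filter (\<lambda>a. snd (fst a) = 0) w) + length (filter (\<lambda>a. snd (fst a) \<noteq> 0) w)"
      unfolding colour_part_def by (induction w) auto
    then show ?thesis using sum_length_filter_compl[of "\<lambda>a. snd (fst a) = 0" w] by simp
  qed
  have pw: "?p i \<in> words (Y \<times> {..<3})" for i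
    using Cons.prems(1) by (auto simp: words_def colour_part_def)
  have a: "fst a \<in> Y \<times> {..<3}" using Cons.prems by simp
  then have "snd (fst a) < 3" by auto
  then have "snd (fst a) = 0 \<or> snd (fst a) = 1 \<or> snd (fst a) = 2" by arith
  then have "fill R (k + length w) ((u @ [a]) @ ?p 0 @ ?p 1 @ ?p 2)"
  proof (elim disjE)
    assume 0: "snd (fst a) = 0"
    then have "fill R k ((u @ [a]) @ ?p 0 @ ?p 1 @ ?p 2)"
      using Cons.prems(2) by (simp add: colour_part_def)
    then show ?thesis by (rule fill_mono) simp
  next
    assume 1: "snd (fst a) = 1"
    then have "fill R k (u @ ?p 0 @ a # ?p 1 @ ?p 2)"
      using Cons.prems(2) by (simp add: colour_part_def)
    then have "fill R (k + length (?p 0)) (u @ a # ?p 0 @ ?p 1 @ ?p 2)"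
      by (intro fill_move[OF R a pw]) (use 1 in \<open>auto simp: colour_part_def\<close>)
    then have "fill R (k + length w) (u @ a # ?p 0 @ ?p 1 @ ?p 2)"
      by (rule fill_mono) (use len in simp)
    then show ?thesis by simp
  next
    assume 2: "snd (fst a) = 2"
    then have "fill R k (u @ (?p 0 @ ?p 1) @ a # ?p 2)"
      using Cons.prems(2) by (simp add: colour_part_def)
    then have "fill R (k + length (?p 0 @ ?p 1)) (u @ a # (?p 0 @ ?p 1) @ ?p 2)"
      by (intro fill_move[OF R a]) (use 2 pw in \<open>auto simp: colour_part_def\<close>)
    then have "fill R (k + length w) (u @ a # (?p 0 @ ?p 1) @ ?p 2)"
      by (rule fill_mono) (use len in simp)
    then show ?thesis by simp
  qed
  from Cons.IH[OF _ this] Cons.prems(1)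
  have "fill R (k + length w + (length w)\<^sup>2) (u @ a # w)" by simp
  then show ?case by (rule fill_mono) (simp add: power2_eq_square)
qed (simp add: colour_part_def)

lemma (in group) ev_commutator_letters:
  assumes f: "f \<in> UNIV \<rightarrow> carrier G" and ab: "f (fst a) \<otimes> f (fst b) = f (fst b) \<otimes> f (fst a)"
  shows "ev G f [b, a, inv_letter b, inv_letter a] = \<one>"
proof -
  have fc: "f x \<in> carrier G" for x using f by auto
  have cl: "ev_letter G f x \<in> carrier G" for x by (rule ev_letter_closed[OF f]) simp
  have "ev_letter G f a \<otimes> f (fst b) = f (fst b) \<otimes> ev_letter G f a"
    using ab commute_inv[OF fc fc ab] by (simp add: ev_letter_def)
  then have "ev_letter G f b \<otimes> ev_letter G f a = ev_letter G f a \<otimes> ev_letter G f b"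
    using commute_inv[OF fc cl, of "fst b" a] by (simp add: ev_letter_def[of _ _ b])
  moreover have "ev G f [b, a, inv_letter b, inv_letter a] =
      (ev_letter G f b \<otimes> ev_letter G f a) \<otimes> inv (ev_letter G f a \<otimes> ev_letter G f b)"
    using cl by (simp add: ev_letter_inv[OF f] inv_mult_group m_assoc)
  ultimately show ?thesis using cl by simp
qed

section \<open>Coloured letters for the cube of G, and fillings in E(G)\<close>

locale E_presented = E_theta G Y \<gamma> \<theta> + YS: relators Y S
  for G :: "('a, 'b) monoid_scheme" (structure) and Y :: "'y set" and \<gamma> \<theta> and S :: "'y word set" +
  assumes finite_S: "finite S"
    and triv: "w \<in> words Y \<Longrightarrow> ev G \<gamma> w = \<one> \<longleftrightarrow> reduce w \<in> normal_closure (free_group Y) S"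
    and finite_ab: "finite (carrier (G Mod K))"
begin

definition \<alpha> :: "'y \<times> nat \<Rightarrow> 'a \<times> 'a \<times> 'a" where
  "\<alpha> = (\<lambda>(y, i). (if i = 0 then \<gamma> y else \<one>, if i = 1 then \<gamma> y else \<one>, if i = 2 then \<gamma> y else \<one>))"

text \<open>Mirrors the values of \<theta> on the two copies of a generator.\<close>

definition \<iota> :: "'y + 'y \<Rightarrow> ('y \<times> nat) word" where
  "\<iota> = case_sum (\<lambda>y. [((y, 0), True), ((y, 2), True)]) (\<lambda>y. [((y, 1), True), ((y, 2), True)])"

definition colour :: "nat \<Rightarrow> 'y word \<Rightarrow> ('y \<times> nat) word" where
  "colour i = subst (\<lambda>y. [((y, i), True)])"

definition letters where "letters = Y \<times> {..<3 :: nat}"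

text \<open>A presentation of the direct cube. The rotations are taken because fillings obtained
  from areas in \<open>G\<close> use relators in this form.\<close>

definition Rel :: "('y \<times> nat) word set" where
  "Rel = (\<Union>i<3. colour i ` YS.rotations) \<union>
     (\<lambda>(a, b). [b, a, inv_letter b, inv_letter a]) `
       {(a, b) \<in> (letters \<times> UNIV) \<times> (letters \<times> UNIV). snd (fst a) \<noteq> snd (fst b)}"

lemma \<alpha>_closed: "\<alpha> \<in> UNIV \<rightarrow> carrier G3"
  by (auto simp: \<alpha>_def)

lemma ev_\<alpha>: "ev G3 \<alpha> w = (ev G (\<lambda>a. fst (\<alpha> a)) w, ev G (\<lambda>a. fst (snd (\<alpha> a))) w, ev G (\<lambda>a. snd (snd (\<alpha> a))) w)"
proof -
  have "(\<lambda>a. snd (\<alpha> a)) \<in> UNIV \<rightarrow> carrier (G \<times>\<times> G)" by (auto simp: \<alpha>_def)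
  then show ?thesis
    using ev_DirProd[OF is_group group_G2 \<alpha>_closed] ev_DirProd[OF is_group is_group] by simp
qed

lemma swapping_Rel: "swapping Rel Y"
  unfolding swapping_def
proof (intro allI impI)
  fix a b :: "('y \<times> nat) \<times> bool"
  assume "fst (fst a) \<in> Y" "fst (fst b) \<in> Y" "snd (fst a) < 3" "snd (fst b) < 3" "snd (fst a) \<noteq> snd (fst b)"
  then show "[b, a, inv_letter b, inv_letter a] \<in> Rel"
    unfolding Rel_def letters_def by (intro UnI2 image_eqI[of _ _ "(a, b)"]) (auto simp: mem_Times_iff)
qed

lemma finite_Rel: "finite Rel"
proof -
  have "finite ((letters \<times> (UNIV :: bool set)) \<times> (letters \<times> (UNIV :: bool set)))"
    using finite_Y by (simp add: letters_def)
  then have "finite {(a, b) \<in> (letters \<times> (UNIV :: bool set)) \<times> (letters \<times> (UNIV :: bool set)). snd (fst a) \<noteq> snd (fst b)}"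
    by (rule rev_finite_subset) auto
  then show ?thesis
    using YS.finite_rotations[OF finite_Y finite_S] by (simp add: Rel_def)
qed

lemma ev_rotations: "r \<in> YS.rotations \<Longrightarrow> ev G \<gamma> r = \<one>"
proof -
  have \<gamma>Y: "\<gamma> \<in> Y \<rightarrow> carrier G" by simp
  assume "r \<in> YS.rotations"
  then obtain n s where s: "s \<in> S \<union> (\<lambda>s. inv\<^bsub>YS.F\<^esub> s) ` S" and r: "r = rotate n (winv s)"
    unfolding YS.rotations_def by blast
  have N: "subgroup (normal_closure YS.F S) YS.F"
    by (rule normal_imp_subgroup[OF YS.F.normal_closure_normal[OF YS.relators]])
  have "s \<in> normal_closure YS.F S"
    using s YS.F.normal_closure_incl[OF YS.relators] subgroup.m_inv_closed[OF N] by blast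
  moreover have sc: "s \<in> carrier YS.F" using s by (rule YS.sym_relators)
  ultimately have "ev G \<gamma> s = \<one>" using triv[of s] by (simp add: carrier_free_group reduce_reduced)
  moreover have sw: "s \<in> words Y" using sc by (simp add: carrier_free_group)
  ultimately have ws: "ev G \<gamma> (winv s) = \<one>" by (simp add: ev_winv[OF \<gamma>Y])
  let ?m = "n mod length (winv s)"
  let ?p = "take ?m (winv s)" and ?q = "drop ?m (winv s)"
  have pq: "?p \<in> words Y" "?q \<in> words Y"
    using sw words_append[of ?p ?q Y] append_take_drop_id[of ?m "winv s"] winv_in_words[of s Y] by simp_all
  have "ev G \<gamma> ?p \<otimes> ev G \<gamma> ?q = \<one>"
    using ws ev_append[OF \<gamma>Y pq] by simp
  then have "ev G \<gamma> ?q \<otimes> ev G \<gamma> ?p = \<one>"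
    using inv_comm pq by simp
  then show ?thesis using ev_append[OF \<gamma>Y pq(2,1)] by (simp add: r rotate_drop_take)
qed

lemma colour_words: "w \<in> words Y \<Longrightarrow> i < 3 \<Longrightarrow> colour i w \<in> words letters"
  unfolding colour_def by (rule subst_in_words) (auto simp: letters_def)

lemma ev_colour:
  assumes "f \<in> UNIV \<rightarrow> carrier G"
  shows "ev G f (colour i w) = ev G (\<lambda>y. f (y, i)) w"
proof -
  have U: "v \<in> words UNIV" for v :: "'z word" by (simp add: words_def)
  have "f x \<in> carrier G" for x using assms by auto
  then show ?thesis
    unfolding colour_def ev_subst[OF assms U U] by (simp add: ev_letter_def)
qed

lemma \<alpha>_components: "(\<lambda>a. fst (\<alpha> a)) \<in> UNIV \<rightarrow> carrier G" "(\<lambda>a. fst (snd (\<alpha> a))) \<in> UNIV \<rightarrow> carrier G"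
    "(\<lambda>a. snd (snd (\<alpha> a))) \<in> UNIV \<rightarrow> carrier G"
  by (auto simp: \<alpha>_def)

lemma ev_const_one: "ev G (\<lambda>y. \<one>) w = \<one>"
  by (induction w) (auto simp: ev_letter_def)

lemma Rel_trivial: "r \<in> Rel \<Longrightarrow> r \<in> words letters \<and> ev G3 \<alpha> r = \<one>\<^bsub>G3\<^esub>"
proof -
  assume "r \<in> Rel"
  then consider i s where "i < 3" "s \<in> YS.rotations" "r = colour i s"
    | a b where "fst a \<in> letters" "fst b \<in> letters" "snd (fst a) \<noteq> snd (fst b)" "r = [b, a, inv_letter b, inv_letter a]"
    unfolding Rel_def by force
  then show ?thesis
  proof cases
    case 1
    have "ev G (\<lambda>y. if i = j then \<gamma> y else \<one>) s = \<one>" for j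
      using ev_rotations[OF 1(2)] by (cases "i = j") (simp_all add: ev_const_one)
    then have "ev G3 \<alpha> r = \<one>\<^bsub>G3\<^esub>"
      by (simp add: ev_\<alpha> 1(3) ev_colour[OF \<alpha>_components(1)] ev_colour[OF \<alpha>_components(2)]
          ev_colour[OF \<alpha>_components(3)]) (simp add: \<alpha>_def)
    then show ?thesis using 1 colour_words YS.rotations_words by auto
  next
    case 2
    obtain y i s where a: "a = ((y, i), s)" by (metis prod.exhaust)
    obtain y' j s' where b: "b = ((y', j), s')" by (metis prod.exhaust)
    have ij: "i \<noteq> j" "i < 3" "j < 3" using 2 a b by (auto simp: letters_def)
    then have "\<alpha> (y, i) \<otimes>\<^bsub>G3\<^esub> \<alpha> (y', j) = \<alpha> (y', j) \<otimes>\<^bsub>G3\<^esub> \<alpha> (y, i)"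
      by (auto simp: \<alpha>_def)
    then have "ev G3 \<alpha> r = \<one>\<^bsub>G3\<^esub>"
      unfolding 2(4) by (intro group.ev_commutator_letters[OF group_G3 \<alpha>_closed]) (simp add: a b)
    then show ?thesis using 2 by simp
  qed
qed

lemma \<iota>_ev: "b \<in> B \<Longrightarrow> \<iota> b \<in> words letters \<and> ev G3 \<alpha> (\<iota> b) = \<theta> (\<epsilon> b)"
proof -
  assume "b \<in> B"
  then obtain y where y: "y \<in> Y" "b = Inl y \<or> b = Inr y" by blast
  then show ?thesis
    by (auto simp: \<iota>_def letters_def ev_letter_def \<alpha>_def \<epsilon>_def both_def \<theta>1 \<theta>2)
qed

lemma uncolour: "w \<in> words letters \<Longrightarrow> \<exists>u \<in> words Y. colour_part i w = colour i u \<and> length u \<le> length w"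
proof (induction w)
  case Nil
  then show ?case by (intro bexI[of _ "[]"]) (simp_all add: colour_part_def colour_def)
next
  case (Cons a w)
  then obtain u where u: "u \<in> words Y" "colour_part i w = colour i u" "length u \<le> length w" by auto
  obtain y j s where a: "a = ((y, j), s)" by (metis prod.exhaust)
  show ?case
  proof (cases "j = i")
    case True
    then show ?thesis
      using u Cons.prems a by (intro bexI[of _ "(y, s) # u"])
        (auto simp: colour_part_def colour_def signed_def letters_def inv_letter_def)
  next
    case False
    then show ?thesis using u a by (intro bexI[of _ u]) (auto simp: colour_part_def)
  qed
qed

lemma ev_colour_part:
  assumes "f \<in> UNIV \<rightarrow> carrier G" "\<And>y j. j \<noteq> i \<Longrightarrow> f (y, j) = \<one>"
  shows "ev G f (colour_part i w) = ev G f w"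
proof (induction w)
  case (Cons a w)
  have U: "v \<in> words UNIV" for v :: "'z word" by (simp add: words_def)
  have "ev G f w \<in> carrier G" using ev_closed[OF assms(1) U] .
  moreover have "ev_letter G f a = \<one>" if "snd (fst a) \<noteq> i"
    using assms(2)[OF that, of "fst (fst a)"] by (simp add: ev_letter_def)
  ultimately show ?case using Cons by (auto simp: colour_part_def)
qed (simp add: colour_part_def)

text \<open>A trivial word is trivial in each coordinate, and its letters of one colour spell a
  trivial word over \<open>Y\<close> that is no longer. The Dehn function of \<open>G\<close> bounds
  the area of that word, and \<open>fill_area\<close> turns area into a filling.\<close>

lemma fill_colour_part:
  assumes w: "w \<in> words letters" "ev G3 \<alpha> w = \<one>\<^bsub>G3\<^esub>" and i: "i < 3" and n: "length w \<le> n"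
  shows "fill Rel (dehn Y S n) (colour_part i w)"
proof -
  obtain u where u: "u \<in> words Y" "colour_part i w = colour i u" "length u \<le> length w"
    using uncolour[OF w(1)] by blast
  have "ev G \<gamma> u = \<one>"
  proof -
    have comps: "ev G (\<lambda>a. fst (\<alpha> a)) w = \<one>" "ev G (\<lambda>a. fst (snd (\<alpha> a))) w = \<one>" "ev G (\<lambda>a. snd (snd (\<alpha> a))) w = \<one>"
      using w(2) by (simp_all add: ev_\<alpha>)
    define f where "f = (\<lambda>(y, j). if j = i then \<gamma> y else \<one>)"
    have f: "f \<in> UNIV \<rightarrow> carrier G" by (auto simp: f_def)
    have "f = (\<lambda>a. fst (\<alpha> a)) \<or> f = (\<lambda>a. fst (snd (\<alpha> a))) \<or> f = (\<lambda>a. snd (snd (\<alpha> a)))"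
    proof -
      have "i = 0 \<or> i = 1 \<or> i = 2" using i by arith
      then show ?thesis by (auto simp: f_def \<alpha>_def fun_eq_iff)
    qed
    then have "ev G f w = \<one>" using comps by auto
    then have "ev G f (colour i u) = \<one>"
      using ev_colour_part[OF f, of i w] by (simp add: u(2) f_def)
    then show ?thesis using ev_colour[OF f, of i u] by (simp add: f_def)
  qed
  then have "reduce u \<in> normal_closure YS.F S" using triv[OF u(1)] by simp
  then have "fill YS.rotations (dehn Y S n) u"
    using YS.area_le_dehn[OF finite_Y u(1)] u(3) n by (intro YS.fill_area) simp_all
  then have "fill Rel (dehn Y S n) (subst (\<lambda>y. [((y, i), True)]) u)"
    by (rule fill_subst[rotated]) (use i in \<open>auto simp: Rel_def colour_def\<close>)
  then show ?thesis by (simp add: u(2) colour_def)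
qed

lemma fill_G3:
  assumes w: "w \<in> words letters" "ev G3 \<alpha> w = \<one>\<^bsub>G3\<^esub>" and n: "length w \<le> n"
  shows "fill Rel (3 * dehn Y S n + n\<^sup>2) w"
proof -
  let ?d = "dehn Y S n"
  note f = fill_colour_part[OF w _ n]
  have "fill Rel (?d + (?d + ?d)) (colour_part 0 w @ colour_part 1 w @ colour_part 2 w)"
    by (intro fill_append f) simp_all
  then have "fill Rel (?d + (?d + ?d) + (length w)\<^sup>2) ([] @ w)"
    using w(1) by (intro fill_sort[OF swapping_Rel]) (simp_all add: letters_def)
  moreover have "(length w)\<^sup>2 \<le> n\<^sup>2" using n by (rule power_mono) simp
  ultimately show ?thesis by (auto intro: fill_mono)
qed

definition cl where "cl = (\<lambda>(a, b, c). (rp a, rp b, rp c))"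

sublocale V: virtually_central E G3 \<theta> "K \<times> K \<times> K" cl B \<epsilon> letters \<alpha> Rel \<iota>
proof (intro virtually_central.intro virtually_central_axioms.intro)
  show "group E" by (rule E.is_group)
  show "group G3" by (rule group_G3)
  show "\<theta> \<in> hom E G3" by (rule \<theta>_hom)
  show "subgroup (K \<times> K \<times> K) G3" by (rule K3_subgroup)
  show "K \<times> K \<times> K \<subseteq> \<theta> ` carrier E" by (rule K3_in_image)
  show "cl x \<in> carrier G3" if "x \<in> carrier G3" for x
    using that by (auto simp: cl_def rp_closed)
  show "x \<otimes>\<^bsub>G3\<^esub> inv\<^bsub>G3\<^esub> cl x \<in> K \<times> K \<times> K" if "x \<in> carrier G3" for x
    using that by (auto simp: cl_def rp_closed rp_coset inv_G3)
  show "cl x = cl y" if "x \<in> carrier G3" "y \<in> carrier G3" "x \<otimes>\<^bsub>G3\<^esub> inv\<^bsub>G3\<^esub> y \<in> K \<times> K \<times> K" for x y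
    using that by (auto simp: cl_def inv_G3 rp_eq)
  have "cl ` carrier G3 \<subseteq> rp ` carrier G \<times> rp ` carrier G \<times> rp ` carrier G"
    by (auto simp: cl_def)
  then show "finite (cl ` carrier G3)"
    by (rule finite_subset) (intro finite_cartesian_product finite_rp[OF finite_ab])
  show "z \<otimes>\<^bsub>E\<^esub> t = t \<otimes>\<^bsub>E\<^esub> z"
    if "z \<in> carrier E" "t \<in> carrier E" "\<theta> z = \<one>\<^bsub>G3\<^esub>" "\<theta> t \<in> K \<times> K \<times> K" for z t
    using that by (intro kernel_commutes) auto
  show "finite B" using finite_Y by simp
  show "\<epsilon> \<in> UNIV \<rightarrow> carrier E" by (rule \<epsilon>_closed)
  show "\<exists>w\<in>words B. ev E \<epsilon> w = g" if "g \<in> carrier E" for g using \<epsilon>_gen[OF that] .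
  show "finite letters" using finite_Y by (simp add: letters_def)
  show "\<alpha> \<in> UNIV \<rightarrow> carrier G3" by (rule \<alpha>_closed)
  show "finite Rel" by (rule finite_Rel)
  show "r \<in> words letters \<and> ev G3 \<alpha> r = \<one>\<^bsub>G3\<^esub>" if "r \<in> Rel" for r using Rel_trivial[OF that] .
  show "\<iota> b \<in> words letters \<and> ev G3 \<alpha> (\<iota> b) = \<theta> (\<epsilon> b)" if "b \<in> B" for b using \<iota>_ev[OF that] .
qed

text \<open>The factor 2 is the length of the image of a generator under \<iota>.\<close>

lemma E_filling:
  "\<exists>C m. \<forall>w \<in> words B. \<forall>n. ev E \<epsilon> w = \<one>\<^bsub>E\<^esub> \<longrightarrow> 2 * length w \<le> n \<longrightarrow>
     eqv (V.relations m) (C * (3 * dehn Y S n + n\<^sup>2 + n + 1)\<^sup>2) w []"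
proof -
  obtain C m where C: "\<And>w k. w \<in> words B \<Longrightarrow> ev E \<epsilon> w = \<one>\<^bsub>E\<^esub> \<Longrightarrow> fill Rel k (subst \<iota> w) \<Longrightarrow>
     eqv (V.relations m) (C * (k + length w + 1)\<^sup>2) w []"
    using V.quadratic_filling by blast
  have "eqv (V.relations m) (C * (3 * dehn Y S n + n\<^sup>2 + n + 1)\<^sup>2) w []"
    if w: "w \<in> words B" "ev E \<epsilon> w = \<one>\<^bsub>E\<^esub>" and n: "2 * length w \<le> n" for w n
  proof -
    have \<iota>w: "subst \<iota> w \<in> words letters" using subst_in_words[OF w(1), of \<iota> letters] \<iota>_ev by blast
    have "length (\<iota> b) \<le> 2" for b by (auto simp: \<iota>_def split: sum.split)
    then have len: "length (subst \<iota> w) \<le> n" using length_subst_le[OF w(1), of \<iota> 2] n by simp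
    have \<alpha>l: "\<alpha> \<in> letters \<rightarrow> carrier G3" using \<alpha>_closed by auto
    have "ev G3 \<alpha> (subst \<iota> w) = ev G3 (\<lambda>b. ev G3 \<alpha> (\<iota> b)) w"
      using group.ev_subst[OF group_G3 \<alpha>l _ w(1), of \<iota>] \<iota>_ev by blast
    also have "\<dots> = ev G3 (\<lambda>b. \<theta> (\<epsilon> b)) w" by (rule ev_cong[OF w(1)]) (use \<iota>_ev in blast)
    also have "\<dots> = \<theta> (ev E \<epsilon> w)" by (rule E.ev_hom[OF group_G3 \<theta>_hom \<epsilon>_closed, symmetric]) (simp add: words_def)
    also have "\<dots> = \<one>\<^bsub>G3\<^esub>" using w(2) \<theta>.hom_one by simp
    finally have "ev G3 \<alpha> (subst \<iota> w) = \<one>\<^bsub>G3\<^esub>" .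
    from C[OF w fill_G3[OF \<iota>w this len]] show ?thesis
      by (rule eqv_weaken) (use n in \<open>intro mult_le_mono2 power_mono, simp_all\<close>)
  qed
  then show ?thesis by blast
qed

end


section \<open>The Dehn function of \<open>\<E>(G)\<close>\<close>

text \<open>A trivial word over \<open>X\<close> is translated by \<open>s\<close> into
  \<open>B\<close>, filled there, and the derivation is translated back by \<open>t\<close>. Here
  \<open>a\<close> bounds the cost of a translated relator, \<open>b\<close> the length of
  \<open>s x\<close>, and \<open>c\<close> the cost of identifying a letter with its double
  translation.\<close>

lemma dehn_transfer:
  assumes E: "group E" and pres: "finite_presentation X R E"
    and \<epsilon>: "\<epsilon> \<in> UNIV \<rightarrow> carrier E" and gen: "\<And>g. g \<in> carrier E \<Longrightarrow> \<exists>w \<in> words B. ev E \<epsilon> w = g"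
    and P: "finite P" "\<And>p. p \<in> P \<Longrightarrow> p \<in> words B \<and> ev E \<epsilon> p = \<one>\<^bsub>E\<^esub>"
    and f: "\<And>w n. w \<in> words B \<Longrightarrow> ev E \<epsilon> w = \<one>\<^bsub>E\<^esub> \<Longrightarrow> length w \<le> n \<Longrightarrow> eqv P (f n) w []"
  shows "\<exists>a b c. \<forall>n. dehn X R n \<le> a * f (b * n) + c * n"
proof -
  interpret E: group E by fact
  interpret relators X R using pres by (simp add: relators_def finite_presentation_def)
  have finX: "finite X" using pres by (simp add: finite_presentation_def)
  obtain \<eta> where \<eta>: "\<eta> \<in> UNIV \<rightarrow> carrier E"
    and surj: "\<And>g. g \<in> carrier E \<Longrightarrow> \<exists>w \<in> words X. ev E \<eta> w = g"
    and triv: "\<And>w. w \<in> words X \<Longrightarrow> ev E \<eta> w = \<one>\<^bsub>E\<^esub> \<longleftrightarrow> reduce w \<in> normal_closure F R"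
    using finite_presentationE[OF E pres] by metis
  have U: "v \<in> words UNIV" for v :: "'z word" by (simp add: words_def)
  have "\<exists>w \<in> words B. ev E \<epsilon> w = \<eta> x" for x using gen \<eta> by blast
  then obtain s where s: "\<And>x. s x \<in> words B" "\<And>x. ev E \<epsilon> (s x) = \<eta> x" by metis
  have "\<exists>w \<in> words X. ev E \<eta> w = \<epsilon> b" for b using surj \<epsilon> by blast
  then obtain t where t: "\<And>b. t b \<in> words X" "\<And>b. ev E \<eta> (t b) = \<epsilon> b" by metis
  have evs: "ev E \<epsilon> (subst s w) = ev E \<eta> w" for w
    using E.ev_subst[OF \<epsilon> U U, of s w] s by simp
  have evt: "ev E \<eta> (subst t w) = ev E \<epsilon> w" for w
    using E.ev_subst[OF \<eta> U U, of t w] t by simp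
  have complete: "\<exists>k. eqv R k w []" if "w \<in> words X" "ev E \<eta> w = \<one>\<^bsub>E\<^esub>" for w
  proof -
    have "reduce w \<in> normal_closure F R" using triv[OF that(1)] that(2) by simp
    then obtain k where "eqv R k (reduce w) []" using normal_closure_eqv by blast
    then show ?thesis using eqv_trans[OF eqv_reduce[of R w]] by blast
  qed
  have "\<forall>p \<in> P. \<exists>k. eqv R k (subst t p) []"
    using P(2) complete subst_in_words[of _ B t X] t evt by simp
  then obtain kp where kp: "\<And>p. p \<in> P \<Longrightarrow> eqv R (kp p) (subst t p) []" by metis
  obtain a where a: "\<And>p. p \<in> P \<Longrightarrow> kp p \<le> a"
    using P(1) finite_nat_set_iff_bounded_le[of "kp ` P"] by auto
  have "\<exists>k. eqv R k [(x, True)] (subst t (s x))" if xX: "x \<in> X" for x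
  proof -
    have "subst t (s x) \<in> words X" using subst_in_words[OF s(1)] t by blast
    moreover have "\<eta> x \<in> carrier E" using \<eta> by auto
    ultimately obtain k where "eqv R k (winv (subst t (s x)) @ [(x, True)]) []"
      using complete[of "winv (subst t (s x)) @ [(x, True)]"] xX
      by (auto simp: E.ev_append[OF \<eta> U U] E.ev_winv[OF \<eta> U] evt s ev_letter_def)
    then show ?thesis by (auto simp: eqv_move_winv)
  qed
  then obtain kx where kx: "\<And>x. x \<in> X \<Longrightarrow> eqv R (kx x) [(x, True)] (subst t (s x))" by metis
  obtain c where c: "\<And>x. x \<in> X \<Longrightarrow> kx x \<le> c"
    using finX finite_nat_set_iff_bounded_le[of "kx ` X"] by auto
  obtain b where b: "\<And>x. x \<in> X \<Longrightarrow> length (s x) \<le> b"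
    using finX finite_nat_set_iff_bounded_le[of "(\<lambda>x. length (s x)) ` X"] by auto
  have "dehn X R n \<le> a * f (b * n) + c * n" for n
  proof (rule dehn_leI[OF finX])
    fix w assume "w \<in> trivial_le n"
    then have w: "w \<in> words X" "reduce w = w" "w \<in> normal_closure F R" "length w \<le> n"
      by (auto simp: trivial_le_def carrier_free_group reduce_reduced)
    have ew: "ev E \<eta> w = \<one>\<^bsub>E\<^esub>" using triv[OF w(1)] w(2,3) by simp
    have "length (subst s w) \<le> b * n"
      using le_trans[OF length_subst_le[OF w(1) b] mult_le_mono2[OF w(4), of b]] by simp
    then have "eqv P (f (b * n)) (subst s w) []"
      using f[of "subst s w" "b * n"] subst_in_words[OF w(1), of s B] s evs ew by simp
    then have "eqv R (a * f (b * n)) (subst t (subst s w)) (subst t [])"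
      by (rule eqv_subst[rotated]) (use kp a eqv_weaken in blast)
    moreover have "eqv R c [(x, True)] (subst t (s x))" if "x \<in> X" for x
      using kx[OF that] c[OF that] by (rule eqv_weaken)
    then have "eqv R (c * length w) w (subst t (subst s w))"
      using eqv_subst_letters[OF _ w(1), of R c "\<lambda>x. subst t (s x)"] by (simp add: subst_subst)
    ultimately have "eqv R (c * length w + a * f (b * n)) w []" using eqv_trans by fastforce
    then have "area X R (reduce w) \<le> c * length w + a * f (b * n)"
      using w by (intro eqv_area) simp_all
    also have "\<dots> \<le> a * f (b * n) + c * n" using mult_le_mono2[OF w(4), of c] by simp
    finally show "area X R w \<le> a * f (b * n) + c * n" using w(2) by simp
  qed
  then show ?thesis by blast
qed

text \<open>From \<open>q <= q^2\<close> the left side is at most 9 times the square of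
  \<open>d + q^2 + 1\<close>, and the inequality \<open>three\<close> yields 27 times the sum of
  \<open>d^2\<close>, \<open>q^4\<close> and 1. The first two are each at most the maximum, whence
  54.\<close>

lemma quadratic_bound:
  fixes d q :: nat
  shows "(3 * d + q\<^sup>2 + q + 1)\<^sup>2 \<le> 54 * max (q ^ 4) (d\<^sup>2) + 27"
proof -
  have three: "(x + y + z)\<^sup>2 \<le> 3 * (x\<^sup>2 + y\<^sup>2 + z\<^sup>2)" for x y z :: nat
  proof -
    have "(int x + int y + int z)\<^sup>2 \<le> 3 * ((int x)\<^sup>2 + (int y)\<^sup>2 + (int z)\<^sup>2)"
      using sum_squares_ge_zero[of "int x - int y" "int y - int z"] zero_le_power2[of "int x - int z"]
      by (simp add: power2_eq_square algebra_simps)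
    then have "int ((x + y + z)\<^sup>2) \<le> int (3 * (x\<^sup>2 + y\<^sup>2 + z\<^sup>2))" by simp
    then show ?thesis by (simp only: of_nat_le_iff)
  qed
  have "q \<le> q\<^sup>2" by (simp add: power2_eq_square)
  then have "(3 * d + q\<^sup>2 + q + 1)\<^sup>2 \<le> (3 * (d + q\<^sup>2 + 1))\<^sup>2" by (intro power_mono) simp_all
  also have "\<dots> = 9 * (d + q\<^sup>2 + 1)\<^sup>2" by (simp only: power_mult_distrib) simp
  also have "\<dots> \<le> 9 * (3 * (d\<^sup>2 + (q\<^sup>2)\<^sup>2 + 1\<^sup>2))" using three[of d "q\<^sup>2" 1] by (intro mult_le_mono2) simp
  also have "\<dots> = 27 * (d\<^sup>2 + q ^ 4) + 27" by simp
  also have "d\<^sup>2 + q ^ 4 \<le> 2 * max (q ^ 4) (d\<^sup>2)" by simp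
  finally show ?thesis by simp
qed

theorem propositionJ:
  fixes G :: "('a, 'b) monoid_scheme"
    and X :: "'x set" and R :: "'x word set"
    and Y :: "'y set" and S :: "'y word set"
  assumes "group G"
    and "finitely_presented (E_group G)"
    and "finite_presentation X R (E_group G)"
    and "finite_presentation Y S G"
  shows "dehn X R \<preceq> (\<lambda>n. max (n ^ 4) ((dehn Y S n)\<^sup>2))"
proof -
  interpret E_construction G using assms(1) by (simp add: E_construction_def)
  have finY: "finite Y" "finite S" and YS: "relators Y S"
    using assms(4) by (simp_all add: finite_presentation_def relators_def)
  obtain \<gamma> where \<gamma>: "\<gamma> \<in> UNIV \<rightarrow> carrier G"
    and \<gamma>_gen: "\<And>g. g \<in> carrier G \<Longrightarrow> \<exists>w \<in> words Y. ev G \<gamma> w = g"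
    and triv: "\<And>w. w \<in> words Y \<Longrightarrow> ev G \<gamma> w = \<one>\<^bsub>G\<^esub> \<longleftrightarrow> reduce w \<in> normal_closure (free_group Y) S"
    using finite_presentationE[OF assms(1,4)] by metis
  interpret E_generated G Y \<gamma> by unfold_locales (use finY \<gamma> \<gamma>_gen in auto)
  obtain \<theta> where \<theta>: "\<theta> \<in> hom E G3" "\<And>g. g \<in> carrier G \<Longrightarrow> \<theta> (iota1 g) = (g, \<one>\<^bsub>G\<^esub>, g)"
    "\<And>g. g \<in> carrier G \<Longrightarrow> \<theta> (iota2 g) = (\<one>\<^bsub>G\<^esub>, g, g)" using theta_exists by blast
  interpret E_theta G Y \<gamma> \<theta> by unfold_locales (use \<theta> in auto)
  interpret K: normal K G unfolding K_def by (rule derived_self_is_normal)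
  have "finite (carrier (G Mod K))"
  proof (rule finite_quotient[OF assms(3)])
    show "comm_group (G Mod K)" unfolding K_def by (rule derived_quot_is_comm_group)
    show "(\<lambda>x. K #>\<^bsub>G\<^esub> x) \<in> hom G (G Mod K)" by (rule K.r_coset_hom_Mod)
    show "(\<lambda>x. K #>\<^bsub>G\<^esub> x) ` carrier G = carrier (G Mod K)" by (simp add: carrier_FactGroup)
  qed
  then interpret E_presented G Y \<gamma> \<theta> S
    by (intro E_presented.intro E_presented_axioms.intro E_theta_axioms YS finY(2) triv)
  let ?g = "\<lambda>n. max (n ^ 4) ((dehn Y S n)\<^sup>2)"
  obtain C m where C: "\<And>w n. w \<in> words B \<Longrightarrow> ev E \<epsilon> w = \<one>\<^bsub>E\<^esub> \<Longrightarrow> 2 * length w \<le> n \<Longrightarrow>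
     eqv (V.relations m) (C * (3 * dehn Y S n + n\<^sup>2 + n + 1)\<^sup>2) w []"
    using E_filling by blast
  \<comment> \<open>\<open>2 * n\<close> because \<open>E_filling\<close> takes a bound on twice the
    length of the word.\<close>
  let ?f = "\<lambda>n. C * (3 * dehn Y S (2 * n) + (2 * n)\<^sup>2 + 2 * n + 1)\<^sup>2"
  have "\<exists>a b c. \<forall>n. dehn X R n \<le> a * ?f (b * n) + c * n"
  proof (rule dehn_transfer[OF E.is_group assms(3) \<epsilon>_closed \<epsilon>_gen])
    show "finite (V.relations m)"
      unfolding V.relations_def
      by (rule finite_subset[OF _ finite_words_le[of B m]]) (use finY in auto)
    show "p \<in> words B \<and> ev E \<epsilon> p = \<one>\<^bsub>E\<^esub>" if "p \<in> V.relations m" for p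
      using that by (simp add: V.relations_def)
    show "eqv (V.relations m) (?f n) w []"
      if "w \<in> words B" "ev E \<epsilon> w = \<one>\<^bsub>E\<^esub>" "length w \<le> n" for w n
      using that by (intro C) simp_all
  qed
  then obtain a b c where "\<forall>n. dehn X R n \<le> a * ?f (b * n) + c * n" by (elim exE)
  then have abc: "dehn X R n \<le> a * ?f (b * n) + c * n" for n by (rule spec)
  \<comment> \<open>\<open>54 * a * C\<close> covers both constants of
    \<open>quadratic_bound\<close>, \<open>2 * b\<close> makes the argument
    \<open>2 * (b * n)\<close> at most \<open>D * n\<close>, \<open>c\<close> covers the linear
    term, and 1 makes \<open>D\<close> positive.\<close>
  define D where "D = 54 * a * C + 2 * b + c + 1"
  have "dehn X R n \<le> D * ?g (D * n + D) + D * n + D" for n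
  proof -
    let ?q = "2 * (b * n)"
    have q: "?q \<le> D * n + D" by (simp add: D_def algebra_simps)
    have "dehn Y S ?q \<le> dehn Y S (D * n + D)" by (rule YS.dehn_mono[OF finY(1) q])
    then have g: "?g ?q \<le> ?g (D * n + D)" using q by (intro max.mono power_mono) simp_all
    have "dehn X R n \<le> a * (C * (54 * ?g ?q + 27)) + c * n"
      using abc[of n] quadratic_bound[of "dehn Y S ?q" ?q]
      by (meson add_le_mono1 le_trans mult_le_mono2)
    also have "\<dots> \<le> a * (C * (54 * ?g (D * n + D) + 27)) + c * n"
      using g by (intro add_right_mono mult_le_mono2 add_mono) simp_all
    also have "\<dots> = 54 * a * C * ?g (D * n + D) + 27 * a * C + c * n" by (simp add: algebra_simps)
    also have "\<dots> \<le> D * ?g (D * n + D) + D * n + D"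
    proof -
      have "54 * a * C * ?g (D * n + D) \<le> D * ?g (D * n + D)" by (rule mult_right_mono) (simp_all add: D_def)
      moreover have "c * n \<le> D * n" by (rule mult_right_mono) (simp_all add: D_def)
      moreover have "27 * a * C \<le> D" by (simp add: D_def)
      ultimately show ?thesis by linarith
    qed
    finally show ?thesis .
  qed
  moreover have "D > 0" by (simp add: D_def)
  ultimately show ?thesis unfolding dehn_le_def by blast
qed

end
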